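(* Suppose that the polygonal domain $\Omega\subset\mathbb R^2$ is simply connected. Then the sequence $$\mathbb R\longrightarrow S_r^0(\mathcal T_h^{\rm ps})\xrightarrow{\ \operatorname{rot}\ }L_{r-1}^1(\mathcal T_h^{\rm ps})\xrightarrow{\ \operatorname{div}\ }\mathcal V_{r-2}^2(\mathcal T_h^{\rm ps})\longrightarrow0$$ is exact for every integer $r\ge2$, and the sequence $$\mathbb R\longrightarrow S_r^0(\mathcal T_h^{\rm ps})\xrightarrow{\ \operatorname{rot}\ }S_{r-1}^1(\mathcal T_h^{\rm ps})\xrightarrow{\ \operatorname{div}\ }L_{r-2}^2(\mathcal T_h^{\rm ps})\longrightarrow0$$ is exact for every integer $r\ge3$. (Exact means that the range of each map is the kernel of the succeeding map; the first map is the inclusion of constants.)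
   Context: Mesh. $\mathcal T_h$ is a (conforming) simplicial, shape-regular triangulation of the polygonal domain $\Omega$. Its Powell--Sabin refinement $\mathcal T_h^{\rm ps}$ is built as follows: select an interior point of each $T\in\mathcal T_h$ and connect it to the three vertices of $T$; connect by a segment the interior points of each pair of triangles of $\mathcal T_h$ sharing an edge; for each $T$ having an edge on $\partial\Omega$, connect the interior point of $T$ to an arbitrarily chosen (relatively interior) point of that edge. The interior points are assumed chosen so that the segment connecting the interior points of two adjacent triangles intersects (the relative interior of) their common edge. Thus each $T\in\mathcal T_h$ is split into six triangles, forming its local split $T^{\rm ps}$. $\mathcal M(\mathcal T_h^{\rm ps})$ is the set of points of intersection of the edges of $\mathcal T_h$ with the edges that adjoin interior points (including the chosen points on boundary edges). An interior $z\in\mathcal M(\mathcal T_h^{\rm ps})$ is a vertex of exactly four triangles $K_1,\dots,K_4$ of $\mathcal T_h^{\rm ps}$ (numbered cyclically around $z$), and one sets $$\theta_z(q)=\big|q|_{K_1}(z)-q|_{K_2}(z)+q|_{K_3}(z)-q|_{K_4}(z)\big|.$$ Local spaces. For scalar $q$, $\operatorname{rot}q=(\partial q/\partial x_2,-\partial q/\partial x_1)^\top$. For $T\in\mathcal T_h$, $V_r^2(T^{\rm ps})$ is the space of functions on $T$ that are polynomials of degree $\le r$ on each of the six triangles of $T^{\rm ps}$; $L_r^0(T^{\rm ps})=L_r^2(T^{\rm ps})=V_r^2(T^{\rm ps})\cap C(T)$; $L_r^1(T^{\rm ps})=[L_r^0(T^{\rm ps})]^2$; $S_r^0(T^{\rm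 ps})=\{v\in L_r^0(T^{\rm ps}):\operatorname{rot}v\in[C(T)]^2\}$; $S_r^1(T^{\rm ps})=\{v\in L_r^1(T^{\rm ps}):\operatorname{div}v\in C(T)\}$. Global spaces. $S_r^0(\mathcal T_h^{\rm ps})=\{q\in C^1(\Omega): q|_T\in S_r^0(T^{\rm ps})\ \forall T\in\mathcal T_h\}$; $S_r^1(\mathcal T_h^{\rm ps})=\{v\in[C(\Omega)]^2:\operatorname{div}v\in C(\Omega),\ v|_T\in S_r^1(T^{\rm ps})\ \forall T\in\mathcal T_h\}$; $L_r^1(\mathcal T_h^{\rm ps})=\{v\in[C(\Omega)]^2: v|_T\in L_r^1(T^{\rm ps})\ \forall T\in\mathcal T_h\}$; $L_r^2(\mathcal T_h^{\rm ps})=\{p\in C(\Omega): p|_T\in L_r^2(T^{\rm ps})\ \forall T\in\mathcal T_h\}$; $\mathcal V_r^2(\mathcal T_h^{\rm ps})=\{p\in L^2(\Omega): p|_T\in V_r^2(T^{\rm ps})\ \forall T\in\mathcal T_h,\ \theta_z(p)=0\text{ for all interior nodes }z\in\mathcal M(\mathcal T_h^{\rm ps})\}$. *)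

theory Defs
  imports "HOL-Analysis.Analysis"
begin

type_synonym pt = "real^2"


section \<open>Domain, mesh and Powell--Sabin refinement\<close>

text \<open>The condition \<open>interior (closure \<Omega>) = \<Omega>\<close> excludes slits.\<close>

definition polygonal_domain :: "pt set \<Rightarrow> bool" where
  "polygonal_domain \<Omega> \<longleftrightarrow>
     open \<Omega> \<and> connected \<Omega> \<and> \<Omega> \<noteq> {} \<and> bounded \<Omega> \<and> interior (closure \<Omega>) = \<Omega> \<and>
     (\<exists>E. finite E \<and> frontier \<Omega> = (\<Union>(a, b)\<in>E. closed_segment a b))"

text \<open>Conformity (two triangles meet in a common, possibly empty, face) is part of
  \<^const>\<open>triangulation\<close>.\<close>

definition conforming_mesh :: "pt set \<Rightarrow> pt set set \<Rightarrow> bool" where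
  "conforming_mesh \<Omega> \<T> \<longleftrightarrow> triangulation \<T> \<and> (\<forall>T\<in>\<T>. 2 simplex T) \<and> \<Union>\<T> = closure \<Omega>"

definition shape_regular :: "real \<Rightarrow> pt set set \<Rightarrow> bool" where
  "shape_regular \<sigma> \<T> \<longleftrightarrow> (\<forall>T\<in>\<T>. \<exists>y \<rho>. 0 < \<rho> \<and> cball y \<rho> \<subseteq> T \<and> diameter T \<le> \<sigma> * \<rho>)"

text \<open>\<open>c T\<close> is the chosen interior point of \<open>T\<close>.  \<open>m e\<close> is the point splitting the edge \<open>e\<close>:
  if \<open>e\<close> is shared by \<open>T\<close> and \<open>T'\<close> it is the intersection of \<open>e\<close> with the segment
  joining \<open>c T\<close> and \<open>c T'\<close>, which is assumed to meet the relative interior of \<open>e\<close>; if \<open>e\<close> is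
  a boundary edge it is an arbitrary point of the relative interior.\<close>

definition powell_sabin ::
    "pt set \<Rightarrow> pt set set \<Rightarrow> (pt set \<Rightarrow> pt) \<Rightarrow> (pt set \<Rightarrow> pt) \<Rightarrow> bool" where
  "powell_sabin \<Omega> \<T> c m \<longleftrightarrow>
     (\<forall>T\<in>\<T>. c T \<in> interior T) \<and>
     (\<forall>T\<in>\<T>. \<forall>T'\<in>\<T>. \<forall>e. T \<noteq> T' \<and> e edge_of T \<and> e edge_of T' \<longrightarrow>
        closed_segment (c T) (c T') \<inter> rel_interior e = {m e}) \<and>
     (\<forall>T\<in>\<T>. \<forall>e. e edge_of T \<and> e \<subseteq> frontier \<Omega> \<longrightarrow> m e \<in> rel_interior e)"

definition ps_split :: "(pt set \<Rightarrow> pt) \<Rightarrow> (pt set \<Rightarrow> pt) \<Rightarrow> pt set \<Rightarrow> pt set set" where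
  "ps_split c m T = {convex hull {c T, a, m e} | a e. e edge_of T \<and> a extreme_point_of e}"

definition ps_mesh :: "(pt set \<Rightarrow> pt) \<Rightarrow> (pt set \<Rightarrow> pt) \<Rightarrow> pt set set \<Rightarrow> pt set set" where
  "ps_mesh c m \<T> = (\<Union>T\<in>\<T>. ps_split c m T)"

definition ps_edge_points :: "(pt set \<Rightarrow> pt) \<Rightarrow> pt set set \<Rightarrow> pt set" where
  "ps_edge_points m \<T> = {m e | e T. T \<in> \<T> \<and> e edge_of T}"


section \<open>Piecewise defined functions\<close>

text \<open>Functions on a set \<open>S\<close> are total functions whose values outside \<open>S\<close> are ignored.
  Derivatives of continuous piecewise polynomials and elements of \<open>L\<^sup>2\<close> are
  determined only almost everywhere; \<open>ae_class S f\<close> is the class of \<open>f\<close> modulo equality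
  almost everywhere on \<open>S\<close>.\<close>

definition ae_class :: "pt set \<Rightarrow> (pt \<Rightarrow> 'b) \<Rightarrow> (pt \<Rightarrow> 'b) set" where
  "ae_class S f = {g. AE x in lebesgue_on S. g x = f x}"

definition ae_continuous_on :: "pt set \<Rightarrow> (pt \<Rightarrow> 'b::topological_space) \<Rightarrow> bool" where
  "ae_continuous_on S f \<longleftrightarrow> (\<exists>g. continuous_on S g \<and> g \<in> ae_class S f)"

definition square_integrable_on :: "pt set \<Rightarrow> (pt \<Rightarrow> real) \<Rightarrow> bool" where
  "square_integrable_on S f \<longleftrightarrow>
     f \<in> borel_measurable (lebesgue_on S) \<and> integrable (lebesgue_on S) (\<lambda>x. (f x)\<^sup>2)"

text \<open>The derivatives are the classical ones. At points where the function is not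
  differentiable (for continuous piecewise polynomials, a null set) the values are irrelevant.\<close>

definition partial :: "2 \<Rightarrow> (pt \<Rightarrow> real) \<Rightarrow> pt \<Rightarrow> real" where
  "partial i q x = frechet_derivative q (at x) (axis i 1)"

definition rot :: "(pt \<Rightarrow> real) \<Rightarrow> pt \<Rightarrow> pt" where
  "rot q x = vector [partial 2 q x, - partial 1 q x]"

definition divergence :: "(pt \<Rightarrow> pt) \<Rightarrow> pt \<Rightarrow> real" where
  "divergence v x = (\<Sum>i\<in>UNIV. partial i (\<lambda>y. v y $ i) x)"

definition C1_on :: "pt set \<Rightarrow> (pt \<Rightarrow> real) \<Rightarrow> bool" where
  "C1_on S q \<longleftrightarrow> (\<forall>x\<in>S. q differentiable (at x)) \<and> (\<forall>i. continuous_on S (partial i q))"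

definition poly2 :: "nat \<Rightarrow> (pt \<Rightarrow> real) set" where
  "poly2 r = {\<lambda>x. \<Sum>(i, j)\<in>{(i, j). i + j \<le> r}. a i j * x $ 1 ^ i * x $ 2 ^ j | a. True}"


section \<open>Local spaces\<close>

text \<open>In this section \<open>\<K>\<close> is the local split of \<open>T\<close>. Agreement with a polynomial is
  required on the interior of each subtriangle, since the spaces \<open>V2\<close> contain discontinuous
  functions. For functions continuous on \<open>T\<close> it extends to the closed subtriangles.\<close>

definition V2 :: "nat \<Rightarrow> pt set set \<Rightarrow> (pt \<Rightarrow> real) set" where
  "V2 r \<K> = {q. \<forall>K\<in>\<K>. \<exists>p\<in>poly2 r. \<forall>x\<in>interior K. q x = p x}"

definition L0 :: "nat \<Rightarrow> pt set \<Rightarrow> pt set set \<Rightarrow> (pt \<Rightarrow> real) set" where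
  "L0 r T \<K> = {q \<in> V2 r \<K>. continuous_on T q}"

abbreviation L2 :: "nat \<Rightarrow> pt set \<Rightarrow> pt set set \<Rightarrow> (pt \<Rightarrow> real) set" where
  "L2 \<equiv> L0"

definition L1 :: "nat \<Rightarrow> pt set \<Rightarrow> pt set set \<Rightarrow> (pt \<Rightarrow> pt) set" where
  "L1 r T \<K> = {v. \<forall>i. (\<lambda>x. v x $ i) \<in> L0 r T \<K>}"

definition S0 :: "nat \<Rightarrow> pt set \<Rightarrow> pt set set \<Rightarrow> (pt \<Rightarrow> real) set" where
  "S0 r T \<K> = {q \<in> L0 r T \<K>. ae_continuous_on T (rot q)}"

definition S1 :: "nat \<Rightarrow> pt set \<Rightarrow> pt set set \<Rightarrow> (pt \<Rightarrow> pt) set" where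
  "S1 r T \<K> = {v \<in> L1 r T \<K>. ae_continuous_on T (divergence v)}"


section \<open>Global spaces\<close>

text \<open>A global function lives on the open set \<open>\<Omega>\<close>, a local one on the closed triangle \<open>T\<close>. So
  \<open>f\<close> restricted to \<open>T\<close> belongs to \<open>W\<close> when it extends from \<open>T \<inter> \<Omega>\<close> to an element of \<open>W\<close>.\<close>

definition restricts_to :: "pt set \<Rightarrow> pt set \<Rightarrow> (pt \<Rightarrow> 'b) \<Rightarrow> (pt \<Rightarrow> 'b) set \<Rightarrow> bool" where
  "restricts_to \<Omega> T f W \<longleftrightarrow> (\<exists>w\<in>W. \<forall>x\<in>T \<inter> \<Omega>. f x = w x)"

definition S0_ps where
  "S0_ps \<Omega> \<T> c m r =
     {q. C1_on \<Omega> q \<and> (\<forall>T\<in>\<T>. restricts_to \<Omega> T q (S0 r T (ps_split c m T)))}"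

definition S1_ps where
  "S1_ps \<Omega> \<T> c m r =
     {v. continuous_on \<Omega> v \<and> ae_continuous_on \<Omega> (divergence v) \<and>
         (\<forall>T\<in>\<T>. restricts_to \<Omega> T v (S1 r T (ps_split c m T)))}"

definition L1_ps where
  "L1_ps \<Omega> \<T> c m r =
     {v. continuous_on \<Omega> v \<and> (\<forall>T\<in>\<T>. restricts_to \<Omega> T v (L1 r T (ps_split c m T)))}"

definition L2_ps where
  "L2_ps \<Omega> \<T> c m r =
     {p. continuous_on \<Omega> p \<and> (\<forall>T\<in>\<T>. restricts_to \<Omega> T p (L2 r T (ps_split c m T)))}"

definition cyclic_numbering ::
    "pt set set \<Rightarrow> pt \<Rightarrow> pt set \<times> pt set \<times> pt set \<times> pt set \<Rightarrow> bool" where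
  "cyclic_numbering \<K> z = (\<lambda>(K1, K2, K3, K4).
     distinct [K1, K2, K3, K4] \<and> {K \<in> \<K>. z extreme_point_of K} = {K1, K2, K3, K4} \<and>
     (\<forall>(K, K')\<in>{(K1, K2), (K2, K3), (K3, K4), (K4, K1)}.
        (K \<inter> K') edge_of K \<and> (K \<inter> K') edge_of K'))"

text \<open>The value at \<open>z\<close> of the restriction of \<open>q\<close> to \<open>K\<close>, as the limit from the interior of
  \<open>K\<close>.\<close>

definition value_from :: "pt set \<Rightarrow> (pt \<Rightarrow> real) \<Rightarrow> pt \<Rightarrow> real" where
  "value_from K q z = Lim (at z within interior K) q"

text \<open>The result does not depend on which cyclic numbering is chosen: two of them differ by a
  rotation or reflection, which changes at most the sign of the alternating sum.\<close>

definition theta :: "pt set set \<Rightarrow> pt \<Rightarrow> (pt \<Rightarrow> real) \<Rightarrow> real" where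
  "theta \<K> z q = (case SOME Ks. cyclic_numbering \<K> z Ks of (K1, K2, K3, K4) \<Rightarrow>
     \<bar>value_from K1 q z - value_from K2 q z + value_from K3 q z - value_from K4 q z\<bar>)"

definition V2_ps where
  "V2_ps \<Omega> \<T> c m r =
     {p. square_integrable_on \<Omega> p \<and>
         (\<forall>T\<in>\<T>. restricts_to \<Omega> T p (V2 r (ps_split c m T))) \<and>
         (\<forall>z\<in>ps_edge_points m \<T> \<inter> \<Omega>. theta (ps_mesh c m \<T>) z p = 0)}"


section \<open>Exactness\<close>

text \<open>Exactness at \<open>B\<close> of \<open>A \<rightarrow> B \<rightarrow> \<dots>\<close> with maps \<open>f\<close> and \<open>g\<close>, functions on \<open>\<Omega>\<close> being
  identified when they agree almost everywhere (for functions continuous on the open set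
  \<open>\<Omega>\<close> this means equality on \<open>\<Omega>\<close>).\<close>

definition exact_at ::
    "pt set \<Rightarrow> 'a set \<Rightarrow> ('a \<Rightarrow> pt \<Rightarrow> 'b) \<Rightarrow> (pt \<Rightarrow> 'b) set \<Rightarrow> ((pt \<Rightarrow> 'b) \<Rightarrow> pt \<Rightarrow> 'c::zero) \<Rightarrow> bool"
  where
  "exact_at \<Omega> A f B g \<longleftrightarrow>
     (\<lambda>u. ae_class \<Omega> (f u)) ` A =
     ae_class \<Omega> ` {v \<in> B. ae_class \<Omega> (g v) = ae_class \<Omega> (\<lambda>_. 0)}"

text \<open>Exactness of the sequence from the constants through \<open>S\<close>, \<open>L\<close> and \<open>V\<close> to zero, with the
  maps inclusion, \<^const>\<open>rot\<close>, \<^const>\<open>divergence\<close> and the zero map.\<close>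

definition exact_rot_div ::
    "pt set \<Rightarrow> (pt \<Rightarrow> real) set \<Rightarrow> (pt \<Rightarrow> pt) set \<Rightarrow> (pt \<Rightarrow> real) set \<Rightarrow> bool" where
  "exact_rot_div \<Omega> S L V \<longleftrightarrow>
     exact_at \<Omega> (UNIV :: real set) (\<lambda>a _. a) S rot \<and>
     exact_at \<Omega> S rot L divergence \<and>
     exact_at \<Omega> L divergence V (\<lambda>_ _. 0 :: real)"

end

theory Submission
  imports Defs "HOL-Complex_Analysis.Riemann_Mapping"
begin

text \<open>
  Kernel of the divergence.  A divergence-free continuous piecewise polynomial field \<open>v\<close> has a polynomial
  potential \<open>q\<^sub>K\<close> on each triangle \<open>K\<close>, and the differences \<open>q\<^sub>K y - q\<^sub>K x\<close> fit together to a primitive of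
  \<open>- v\<^sub>2 dx\<^sub>1 + v\<^sub>1 dx\<^sub>2\<close> near every point \<open>x\<close>.  A simply connected plane domain is contractible, and continuing
  these local primitives along the paths of a contraction gives a global one.

  Range of the divergence.  Work modulo divergences of continuous fields of degree \<open>k\<close>, and for an edge \<open>e\<close>
  of \<open>T\<close> let \<open>1\<^sub>T\<^sub>e\<close> be the indicator of the triangle spanned by \<open>e\<close> and the interior point of \<open>T\<close>.  Multiples
  of the hat function at the interior point identify, up to nonzero factors, the three indicators
  of one \<open>T\<close>; the hat function at the edge point, in the direction of the segment joining the interior
  points, identifies \<open>1\<^sub>T\<^sub>e\<close> with \<open>1\<^sub>T\<^sub>'\<^sub>e\<close> and annihilates \<open>1\<^sub>T\<^sub>e\<close> if \<open>e\<close> is a boundary edge.  Hence all of them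
  vanish.  Around an edge point the four triangles are the quadrants of two crossing lines; with the
  hat function \<open>u\<close> and the two coordinates \<open>x\<close>, \<open>y\<close> as barycentric coordinates on each quadrant, the fields
  \<open>u\<^sup>j\<^sup>+\<^sup>1 x\<^sup>i y\<^sup>l\<close> times one of the two directions allow one to raise the power of \<open>u\<close> in \<open>u\<^sup>j x\<^sup>i y\<^sup>l\<close>
  until only multiples of indicators are left, so every piecewise polynomial is a divergence, except
  that the alternating sum of its four values at the edge point has to vanish.
\<close>

section \<open>Polynomials in two variables\<close>

text \<open>Both sequences rest on one surjectivity statement. A continuous function takes equal
  values on the four cells at an edge point, so its alternating sum vanishes there, and a field
  whose divergence is continuous meets the extra conditions of the smoother space by itself. At an
  edge point the divergence is a term depending only on the side of the first line plus a term
  depending only on the side of the second; such sums are exactly the 2 by 2 arrays with alternating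
  sum zero, so there is no other local obstruction. That the cells form quadrants is due to
  \<open>m e\<close> lying between \<open>c T\<close> and \<open>c T'\<close>. Fields satisfy no
  boundary condition, so a hat function may be nonzero on a boundary edge; this removes the cokernel
  that the mean value would otherwise cause. A second difficulty is the passage between open and
  closed sets: global functions live on the open \<Omega>, local ones on closed triangles, and
  derivatives make sense only inside cells. Identities are proved on open cells and carried over by
  continuity and density; the potential reaches the closed triangles through a Lipschitz
  bound.\<close>

lemma finite_degree_set: "finite {(i, j). i + j \<le> (r::nat)}"
  by (rule finite_subset[of _ "{..r} \<times> {..r}"]) auto

lemma poly2_add: "p \<in> poly2 r \<Longrightarrow> q \<in> poly2 r \<Longrightarrow> (\<lambda>x. p x + q x) \<in> poly2 r"
  unfolding poly2_def
proof clarify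
  fix a b :: "nat \<Rightarrow> nat \<Rightarrow> real"
  have "(\<lambda>x::pt. (\<Sum>(i, j)\<in>{(i, j). i + j \<le> r}. a i j * x$1^i * x$2^j) +
            (\<Sum>(i, j)\<in>{(i, j). i + j \<le> r}. b i j * x$1^i * x$2^j))
      = (\<lambda>x. \<Sum>(i, j)\<in>{(i, j). i + j \<le> r}. (a i j + b i j) * x$1^i * x$2^j)"
    by (simp add: sum.distrib[symmetric] case_prod_beta algebra_simps)
  then show "\<exists>c. (\<lambda>x::pt. (\<Sum>(i, j)\<in>{(i, j). i + j \<le> r}. a i j * x$1^i * x$2^j) +
            (\<Sum>(i, j)\<in>{(i, j). i + j \<le> r}. b i j * x$1^i * x$2^j))
      = (\<lambda>x. \<Sum>(i, j)\<in>{(i, j). i + j \<le> r}. c i j * x$1^i * x$2^j) \<and> True"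
    by (intro exI[of _ "\<lambda>i j. a i j + b i j"]) simp
qed

lemma poly2_monom:
  assumes "i + j \<le> r" shows "(\<lambda>x. a * x$1^i * x$2^j) \<in> poly2 r"
proof -
  have "(\<Sum>(i', j')\<in>{(i, j). i + j \<le> r}. (if (i', j') = (i, j) then a else 0) * x$1^i' * x$2^j')
      = a * x$1^i * x$2^j" for x :: pt
  proof -
    have "(\<Sum>(i', j')\<in>{(i, j). i + j \<le> r}. (if (i', j') = (i, j) then a else 0) * x$1^i' * x$2^j')
       = (\<Sum>k\<in>{(i, j). i + j \<le> r}. if k = (i, j) then a * x$1^i * x$2^j else 0)"
      by (intro sum.cong) (auto split: if_splits)
    also have "\<dots> = a * x$1^i * x$2^j"
      using assms by (subst sum.delta) (auto simp: finite_degree_set)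
    finally show ?thesis .
  qed
  then show ?thesis
    unfolding poly2_def
    by (intro CollectI exI[of _ "\<lambda>i' j'. if (i', j') = (i, j) then a else 0"]) auto
qed

text \<open>Coefficient sums are awkward to multiply or differentiate; with this rule the closure
  properties of \<open>poly2\<close> are checked on a single monomial.\<close>

lemma poly2_induct [consumes 1, case_names monom add]:
  assumes p: "p \<in> poly2 r"
    and monom: "\<And>a i j. i + j \<le> r \<Longrightarrow> P (\<lambda>x. a * x$1^i * x$2^j)"
    and add: "\<And>p q. p \<in> poly2 r \<Longrightarrow> q \<in> poly2 r \<Longrightarrow> P p \<Longrightarrow> P q \<Longrightarrow> P (\<lambda>x. p x + q x)"
  shows "P p"
proof -
  obtain a where a: "p = (\<lambda>x. \<Sum>(i, j)\<in>{(i, j). i + j \<le> r}. a i j * x$1^i * x$2^j)"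
    using p by (auto simp: poly2_def)
  have "P (\<lambda>x. \<Sum>(i, j)\<in>I. a i j * x$1^i * x$2^j) \<and> (\<lambda>x. \<Sum>(i, j)\<in>I. a i j * x$1^i * x$2^j) \<in> poly2 r"
    if "I \<subseteq> {(i, j). i + j \<le> r}" for I
    using finite_subset[OF that finite_degree_set] that
  proof (induction I rule: finite_induct)
    case empty
    show ?case using monom[of 0 0 0] poly2_monom[of 0 0 r 0] by simp
  next
    case (insert k I)
    obtain i j where k: "k = (i, j)" "i + j \<le> r" using insert.prems by auto
    show ?case
      using insert.IH insert.prems insert.hyps poly2_monom[OF k(2)] monom[OF k(2)]
      by (auto simp: k(1) intro!: add poly2_add)
  qed
  then show ?thesis unfolding a by blast
qed

lemma poly2_const [simp]: "(\<lambda>x. a) \<in> poly2 r"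
  using poly2_monom[of 0 0 r a] by simp

lemma poly2_mono: "p \<in> poly2 r \<Longrightarrow> r \<le> s \<Longrightarrow> p \<in> poly2 s"
  by (induction rule: poly2_induct) (auto intro: poly2_monom poly2_add)

lemma poly2_mult: "p \<in> poly2 r \<Longrightarrow> q \<in> poly2 s \<Longrightarrow> (\<lambda>x. p x * q x) \<in> poly2 (r + s)"
proof (induction rule: poly2_induct)
  case (monom a i j)
  from monom(2) monom(1) show ?case
  proof (induction rule: poly2_induct)
    case (monom b k l)
    have "(\<lambda>x::pt. (a * b) * x$1^(i + k) * x$2^(j + l)) \<in> poly2 (r + s)"
      using monom by (intro poly2_monom) auto
    then show ?case by (simp add: power_add mult.assoc mult.left_commute)
  next
    case (add p q)
    then show ?case using poly2_add[of "\<lambda>x. a * x$1^i * x$2^j * p x" "r + s"]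
      by (simp add: distrib_left)
  qed
next
  case (add p q')
  then show ?case using poly2_add[of "\<lambda>x. p x * q x" "r + s"] by (simp add: distrib_right)
qed

lemma poly2_cmult: "p \<in> poly2 r \<Longrightarrow> (\<lambda>x. a * p x) \<in> poly2 r"
  using poly2_mult[of "\<lambda>_. a" 0] by simp

lemma poly2_diff: "p \<in> poly2 r \<Longrightarrow> q \<in> poly2 r \<Longrightarrow> (\<lambda>x. p x - q x) \<in> poly2 r"
  using poly2_add[of p r "\<lambda>x. -1 * q x"] poly2_cmult[of q r "-1"] by simp

lemma poly2_uminus: "p \<in> poly2 r \<Longrightarrow> (\<lambda>x. - p x) \<in> poly2 r"
  using poly2_cmult[of p r "-1"] by simp

lemma poly2_power: "p \<in> poly2 r \<Longrightarrow> (\<lambda>x. p x ^ n) \<in> poly2 (n * r)"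
  by (induction n) (auto intro: poly2_mult)

lemma poly2_coord: "(\<lambda>x. x $ i) \<in> poly2 1"
  using poly2_monom[of 1 0 1 1] poly2_monom[of 0 1 1 1] exhaust_2[of i] by auto

lemma poly2_inner: "(\<lambda>x. X \<bullet> (x - m)) \<in> poly2 1"
proof -
  have "(\<lambda>x. X \<bullet> (x - m)) = (\<lambda>x. (X $ 1 * x $ 1 + X $ 2 * x $ 2) + - (X \<bullet> m))"
    by (auto simp: inner_vec_def sum_2 algebra_simps)
  then show ?thesis
    by (simp only:) (intro poly2_add poly2_cmult poly2_coord poly2_const)
qed


subsection \<open>Partial derivatives\<close>

lemma has_derivative_imp_partial:
  "(f has_derivative f') (at x) \<Longrightarrow> partial i f x = f' (axis i 1)"
  unfolding partial_def by (metis frechet_derivative_at)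

lemma has_derivative_partial:
  assumes "f differentiable (at x)"
  shows "(f has_derivative (\<lambda>h. partial 1 f x * h $ 1 + partial 2 f x * h $ 2)) (at x)"
proof -
  let ?D = "frechet_derivative f (at x)"
  have D: "(f has_derivative ?D) (at x)" using assms frechet_derivative_works by blast
  then interpret linear ?D by (rule has_derivative_linear)
  have "?D h = partial 1 f x * h $ 1 + partial 2 f x * h $ 2" for h
  proof -
    have "h = (h $ 1) *\<^sub>R axis 1 1 + (h $ 2) *\<^sub>R axis 2 1"
      by (auto simp: vec_eq_iff forall_2 axis_def)
    then have "?D h = ?D ((h $ 1) *\<^sub>R axis 1 1 + (h $ 2) *\<^sub>R axis 2 1)" by simp
    also have "\<dots> = h $ 1 * partial 1 f x + h $ 2 * partial 2 f x"
      by (simp only: add scale partial_def real_scaleR_def)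
    finally show ?thesis by (simp add: mult.commute)
  qed
  then show ?thesis using D by (metis (no_types, lifting) ext)
qed

text \<open>Differentiation is local: derivatives of a piecewise polynomial are read off in this way
  from its polynomial on the interior of a cell.\<close>

lemma partial_cong_open:
  assumes "open U" "x \<in> U" "\<And>y. y \<in> U \<Longrightarrow> f y = g y" "g differentiable (at x)"
  shows "f differentiable (at x)" "partial i f x = partial i g x"
proof -
  obtain g' where g': "(g has_derivative g') (at x)" using assms(4) by (auto simp: differentiable_def)
  then have f': "(f has_derivative g') (at x)"
    using has_derivative_transform_within_open[OF g' assms(1,2)] assms(3) by metis
  then show "f differentiable (at x)" by (auto simp: differentiable_def)
  show "partial i f x = partial i g x"
    using f' g' by (simp add: has_derivative_imp_partial)
qed

lemma partial_zeroD:
  assumes "f differentiable (at x)" "\<And>i. partial i f x = 0"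
  shows "(f has_derivative (\<lambda>_. 0)) (at x)"
  using has_derivative_partial[OF assms(1)] assms(2) by simp

lemma has_derivative_coord: "((\<lambda>x. x $ i) has_derivative (\<lambda>h. h $ i)) F"
  by (rule bounded_linear.has_derivative[OF bounded_linear_vec_nth]) simp

lemma has_derivative_monom:
  "((\<lambda>x::pt. a * x$1^i * x$2^j) has_derivative
     (\<lambda>h. (a * i * x$1^(i - 1) * x$2^j) * h$1 + (a * j * x$1^i * x$2^(j - 1)) * h$2)) (at x)"
  by (rule has_derivative_eq_rhs, (rule derivative_eq_intros has_derivative_coord refl)+)
     (auto simp: algebra_simps)

lemma partial_monom:
  "partial 1 (\<lambda>x::pt. a * x$1^i * x$2^j) = (\<lambda>x. (a * i) * x$1^(i - 1) * x$2^j)"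
  "partial 2 (\<lambda>x::pt. a * x$1^i * x$2^j) = (\<lambda>x. (a * j) * x$1^i * x$2^(j - 1))"
  by (auto simp: has_derivative_imp_partial[OF has_derivative_monom] axis_def fun_eq_iff)

lemma poly2_differentiable: "p \<in> poly2 r \<Longrightarrow> p differentiable (at x)"
proof (induction rule: poly2_induct)
  case (monom a i j)
  then show ?case using has_derivative_monom[of a i j x] unfolding differentiable_def by blast
next
  case (add p q)
  show ?case using differentiable_add[OF add(3,4)] by simp
qed

lemma poly2_continuous: "p \<in> poly2 r \<Longrightarrow> continuous_on S p"
  by (meson continuous_at_imp_continuous_on differentiable_imp_continuous_within poly2_differentiable)

lemma partial_add:
  assumes "f differentiable (at x)" "g differentiable (at x)"
  shows "partial i (\<lambda>x. f x + g x) x = partial i f x + partial i g x"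
  unfolding has_derivative_imp_partial[OF has_derivative_add[OF assms[unfolded frechet_derivative_works]]]
  by (simp add: partial_def)

lemma partial_cmult:
  assumes "f differentiable (at x)"
  shows "partial i (\<lambda>x. a * f x) x = a * partial i f x"
  unfolding has_derivative_imp_partial[OF has_derivative_mult_right[OF assms[unfolded frechet_derivative_works]]]
  by (simp add: partial_def)

lemma partial_diff:
  assumes "f differentiable (at x)" "g differentiable (at x)"
  shows "partial i (\<lambda>x. f x - g x) x = partial i f x - partial i g x"
  unfolding has_derivative_imp_partial[OF has_derivative_diff[OF assms[unfolded frechet_derivative_works]]]
  by (simp add: partial_def)

lemma partial_poly2_add:
  "p \<in> poly2 r \<Longrightarrow> q \<in> poly2 s \<Longrightarrow> partial i (\<lambda>x. p x + q x) = (\<lambda>x. partial i p x + partial i q x)"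
  by (auto simp: fun_eq_iff partial_add poly2_differentiable)

lemma poly2_partial:
  assumes "p \<in> poly2 r" shows "partial i p \<in> poly2 (r - 1)"
proof -
  have "partial 1 p \<in> poly2 (r - 1) \<and> partial 2 p \<in> poly2 (r - 1)"
    using assms
  proof (induction rule: poly2_induct)
    case (monom a i j)
    show ?case unfolding partial_monom
    proof
      show "(\<lambda>x::pt. a * real i * x$1^(i - 1) * x$2^j) \<in> poly2 (r - 1)"
      \<comment> \<open>At \<open>i = 0\<close> the truncated exponent \<open>i - 1\<close> would
        spoil the degree count, but the coefficient is zero.\<close>
      proof (cases "i = 0")
        case False
        then show ?thesis using monom by (intro poly2_monom) auto
      qed simp
      show "(\<lambda>x::pt. a * real j * x$1^i * x$2^(j - 1)) \<in> poly2 (r - 1)"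
      proof (cases "j = 0")
        case False
        then show ?thesis using monom by (intro poly2_monom) auto
      qed simp
    qed
  next
    case (add p q)
    then show ?case by (auto simp: partial_poly2_add intro: poly2_add)
  qed
  then show ?thesis using exhaust_2[of i] by auto
qed

lemma poly2_partial_commute:
  assumes "p \<in> poly2 r" shows "partial 1 (partial 2 p) x = partial 2 (partial 1 p) x"
  using assms
proof (induction rule: poly2_induct)
  case (monom a i j)
  then show ?case by (simp add: partial_monom)
next
  case (add p q)
  then show ?case
    by (simp add: partial_poly2_add[OF add(1,2)] partial_poly2_add[OF poly2_partial poly2_partial, OF add(1,2)])
qed

lemma poly2_antiderivative2:
  assumes "p \<in> poly2 r" shows "\<exists>q\<in>poly2 (Suc r). partial 2 q = p"
  using assms
proof (induction rule: poly2_induct)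
  case (monom a i j)
  have "(\<lambda>x::pt. (a / Suc j) * x$1^i * x$2^Suc j) \<in> poly2 (Suc r)"
    using monom by (intro poly2_monom) auto
  moreover have "partial 2 (\<lambda>x::pt. (a / Suc j) * x$1^i * x$2^Suc j) = (\<lambda>x. a * x$1^i * x$2^j)"
    unfolding partial_monom by simp
  ultimately show ?case by blast
next
  case (add p q)
  then obtain p' q' where "p' \<in> poly2 (Suc r)" "partial 2 p' = p" "q' \<in> poly2 (Suc r)" "partial 2 q' = q"
    by blast
  then show ?case
    by (intro bexI[of _ "\<lambda>x. p' x + q' x"]) (auto simp: partial_poly2_add intro: poly2_add)
qed

text \<open>Integrates only the restriction to the first axis, so the result stays independent of
  the second variable; this is the correction term in \<open>poly2_potential\<close>.\<close>

lemma poly2_antiderivative1: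
  assumes "p \<in> poly2 r"
  shows "\<exists>q\<in>poly2 (Suc r). partial 1 q = (\<lambda>x. p (vector [x $ 1, 0])) \<and> partial 2 q = (\<lambda>x. 0)"
  using assms
proof (induction rule: poly2_induct)
  case (monom a i j)
  \<comment> \<open>A monomial with \<open>j > 0\<close> vanishes on the axis; for
    \<open>j = 0\<close> the factor \<open>0 ^ 0\<close> is 1.\<close>
  let ?b = "if j = 0 then a / Suc i else 0"
  have "(\<lambda>x::pt. ?b * x$1^Suc i * x$2^0) \<in> poly2 (Suc r)"
    using monom by (intro poly2_monom) auto
  moreover have "partial 1 (\<lambda>x::pt. ?b * x$1^Suc i * x$2^0) = (\<lambda>x. a * (vector [x$1, 0] :: pt)$1^i * (vector [x$1, 0] :: pt)$2^j)"
    unfolding partial_monom by (auto simp: fun_eq_iff)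
  moreover have "partial 2 (\<lambda>x::pt. ?b * x$1^Suc i * x$2^0) = (\<lambda>x. 0)"
    unfolding partial_monom by simp
  ultimately show ?case by blast
next
  case (add p q)
  then obtain p' q' where "p' \<in> poly2 (Suc r)" "partial 1 p' = (\<lambda>x. p (vector [x $ 1, 0]))"
    "partial 2 p' = (\<lambda>x. 0)" "q' \<in> poly2 (Suc r)" "partial 1 q' = (\<lambda>x. q (vector [x $ 1, 0]))"
    "partial 2 q' = (\<lambda>x. 0)" by blast
  then show ?case
    by (intro bexI[of _ "\<lambda>x. p' x + q' x"]) (auto simp: partial_poly2_add intro: poly2_add)
qed

lemma poly2_line:
  assumes "p \<in> poly2 r" shows "real_polynomial_function (\<lambda>t. p (a + t *\<^sub>R b))"
  using assms
proof (induction rule: poly2_induct)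
  case (monom c i j)
  have "real_polynomial_function (\<lambda>t. a $ k + t * b $ k)" for k
    using real_polynomial_function.intros(1)[OF bounded_linear_ident]
    by (intro real_polynomial_function.intros) auto
  then show ?case
    by (simp, intro real_polynomial_function.intros real_polynomial_function_power) auto
next
  case (add p q)
  then show ?case by (intro real_polynomial_function.intros(3))
qed

text \<open>On the line from a point of \<open>U\<close> through \<open>x\<close> the polynomial has
  one variable and infinitely many zeros, since the line meets \<open>U\<close> in an open set of
  parameters; \<open>x\<close> itself is the parameter 1.\<close>

lemma poly2_eq_0:
  assumes p: "p \<in> poly2 r" and U: "open U" "U \<noteq> {}" and 0: "\<And>x. x \<in> U \<Longrightarrow> p x = 0"
  shows "p x = 0"
proof -
  obtain a where a: "a \<in> U" using U by blast
  obtain c :: "nat \<Rightarrow> real" and n where c: "(\<lambda>t. p (a + t *\<^sub>R (x - a))) = (\<lambda>t. \<Sum>i\<le>n. c i * t^i)"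
    using poly2_line[OF p] unfolding real_polynomial_function_iff_sum by blast
  have "open ((\<lambda>t::real. a + t *\<^sub>R (x - a)) -` U)"
    by (intro open_vimage U continuous_intros)
  moreover have "0 \<in> (\<lambda>t::real. a + t *\<^sub>R (x - a)) -` U" using a by simp
  ultimately have "infinite ((\<lambda>t::real. a + t *\<^sub>R (x - a)) -` U)"
    using finite_imp_not_open by blast
  moreover have "(\<lambda>t::real. a + t *\<^sub>R (x - a)) -` U \<subseteq> {t. (\<Sum>i\<le>n. c i * t^i) = 0}"
    using 0 fun_cong[OF c] by (metis (mono_tags, lifting) mem_Collect_eq subsetI vimage_eq)
  ultimately have "infinite {t. (\<Sum>i\<le>n. c i * t^i) = 0}" by (meson finite_subset)
  then have "\<forall>i\<le>n. c i = 0" using polyfun_finite_roots by blast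
  then show ?thesis using fun_cong[OF c, of 1] by simp
qed

text \<open>Poincare lemma with degree control. Integrate \<open>f1\<close> in the second variable
  to \<open>P\<close>; the defect \<open>R\<close> of the other equation has
  \<open>partial 2 R = - partial 2 f2 - partial 1 f1\<close>, which vanishes on \<open>U\<close> and
  hence everywhere. So \<open>R\<close> depends on the first variable only and is integrated
  separately.\<close>

lemma poly2_potential:
  assumes f: "f1 \<in> poly2 r" "f2 \<in> poly2 r" and U: "open U" "U \<noteq> {}"
    and div: "\<And>x. x \<in> U \<Longrightarrow> partial 1 f1 x + partial 2 f2 x = 0"
  shows "\<exists>q\<in>poly2 (Suc r). partial 2 q = f1 \<and> partial 1 q = (\<lambda>x. - f2 x)"
proof -
  obtain P where P: "P \<in> poly2 (Suc r)" "partial 2 P = f1" using poly2_antiderivative2[OF f(1)] by blast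
  define R where "R = (\<lambda>x. - f2 x - partial 1 P x)"
  have R: "R \<in> poly2 r"
    unfolding R_def using poly2_partial[OF P(1)] f by (intro poly2_diff poly2_uminus) auto
  have dR: "partial 2 R x = - partial 2 f2 x - partial 1 f1 x" for x
  proof -
    have "partial 2 R x = partial 2 (\<lambda>x. - 1 * f2 x) x - partial 2 (partial 1 P) x"
      unfolding R_def using f P poly2_partial[OF P(1)]
      by (subst partial_diff[symmetric]) (auto intro!: poly2_differentiable poly2_uminus)
    also have "\<dots> = - partial 2 f2 x - partial 1 f1 x"
      using partial_cmult[OF poly2_differentiable[OF f(2)], of 2 "-1" x] P poly2_partial_commute[OF P(1)] by simp
    finally show ?thesis .
  qed
  have "partial 2 R x = 0" for x
    by (rule poly2_eq_0[OF poly2_partial[OF R] U]) (use div in \<open>simp add: dR, smt (verit)\<close>)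
  then have R': "(R has_derivative (\<lambda>h. partial 1 R x * h $ 1)) (at x)" for x
    using has_derivative_partial[OF poly2_differentiable[OF R], of x] by simp
  have R0: "R x = R (vector [x $ 1, 0])" for x
  proof -
    let ?g = "\<lambda>t. R (vector [x $ 1, t])"
    have v: "((\<lambda>t::real. vector [x $ 1, t] :: pt) has_derivative (\<lambda>t. t *\<^sub>R axis 2 1)) (at t)" for t
    proof -
      have eq: "(\<lambda>t::real. vector [x $ 1, t] :: pt) = (\<lambda>t. vector [x $ 1, 0] + t *\<^sub>R axis 2 1)"
        by (auto simp: fun_eq_iff vec_eq_iff forall_2 axis_def)
      show ?thesis unfolding eq by (auto intro!: derivative_eq_intros)
    qed
    have "(?g has_derivative (\<lambda>t. 0)) (at t)" for t
      using has_derivative_compose[OF v R', of t] by (simp add: axis_def)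
    then have "(?g has_derivative (\<lambda>h. 0)) (at t within UNIV)" for t by simp
    then obtain k where "\<And>t. ?g t = k"
      using has_derivative_zero_constant[of UNIV ?g] by auto
    moreover have "x = vector [x $ 1, x $ 2]" by (auto simp: vec_eq_iff forall_2)
    ultimately show ?thesis by metis
  qed
  obtain Q where Q: "Q \<in> poly2 (Suc r)" "partial 1 Q = (\<lambda>x. R (vector [x $ 1, 0]))" "partial 2 Q = (\<lambda>x. 0)"
    using poly2_antiderivative1[OF R] by blast
  show ?thesis
  proof (intro bexI conjI)
    show "(\<lambda>x. P x + Q x) \<in> poly2 (Suc r)" using P Q by (intro poly2_add)
    show "partial 2 (\<lambda>x. P x + Q x) = f1" using P Q by (simp add: partial_poly2_add[OF P(1) Q(1)])
    show "partial 1 (\<lambda>x. P x + Q x) = (\<lambda>x. - f2 x)"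
    proof
      fix x
      show "partial 1 (\<lambda>x. P x + Q x) x = - f2 x"
        using R0[of x] Q(2) unfolding partial_poly2_add[OF P(1) Q(1)] by (simp add: R_def)
    qed
  qed
qed


subsection \<open>Barycentric expansion\<close>

text \<open>Homogenization: multiplying by \<open>u + v + w\<close>, which is 1, raises the degree
  of a form without changing the function. So a polynomial of degree at most \<open>n\<close> is a
  form of degree exactly \<open>n\<close> in barycentric coordinates.\<close>

lemma poly2_barycentric_induct:
  assumes p: "p \<in> poly2 n"
    and one: "\<And>x. u x + v x + w x = (1::real)"
    and x1: "\<And>x. x $ 1 = a1 * u x + b1 * v x + c1 * w x"
    and x2: "\<And>x. x $ 2 = a2 * u x + b2 * v x + c2 * w x"
    and monom: "\<And>a j i l. j + i + l = n \<Longrightarrow> P (\<lambda>x. a * u x ^ j * v x ^ i * w x ^ l)"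
    and add: "\<And>p q. P p \<Longrightarrow> P q \<Longrightarrow> P (\<lambda>x. p x + q x)"
  shows "P p"
proof -
  \<comment> \<open>\<open>H k\<close> collects the forms of degree \<open>k\<close> in
    \<open>u\<close>, \<open>v\<close>, \<open>w\<close>, one linear factor per recursion
    step.\<close>
  define H where "H = rec_nat (range (\<lambda>a (x::pt). a :: real))
    (\<lambda>_ S. {\<lambda>x. u x * p x + v x * q x + w x * r x | p q r. p \<in> S \<and> q \<in> S \<and> r \<in> S})"
  have H0: "H 0 = range (\<lambda>a x. a)" by (simp add: H_def)
  have HS: "H (Suc k) = {\<lambda>x. u x * p x + v x * q x + w x * r x | p q r. p \<in> H k \<and> q \<in> H k \<and> r \<in> H k}" for k
    by (simp add: H_def)
  have Hscale: "p \<in> H k \<Longrightarrow> (\<lambda>x. a * p x) \<in> H k" for p k a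
  proof (induction k arbitrary: p)
    case (Suc k)
    then obtain q r s where *: "p = (\<lambda>x. u x * q x + v x * r x + w x * s x)" "q \<in> H k" "r \<in> H k" "s \<in> H k"
      by (auto simp: HS)
    show ?case
      unfolding HS *(1) using Suc.IH[OF *(2)] Suc.IH[OF *(3)] Suc.IH[OF *(4)]
      by (intro CollectI exI[of _ "\<lambda>x. a * q x"] exI[of _ "\<lambda>x. a * r x"] exI[of _ "\<lambda>x. a * s x"])
         (auto simp: algebra_simps)
  qed (auto simp: H0)
  have Hmul: "(\<lambda>x. (a * u x + b * v x + c * w x) * p x) \<in> H (Suc k)" if "p \<in> H k" for p k a b c
    unfolding HS using Hscale[OF that]
    by (intro CollectI exI[of _ "\<lambda>x. a * p x"] exI[of _ "\<lambda>x. b * p x"] exI[of _ "\<lambda>x. c * p x"])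
       (auto simp: algebra_simps)
  have Hx1: "(\<lambda>x. x $ 1 * p x) \<in> H (Suc k)" if "p \<in> H k" for p k
    using Hmul[OF that, of a1 b1 c1] by (simp add: x1)
  have Hx2: "(\<lambda>x. x $ 2 * p x) \<in> H (Suc k)" if "p \<in> H k" for p k
    using Hmul[OF that, of a2 b2 c2] by (simp add: x2)
  have Hup: "p \<in> H (Suc k)" if "p \<in> H k" for p k
    using Hmul[OF that, of 1 1 1] by (simp add: one)
  have Hmono: "p \<in> H k \<Longrightarrow> p \<in> H (d + k)" for p k d
    by (induction d) (auto intro: Hup)
  have Hmonom: "(\<lambda>x. a * x $ 1 ^ i * x $ 2 ^ j) \<in> H (i + j)" for a i j
  proof (induction i)
    case 0
    show ?case
    proof (induction j)
      case (Suc j)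
      then show ?case using Hx2[OF Suc] by (simp add: mult.left_commute)
    qed (auto simp: H0)
  next
    case (Suc i)
    then show ?case using Hx1[OF Suc] by (simp add: mult.left_commute mult.assoc)
  qed
  \<comment> \<open>Generalized by a monomial prefactor of complementary degree: a linear factor
    peeled off \<open>q\<close> moves into the prefactor.\<close>
  have HP: "P (\<lambda>x. u x ^ j * v x ^ i * w x ^ l * q x)" if "q \<in> H k" "j + i + l + k = n" for q k j i l
    using that
  proof (induction k arbitrary: q j i l)
    case 0
    then obtain a where "q = (\<lambda>x. a)" by (auto simp: H0)
    then show ?case using monom[of j i l a] 0 by (simp add: mult_ac)
  next
    case (Suc k)
    then obtain q1 q2 q3 where *: "q = (\<lambda>x. u x * q1 x + v x * q2 x + w x * q3 x)" "q1 \<in> H k" "q2 \<in> H k" "q3 \<in> H k"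
      by (auto simp: HS)
    have "(\<lambda>x. u x ^ j * v x ^ i * w x ^ l * q x) = (\<lambda>x. (u x ^ Suc j * v x ^ i * w x ^ l * q1 x +
       u x ^ j * v x ^ Suc i * w x ^ l * q2 x) + u x ^ j * v x ^ i * w x ^ Suc l * q3 x)"
      by (simp add: * algebra_simps)
    then show ?case using Suc.IH[OF *(2), of "Suc j" i l] Suc.IH[OF *(3), of j "Suc i" l] Suc.IH[OF *(4), of j i "Suc l"]
        Suc.prems by (auto intro!: add)
  qed
  from p show ?thesis
  proof (induction rule: poly2_induct)
    case (monom a i j)
    then have "(\<lambda>x. a * x $ 1 ^ i * x $ 2 ^ j) \<in> H n" using Hmono[OF Hmonom[of a i j], of "n - (i + j)"] by simp
    then show ?case using HP[of _ n 0 0 0] by simp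
  qed (rule add)
qed


section \<open>Almost everywhere equality\<close>

lemma AE_lebesgue_on_iff_negligible:
  fixes S :: "pt set"
  assumes "S \<in> sets lebesgue"
  shows "(AE x in lebesgue_on S. P x) \<longleftrightarrow> negligible {x \<in> S. \<not> P x}"
proof -
  have "(AE x in lebesgue_on S. P x) \<longleftrightarrow> (AE x in lebesgue. x \<in> S \<longrightarrow> P x)"
    using assms by (intro AE_restrict_space_iff) auto
  also have "\<dots> \<longleftrightarrow> negligible {x. \<not> (x \<in> S \<longrightarrow> P x)}"
    unfolding eventually_ae_filter_negligible by (meson negligible_subset order_refl)
  also have "{x. \<not> (x \<in> S \<longrightarrow> P x)} = {x \<in> S. \<not> P x}" by auto
  finally show ?thesis .
qed

lemma ae_class_eq_iff: "ae_class S f = ae_class S g \<longleftrightarrow> (AE x in lebesgue_on S. f x = g x)"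
proof
  assume "ae_class S f = ae_class S g"
  moreover have "f \<in> ae_class S f" by (simp add: ae_class_def)
  ultimately show "AE x in lebesgue_on S. f x = g x" by (simp add: ae_class_def)
next
  assume "AE x in lebesgue_on S. f x = g x"
  then show "ae_class S f = ae_class S g"
    by (auto simp: ae_class_def elim: eventually_elim2)
qed

text \<open>The set of disagreement is open, as the preimage of the complement of the diagonal, and
  a nonempty open set is not negligible.\<close>

lemma continuous_eq_of_negligible:
  fixes f g :: "pt \<Rightarrow> 'b::t2_space"
  assumes "open S" "continuous_on S f" "continuous_on S g" "negligible {x \<in> S. f x \<noteq> g x}" "x \<in> S"
  shows "f x = g x"
proof -
  have "open {x \<in> S. f x \<noteq> g x}"
  proof -
    have "open (S \<inter> (\<lambda>x. (f x, g x)) -` (- {y. \<exists>x. y = (x, x)}))"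
      using assms(1-3) closed_diagonal
      by (intro continuous_open_preimage continuous_on_Pair) auto
    moreover have "S \<inter> (\<lambda>x. (f x, g x)) -` (- {y. \<exists>x. y = (x, x)}) = {x \<in> S. f x \<noteq> g x}" by auto
    ultimately show ?thesis by simp
  qed
  then have "{x \<in> S. f x \<noteq> g x} = {}" using assms(4) open_not_negligible by blast
  then show ?thesis using assms(5) by blast
qed


section \<open>Gluing local primitives on a simply connected domain\<close>

text \<open>Transported along the linear identification of the plane with the complex numbers, where
  this is a consequence of the Riemann mapping theorem.\<close>

lemma simply_connected_imp_contractible_pt:
  fixes S :: "pt set"
  assumes "open S" "simply_connected S" shows "contractible S"
proof -
  define h :: "pt \<Rightarrow> complex" where "h x = Complex (x $ 1) (x $ 2)" for x
  define g :: "complex \<Rightarrow> pt" where "g z = vector [Re z, Im z]" for z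
  have gh: "g (h x) = x" for x by (auto simp: g_def h_def vec_eq_iff forall_2)
  have hg: "h (g z) = z" for z by (auto simp: g_def h_def)
  have ch: "continuous_on U h" for U
    unfolding h_def Complex_eq by (intro continuous_intros)
  have "g = (\<lambda>z. Re z *\<^sub>R axis 1 1 + Im z *\<^sub>R axis 2 1)"
    by (auto simp: g_def fun_eq_iff vec_eq_iff forall_2 axis_def)
  then have cg: "continuous_on U g" for U by (simp only:) (intro continuous_intros)
  have hom: "S homeomorphic h ` S"
    unfolding homeomorphic_def homeomorphism_def
    by (rule exI[of _ h], rule exI[of _ g]) (auto simp: gh hg ch cg image_iff)
  have "h ` S = g -` S"
  proof (intro equalityI subsetI)
    fix z assume "z \<in> g -` S"
    then show "z \<in> h ` S" using hg[of z] by (metis image_eqI vimageD)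
  qed (auto simp: gh)
  then have "open (h ` S)" using open_vimage[OF assms(1) cg] by simp
  then show ?thesis
    using hom assms(2) contractible_eq_simply_connected_2d homeomorphic_contractible_eq
      homeomorphic_simply_connected_eq by blast
qed

text \<open>\<open>f w\<close> is a primitive on the ball around \<open>w\<close>; \<open>\<phi>\<close> continues these primitives along the
  path \<open>\<gamma>\<close> up to time \<open>s\<close>.\<close>

definition primitive_along ::
    "'a::metric_space set \<Rightarrow> ('a \<Rightarrow> real) \<Rightarrow> ('a \<Rightarrow> 'a \<Rightarrow> real) \<Rightarrow> (real \<Rightarrow> 'a) \<Rightarrow> real \<Rightarrow> (real \<Rightarrow> real) \<Rightarrow> bool"
  where "primitive_along \<Omega> \<epsilon> f \<gamma> s \<phi> \<longleftrightarrow> (\<forall>t\<in>{0..s}. \<exists>w\<in>\<Omega>. \<exists>d>0. \<forall>u\<in>{0..s}. \<bar>u - t\<bar> < d \<longrightarrow>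
     \<gamma> u \<in> ball w (\<epsilon> w) \<and> \<phi> u - \<phi> t = f w (\<gamma> u) - f w (\<gamma> t))"

context
  fixes \<Omega> :: "'a::metric_space set" and \<epsilon> :: "'a \<Rightarrow> real" and f :: "'a \<Rightarrow> 'a \<Rightarrow> real"
  assumes consist: "\<And>w z p q. w \<in> \<Omega> \<Longrightarrow> z \<in> \<Omega> \<Longrightarrow> p \<in> ball w (\<epsilon> w) \<inter> ball z (\<epsilon> z) \<Longrightarrow>
      q \<in> ball w (\<epsilon> w) \<inter> ball z (\<epsilon> z) \<Longrightarrow> f w p - f w q = f z p - f z q"
begin

text \<open>The difference of two continuations is locally constant: near any time both grow by
  increments of primitives on two balls, and these agree on the overlap by
  \<open>consist\<close>.\<close>

lemma primitive_along_unique: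
  assumes "primitive_along \<Omega> \<epsilon> f \<gamma> 1 \<phi>" "primitive_along \<Omega> \<epsilon> f \<gamma> 1 \<psi>"
  shows "\<phi> 1 - \<phi> 0 = \<psi> 1 - \<psi> 0"
proof -
  have "(\<lambda>t. \<phi> t - \<psi> t) 0 = (\<lambda>t. \<phi> t - \<psi> t) 1"
  proof (rule connected_local_const[where f = "\<lambda>t. \<phi> t - \<psi> t" and A = "{0..1::real}"])
    show "\<forall>a\<in>{0..1}. \<forall>\<^sub>F b in at a within {0..1}. \<phi> a - \<psi> a = \<phi> b - \<psi> b"
    proof
      fix t :: real assume t: "t \<in> {0..1}"
      obtain w d where w: "w \<in> \<Omega>" "d > 0" "\<And>u. u \<in> {0..1} \<Longrightarrow> \<bar>u - t\<bar> < d \<Longrightarrow>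
          \<gamma> u \<in> ball w (\<epsilon> w) \<and> \<phi> u - \<phi> t = f w (\<gamma> u) - f w (\<gamma> t)"
        using assms(1) t unfolding primitive_along_def by blast
      obtain w' d' where w': "w' \<in> \<Omega>" "d' > 0" "\<And>u. u \<in> {0..1} \<Longrightarrow> \<bar>u - t\<bar> < d' \<Longrightarrow>
          \<gamma> u \<in> ball w' (\<epsilon> w') \<and> \<psi> u - \<psi> t = f w' (\<gamma> u) - f w' (\<gamma> t)"
        using assms(2) t unfolding primitive_along_def by blast
      have "\<phi> t - \<psi> t = \<phi> u - \<psi> u" if u: "u \<in> {0..1}" "dist u t < min d d'" for u
      proof -
        have "f w (\<gamma> u) - f w (\<gamma> t) = f w' (\<gamma> u) - f w' (\<gamma> t)"
          using w(3)[OF u(1)] w'(3)[OF u(1)] w(3)[OF t] w'(3)[OF t] u(2) w(1,2) w'(1,2)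
          by (intro consist) (auto simp: dist_real_def)
        moreover have "\<phi> u - \<phi> t = f w (\<gamma> u) - f w (\<gamma> t)" "\<psi> u - \<psi> t = f w' (\<gamma> u) - f w' (\<gamma> t)"
          using w(3)[OF u(1)] w'(3)[OF u(1)] u(2) by (auto simp: dist_real_def)
        ultimately show ?thesis by simp
      qed
      then show "\<forall>\<^sub>F b in at t within {0..1}. \<phi> t - \<psi> t = \<phi> b - \<psi> b"
        using w(2) w'(2) unfolding eventually_at by (intro exI[of _ "min d d'"]) auto
    qed
  qed auto
  then show ?thesis by simp
qed

text \<open>The margin \<open>d\<close> serves the junction: just before \<open>s1\<close> the
  continuation follows the primitive of another ball, and since the path is already in the ball of
  \<open>z\<close> there, \<open>consist\<close> lets \<open>f z\<close> replace it on both
  sides.\<close>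

lemma primitive_along_extend:
  assumes z: "z \<in> \<Omega>" and s: "0 \<le> s1" "s1 \<le> s2" and d: "d > 0"
    and near: "\<And>u. u \<in> {0..s2} \<Longrightarrow> s1 - d < u \<Longrightarrow> \<gamma> u \<in> ball z (\<epsilon> z)"
    and \<phi>: "primitive_along \<Omega> \<epsilon> f \<gamma> s1 \<phi>"
  shows "primitive_along \<Omega> \<epsilon> f \<gamma> s2 (\<lambda>u. if u \<le> s1 then \<phi> u else \<phi> s1 + f z (\<gamma> u) - f z (\<gamma> s1))"
    (is "primitive_along _ _ _ _ _ ?\<psi>")
  unfolding primitive_along_def
proof
  fix t assume t: "t \<in> {0..s2}"
  show "\<exists>w\<in>\<Omega>. \<exists>d>0. \<forall>u\<in>{0..s2}. \<bar>u - t\<bar> < d \<longrightarrow>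
     \<gamma> u \<in> ball w (\<epsilon> w) \<and> ?\<psi> u - ?\<psi> t = f w (\<gamma> u) - f w (\<gamma> t)"
  proof (cases "t > s1")
    case True
    then show ?thesis
      using d near s by (intro bexI[OF _ z] exI[of _ "t - s1"]) auto
  next
    case False
    then have "t \<in> {0..s1}" using t by auto
    then obtain w e where w: "w \<in> \<Omega>" "e > 0" "\<And>u. u \<in> {0..s1} \<Longrightarrow> \<bar>u - t\<bar> < e \<Longrightarrow>
          \<gamma> u \<in> ball w (\<epsilon> w) \<and> \<phi> u - \<phi> t = f w (\<gamma> u) - f w (\<gamma> t)"
      using \<phi> unfolding primitive_along_def by meson
    show ?thesis
    proof (cases "t = s1")
      case False
      with \<open>\<not> t > s1\<close> w show ?thesis
        by (intro bexI[OF _ w(1)] exI[of _ "min e (s1 - t)"]) auto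
    next
      case True
      have "?\<psi> u - ?\<psi> t = f z (\<gamma> u) - f z (\<gamma> t)"
        if u: "u \<in> {0..s2}" "\<bar>u - t\<bar> < min d e" for u
      proof (cases "u \<le> s1")
        case le: True
        have "f w (\<gamma> u) - f w (\<gamma> t) = f z (\<gamma> u) - f z (\<gamma> t)"
          using w(3)[of u] w(3)[of t] near[of u] near[of t] u s True le d w(1,2) z
          by (intro consist) auto
        then show ?thesis using w(3)[of u] u True le by auto
      qed (use True in auto)
      then show ?thesis
        using near True d w(2) by (intro bexI[OF _ z] exI[of _ "min d e"]) auto
    qed
  qed
qed

lemma glue_local_primitives:
  assumes "open \<Omega>" and \<epsilon>: "\<And>x. x \<in> \<Omega> \<Longrightarrow> \<epsilon> x > 0 \<and> ball x (\<epsilon> x) \<subseteq> \<Omega>"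
    and H: "continuous_on ({0..1::real} \<times> \<Omega>) H" "H ` ({0..1} \<times> \<Omega>) \<subseteq> \<Omega>"
      "\<And>x. x \<in> \<Omega> \<Longrightarrow> H (0, x) = a" "\<And>x. x \<in> \<Omega> \<Longrightarrow> H (1, x) = x"
  obtains q where "\<And>x. x \<in> \<Omega> \<Longrightarrow> \<exists>\<delta>>0. \<forall>y\<in>ball x \<delta>. q y - q x = f x y - f x x"
proof -
  \<comment> \<open>Besides the existence of a continuation up to time \<open>s\<close>, this
    records that near \<open>x\<close> its end value varies with \<open>y\<close> like the primitive
    of one ball. At \<open>s = 1\<close>, where \<open>H (1, y) = y\<close>, that yields the
    claim.\<close>
  define I where "I x s \<longleftrightarrow> (\<exists>\<delta>>0. \<exists>\<Phi>. \<exists>w\<in>\<Omega>. ball x \<delta> \<subseteq> \<Omega> \<and> (\<forall>y\<in>ball x \<delta>.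
     primitive_along \<Omega> \<epsilon> f (\<lambda>t. H (t, y)) s (\<lambda>t. \<Phi> t y) \<and> \<Phi> 0 y = 0 \<and>
     H (s, y) \<in> ball w (\<epsilon> w) \<and> \<Phi> s y - \<Phi> s x = f w (H (s, y)) - f w (H (s, x))))" for x and s :: real
  have I1: "I x 1" if x: "x \<in> \<Omega>" for x
  proof -
    have a: "a \<in> \<Omega>" using H(2) H(3)[OF x] x by force
    \<comment> \<open>At time 0 all paths are at the point \<open>a\<close>, so nothing varies with
      \<open>y\<close>.\<close>
    have I0: "I x 0" unfolding I_def
    proof (intro exI conjI bexI ballI)
      show "\<epsilon> x > 0" "ball x (\<epsilon> x) \<subseteq> \<Omega>" using \<epsilon>[OF x] by auto
      fix y assume "y \<in> ball x (\<epsilon> x)"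
      then have y: "y \<in> \<Omega>" using \<epsilon>[OF x] by auto
      show "primitive_along \<Omega> \<epsilon> f (\<lambda>t. H (t, y)) 0 (\<lambda>t. 0)"
        using a \<epsilon>[OF a] H(3)[OF y] by (auto simp: primitive_along_def intro!: bexI[of _ a] exI[of _ 1])
      show "H (0, y) \<in> ball a (\<epsilon> a)" using \<epsilon>[OF a] H(3)[OF y] by simp
      show "0 - 0 = f a (H (0, y)) - f a (H (0, x))" by (simp add: H(3) x y)
    qed (simp_all add: a)
    have "0 \<le> (0::real) \<and> (1::real) \<le> 1 \<and> I x 0 \<longrightarrow> I x 1"
    \<comment> \<open>Bisection replaces a subdivision of the whole path: each time \<tau> only
      needs a neighbourhood during which all nearby paths stay in the single ball around
      \<open>z\<close>.\<close>
    proof (rule Bolzano[of 0 1 "\<lambda>s t. 0 \<le> s \<and> t \<le> 1 \<and> I x s \<longrightarrow> I x t"])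
      fix \<tau> :: real assume \<tau>: "0 \<le> \<tau>" "\<tau> \<le> 1"
      define z where "z = H (\<tau>, x)"
      have z: "z \<in> \<Omega>" using H(2) \<tau> x unfolding z_def by force
      obtain e where e: "e > 0" "\<And>p. p \<in> {0..1} \<times> \<Omega> \<Longrightarrow> dist p (\<tau>, x) < e \<Longrightarrow> dist (H p) z < \<epsilon> z"
        using H(1) \<tau> x \<epsilon>[OF z] unfolding continuous_on_iff z_def by (metis atLeastAtMost_iff mem_Sigma_iff)
      have near: "H (u, y) \<in> ball z (\<epsilon> z)"
        if "u \<in> {0..1}" "\<bar>u - \<tau>\<bar> < e / 2" "y \<in> \<Omega>" "dist x y < e / 2" for u y
      proof -
        have "dist (u, y) (\<tau>, x) \<le> dist u \<tau> + dist y x"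
          by (simp add: dist_prod_def sqrt_sum_squares_le_sum)
        then have "dist (u, y) (\<tau>, x) < e" using that by (simp add: dist_real_def dist_commute)
        then show ?thesis using e(2)[of "(u, y)"] that by (simp add: dist_commute)
      qed
      show "\<exists>d>0. \<forall>s t. s \<le> \<tau> \<and> \<tau> \<le> t \<and> t - s < d \<longrightarrow> (0 \<le> s \<and> t \<le> 1 \<and> I x s \<longrightarrow> I x t)"
      proof (intro exI[of _ "e/2"] conjI allI impI)
        fix s t assume st: "s \<le> \<tau> \<and> \<tau> \<le> t \<and> t - s < e / 2" and *: "0 \<le> s \<and> t \<le> 1 \<and> I x s"
        then obtain \<delta> \<Phi> w where \<delta>: "\<delta> > 0" "ball x \<delta> \<subseteq> \<Omega>" and w: "w \<in> \<Omega>" and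
          \<Phi>: "\<And>y. y \<in> ball x \<delta> \<Longrightarrow> primitive_along \<Omega> \<epsilon> f (\<lambda>t. H (t, y)) s (\<lambda>t. \<Phi> t y) \<and> \<Phi> 0 y = 0 \<and>
            H (s, y) \<in> ball w (\<epsilon> w) \<and> \<Phi> s y - \<Phi> s x = f w (H (s, y)) - f w (H (s, x))"
          unfolding I_def by blast
        show "I x t"
          unfolding I_def
        proof (rule exI[of _ "min \<delta> (e/2)"], rule conjI, use \<delta> e in simp,
            rule exI[of _ "\<lambda>u y. if u \<le> s then \<Phi> u y else \<Phi> s y + f z (H (u, y)) - f z (H (s, y))"],
            rule bexI[OF _ z], intro conjI ballI)
          show "ball x (min \<delta> (e / 2)) \<subseteq> \<Omega>" using \<delta> by auto
          fix y assume y: "y \<in> ball x (min \<delta> (e / 2))"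
          then have y\<Omega>: "y \<in> \<Omega>" using \<delta> by auto
          show "primitive_along \<Omega> \<epsilon> f (\<lambda>t. H (t, y)) t
             (\<lambda>t. if t \<le> s then \<Phi> t y else \<Phi> s y + f z (H (t, y)) - f z (H (s, y)))"
          proof (rule primitive_along_extend[OF z, of s t "e / 2 - (\<tau> - s)"])
            show "H (u, y) \<in> ball z (\<epsilon> z)" if "u \<in> {0..t}" "s - (e / 2 - (\<tau> - s)) < u" for u
            proof (rule near)
              show "\<bar>u - \<tau>\<bar> < e / 2" 
              proof (rule abs_less_iff[THEN iffD2], rule conjI)
                have "s \<le> \<tau>" "t - s < e / 2" using st by auto
                then show "u - \<tau> < e / 2" using that(1) by (smt (verit) atLeastAtMost_iff)
                show "- (u - \<tau>) < e / 2" using that(2) by linarith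
              qed
            qed (use that st * y y\<Omega> in auto)
          qed (use st * y \<Phi> in auto)
          show "(if 0 \<le> s then \<Phi> 0 y else \<Phi> s y + f z (H (0, y)) - f z (H (s, y))) = 0"
            using \<Phi>[of y] y * by simp
          show Ht: "H (t, y) \<in> ball z (\<epsilon> z)"
            using st * y y\<Omega> by (intro near) auto
          have Hs: "H (s, y) \<in> ball z (\<epsilon> z)" "H (s, x) \<in> ball z (\<epsilon> z)"
            using st * y y\<Omega> x e by (auto intro!: near simp del: mem_ball) (use y in auto)
          \<comment> \<open>At time \<open>s\<close> the end points lie in both balls, so the old
            variation can be expressed by \<open>f z\<close>, the primitive used from
            \<open>s\<close> on.\<close>
          have "f w (H (s, y)) - f w (H (s, x)) = f z (H (s, y)) - f z (H (s, x))"
            using Hs \<Phi>[of y] \<Phi>[of x] y \<delta>(1) by (intro consist w z) auto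
          then have "\<Phi> s y - \<Phi> s x = f z (H (s, y)) - f z (H (s, x))" using \<Phi>[of y] y by simp
          moreover have "t \<le> s \<longleftrightarrow> t = s" using st by auto
          ultimately show "(if t \<le> s then \<Phi> t y else \<Phi> s y + f z (H (t, y)) - f z (H (s, y))) -
              (if t \<le> s then \<Phi> t x else \<Phi> s x + f z (H (t, x)) - f z (H (s, x)))
              = f z (H (t, y)) - f z (H (t, x))"
            by (cases "t = s") auto
        qed
      qed (use e in auto)
    qed auto
    then show ?thesis using I0 by simp
  qed
  \<comment> \<open>The choice is harmless: all continuations starting at 0 have the same end
    value.\<close>
  define q where "q y = (SOME \<phi>. primitive_along \<Omega> \<epsilon> f (\<lambda>t. H (t, y)) 1 \<phi> \<and> \<phi> 0 = 0) 1" for y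
  have q: "q y = \<phi> 1" if "primitive_along \<Omega> \<epsilon> f (\<lambda>t. H (t, y)) 1 \<phi>" "\<phi> 0 = 0" for y \<phi>
  proof -
    have "primitive_along \<Omega> \<epsilon> f (\<lambda>t. H (t, y)) 1 (SOME \<phi>. primitive_along \<Omega> \<epsilon> f (\<lambda>t. H (t, y)) 1 \<phi> \<and> \<phi> 0 = 0) \<and>
      (SOME \<phi>. primitive_along \<Omega> \<epsilon> f (\<lambda>t. H (t, y)) 1 \<phi> \<and> \<phi> 0 = 0) 0 = 0"
      using that by (intro someI[where P = "\<lambda>\<phi>. primitive_along \<Omega> \<epsilon> f (\<lambda>t. H (t, y)) 1 \<phi> \<and> \<phi> 0 = 0"
          and x = \<phi>]) simp
    then show ?thesis
      using primitive_along_unique[OF that(1)] that(2) unfolding q_def by fastforce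
  qed
  show ?thesis
  proof
    fix x assume x: "x \<in> \<Omega>"
    obtain \<delta> \<Phi> w where \<delta>: "\<delta> > 0" "ball x \<delta> \<subseteq> \<Omega>" and w: "w \<in> \<Omega>" and
      \<Phi>: "\<And>y. y \<in> ball x \<delta> \<Longrightarrow> primitive_along \<Omega> \<epsilon> f (\<lambda>t. H (t, y)) 1 (\<lambda>t. \<Phi> t y) \<and> \<Phi> 0 y = 0 \<and>
        H (1, y) \<in> ball w (\<epsilon> w) \<and> \<Phi> 1 y - \<Phi> 1 x = f w (H (1, y)) - f w (H (1, x))"
      using I1[OF x] unfolding I_def by blast
    show "\<exists>\<delta>>0. \<forall>y\<in>ball x \<delta>. q y - q x = f x y - f x x"
    proof (intro exI[of _ "min \<delta> (\<epsilon> x)"] conjI ballI)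
      fix y assume y: "y \<in> ball x (min \<delta> (\<epsilon> x))"
      then have "y \<in> ball x \<delta>" "y \<in> \<Omega>" using \<delta> by auto
      moreover have "x \<in> ball x \<delta>" using \<delta> by simp
      ultimately have "q y = \<Phi> 1 y" "q x = \<Phi> 1 x"
        "\<Phi> 1 y - \<Phi> 1 x = f w y - f w x" "y \<in> ball w (\<epsilon> w)" "x \<in> ball w (\<epsilon> w)"
        using \<Phi>[of y] \<Phi>[of x] q[of y "\<lambda>t. \<Phi> t y"] q[of x "\<lambda>t. \<Phi> t x"] H(4) x by auto
      moreover have "f w y - f w x = f x y - f x x"
        using y calculation \<epsilon>[OF x] by (intro consist w x) auto
      ultimately show "q y - q x = f x y - f x x" by simp
    qed (use \<delta> \<epsilon>[OF x] in auto)
  qed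
qed

end


section \<open>Divergences on the four triangles around an edge point\<close>

text \<open>Coordinates \<open>X \<bullet> (z - m)\<close> and \<open>Y \<bullet> (z - m)\<close> are centred at the edge point \<open>m\<close>; the scaling
  factors \<open>g\<close> and \<open>h\<close> have the sign of the coordinates on the quadrant; for the dual basis \<open>s\<close>, \<open>t\<close> the other
  two vertices of the triangle are \<open>m + s / g\<close> and \<open>m + t / h\<close>.\<close>

definition quad :: "pt \<Rightarrow> pt \<Rightarrow> pt \<Rightarrow> real \<Rightarrow> real \<Rightarrow> pt set" where
  "quad X Y m g h = {z. 0 < g * (X \<bullet> (z - m)) \<and> 0 < h * (Y \<bullet> (z - m)) \<and>
     g * (X \<bullet> (z - m)) + h * (Y \<bullet> (z - m)) < 1}"

text \<open>The nodal function of \<open>m\<close> on the four triangles, continued to the whole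
  plane: for \<open>g1 > 0 > g2\<close> the maximum selects the factor with the sign of the
  coordinate, and likewise for \<open>h1\<close>, \<open>h2\<close>. Outside the triangles the value
  is nonpositive.\<close>

definition hat :: "pt \<Rightarrow> pt \<Rightarrow> pt \<Rightarrow> real \<Rightarrow> real \<Rightarrow> real \<Rightarrow> real \<Rightarrow> pt \<Rightarrow> real" where
  "hat X Y m g1 g2 h1 h2 z = 1 - max (g1 * (X \<bullet> (z - m))) (g2 * (X \<bullet> (z - m)))
     - max (h1 * (Y \<bullet> (z - m))) (h2 * (Y \<bullet> (z - m)))"

lemma open_quad: "open (quad X Y m g h)"
  unfolding quad_def by (intro open_Collect_conj open_Collect_less continuous_intros)

lemma hat_quad:
  assumes "g1 > 0" "g2 < 0" "h1 > 0" "h2 < 0" "g \<in> {g1, g2}" "h \<in> {h1, h2}" "z \<in> quad X Y m g h"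
  shows "hat X Y m g1 g2 h1 h2 z = 1 - g * (X \<bullet> (z - m)) - h * (Y \<bullet> (z - m))"
proof -
  have *: "max (a * v) (b * v) = c * v" if "c \<in> {a, b}" "a > 0" "b < 0" "0 < c * v" for a b c v :: real
    using that by (auto simp: zero_less_mult_iff max_def mult_le_cancel_right)
  show ?thesis
    using assms *[of g g1 g2 "X \<bullet> (z - m)"] *[of h h1 h2 "Y \<bullet> (z - m)"]
    by (auto simp: hat_def quad_def)
qed

lemma quad_unique:
  assumes signs: "g1 > 0" "g2 < 0" "h1 > 0" "h2 < 0"
    and gh: "g \<in> {g1, g2}" "h \<in> {h1, h2}" "g' \<in> {g1, g2}" "h' \<in> {h1, h2}"
    and z: "z \<in> quad X Y p g h" "z \<in> quad X Y p g' h'"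
  shows "g' = g \<and> h' = h"
proof -
  have eq: "a = b" if "a \<in> {u, v}" "b \<in> {u, v}" "0 < a * r" "0 < b * r" "0 < u" "v < 0" for a b u v r :: real
  proof (cases "0 < r")
    case True
    then have "0 < a" "0 < b" using that(3,4) by (simp_all add: zero_less_mult_iff)
    then show ?thesis using that by auto
  next
    case False
    then have "a < 0" "b < 0" using that(3,4) by (auto simp: zero_less_mult_iff)
    then show ?thesis using that by auto
  qed
  show ?thesis
    using eq[OF gh(3,1) _ _ signs(1,2)] eq[OF gh(4,2) _ _ signs(3,4)] z unfolding quad_def mem_Collect_eq by blast
qed

lemma continuous_on_hat: "continuous_on U (hat X Y m g1 g2 h1 h2)"
  unfolding hat_def by (intro continuous_intros)

text \<open>\<open>S\<close> abstracts the families of functions on the four quadrants that are piecewise divergences;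
  by \<open>div\<close> it contains the divergence \<open>D f w\<close> of each admissible field \<open>f *\<^sub>R w\<close>.\<close>

locale cross =
  fixes X Y m s t :: pt and g1 g2 h1 h2 :: real and k :: nat and S :: "(real \<Rightarrow> real \<Rightarrow> pt \<Rightarrow> real) set"
  assumes signs: "g1 > 0" "g2 < 0" "h1 > 0" "h2 < 0"
    and frame: "X \<bullet> s = 1" "X \<bullet> t = 0" "Y \<bullet> s = 0" "Y \<bullet> t = 1"
    and coords: "\<And>z. z = (X \<bullet> z) *\<^sub>R s + (Y \<bullet> z) *\<^sub>R t"
    and S_add: "\<And>F G. F \<in> S \<Longrightarrow> G \<in> S \<Longrightarrow> (\<lambda>g h z. F g h z + G g h z) \<in> S"
    and S_cmult: "\<And>F a. F \<in> S \<Longrightarrow> (\<lambda>g h z. a * F g h z) \<in> S"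
    and S_cong: "\<And>F G. F \<in> S \<Longrightarrow> (\<And>g h z. g \<in> {g1, g2} \<Longrightarrow> h \<in> {h1, h2} \<Longrightarrow> z \<in> quad X Y m g h \<Longrightarrow>
        F g h z = G g h z) \<Longrightarrow> G \<in> S"
    and div: "\<And>f w F. continuous_on UNIV f \<Longrightarrow> (\<And>z. hat X Y m g1 g2 h1 h2 z \<le> 0 \<Longrightarrow> f z = 0) \<Longrightarrow>
        (\<And>g h. g \<in> {g1, g2} \<Longrightarrow> h \<in> {h1, h2} \<Longrightarrow> \<exists>p\<in>poly2 k. \<forall>z\<in>quad X Y m g h. f z = p z) \<Longrightarrow>
        (\<And>g h z. g \<in> {g1, g2} \<Longrightarrow> h \<in> {h1, h2} \<Longrightarrow> z \<in> quad X Y m g h \<Longrightarrow>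
           \<exists>f'. (f has_derivative f') (at z) \<and> f' w = F g h z) \<Longrightarrow> F \<in> S"
    and one: "(\<lambda>g h z. 1) \<in> S"
begin

abbreviation x where "x z \<equiv> X \<bullet> (z - m)"
abbreviation y where "y z \<equiv> Y \<bullet> (z - m)"
abbreviation u where "u g h z \<equiv> 1 - g * x z - h * y z"

text \<open>The two lines play symmetric roles; statements for the direction \<open>t\<close> are
  deduced from those for \<open>s\<close> through this interpretation.\<close>

lemma swap: "cross Y X m t s h1 h2 g1 g2 k {F. (\<lambda>g h. F h g) \<in> S}"
proof -
  have q: "quad Y X m h g = quad X Y m g h" for g h by (auto simp: quad_def)
  have h: "hat Y X m h1 h2 g1 g2 = hat X Y m g1 g2 h1 h2" by (auto simp: hat_def)
  show ?thesis
  proof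
    fix F G assume *: "F \<in> {F. (\<lambda>g h. F h g) \<in> S}" "\<And>g h z. g \<in> {h1, h2} \<Longrightarrow> h \<in> {g1, g2} \<Longrightarrow>
       z \<in> quad Y X m g h \<Longrightarrow> F g h z = G g h z"
    have "(\<lambda>g h. G h g) \<in> S"
      by (rule S_cong[of "\<lambda>g h. F h g"]) (use * q in auto)
    then show "G \<in> {F. (\<lambda>g h. F h g) \<in> S}" by simp
  next
    fix f w F
    assume *: "continuous_on UNIV f" "\<And>z. hat Y X m h1 h2 g1 g2 z \<le> 0 \<Longrightarrow> f z = 0"
      "\<And>g h. g \<in> {h1, h2} \<Longrightarrow> h \<in> {g1, g2} \<Longrightarrow> \<exists>p\<in>poly2 k. \<forall>z\<in>quad Y X m g h. f z = p z"
      "\<And>g h z. g \<in> {h1, h2} \<Longrightarrow> h \<in> {g1, g2} \<Longrightarrow> z \<in> quad Y X m g h \<Longrightarrow>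
         \<exists>f'. (f has_derivative f') (at z) \<and> f' w = F g h z"
    have "(\<lambda>g h. F h g) \<in> S"
      by (rule div[where f = f and w = w]) (use * q h in auto)
    then show "F \<in> {F. (\<lambda>g h. F h g) \<in> S}" by simp
  next
    fix z show "z = (Y \<bullet> z) *\<^sub>R t + (X \<bullet> z) *\<^sub>R s" using coords[of z] by (simp add: add.commute)
  qed (use signs frame S_add S_cmult one in auto)
qed

text \<open>The field is \<open>max 0 hat\<close> to the power \<open>a + 1\<close> times
  \<open>P\<close>, in direction \<open>s\<close>. On a quadrant it is
  \<open>u ^ (a + 1) * Q\<close>, and \<open>u\<close> has derivative \<open>- g\<close> along
  \<open>s\<close>, so the product rule gives the two terms. Truncation at 0 makes the field vanish
  off the four triangles.\<close>

lemma div_power: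
  assumes P: "continuous_on UNIV P" and d: "a + 1 + d \<le> k"
    and Q: "\<And>g h. g \<in> {g1, g2} \<Longrightarrow> h \<in> {h1, h2} \<Longrightarrow> Q g h \<in> poly2 d"
    and PQ: "\<And>g h z. g \<in> {g1, g2} \<Longrightarrow> h \<in> {h1, h2} \<Longrightarrow> z \<in> quad X Y m g h \<Longrightarrow> P z = Q g h z"
    and Q': "\<And>g h z. g \<in> {g1, g2} \<Longrightarrow> h \<in> {h1, h2} \<Longrightarrow> z \<in> quad X Y m g h \<Longrightarrow>
        \<exists>Q'. (Q g h has_derivative Q') (at z) \<and> Q' s = R g h z"
  shows "(\<lambda>g h z. u g h z ^ Suc a * R g h z - Suc a * g * u g h z ^ a * Q g h z) \<in> S"
proof (rule div)
  let ?f = "\<lambda>z. max 0 (hat X Y m g1 g2 h1 h2 z) ^ Suc a * P z"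
  show "continuous_on UNIV ?f"
    using P by (intro continuous_intros continuous_on_hat)
  show "hat X Y m g1 g2 h1 h2 z \<le> 0 \<Longrightarrow> ?f z = 0" for z by (simp add: max_def)
  fix g h assume g: "g \<in> {g1, g2}" and h: "h \<in> {h1, h2}"
  have f: "?f z = u g h z ^ Suc a * Q g h z" if "z \<in> quad X Y m g h" for z
    using PQ[OF g h that] hat_quad[OF signs g h that] that by (simp add: quad_def max_def)
  have "(\<lambda>z. 1 - g * x z - h * y z) \<in> poly2 1"
    by (intro poly2_diff poly2_cmult poly2_inner poly2_const)
  from poly2_mult[OF poly2_power[OF this, of "Suc a"] Q[OF g h]]
  have "(\<lambda>z. u g h z ^ Suc a * Q g h z) \<in> poly2 k"
    by (rule poly2_mono) (use d in simp)
  then show "\<exists>p\<in>poly2 k. \<forall>z\<in>quad X Y m g h. ?f z = p z"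
    by (rule rev_bexI) (rule ballI, rule f)
  fix z assume z: "z \<in> quad X Y m g h"
  obtain Q' where Q': "(Q g h has_derivative Q') (at z)" "Q' s = R g h z" using Q'[OF g h z] by blast
  have "((\<lambda>z. u g h z ^ Suc a * Q g h z) has_derivative
      (\<lambda>v. u g h z ^ Suc a * Q' v + (Suc a * (- g * (X \<bullet> v) - h * (Y \<bullet> v)) * u g h z ^ a) * Q g h z)) (at z)"
    by (rule has_derivative_eq_rhs, (rule derivative_eq_intros Q' refl)+) (auto simp: algebra_simps)
  then have "(?f has_derivative
      (\<lambda>v. u g h z ^ Suc a * Q' v + (Suc a * (- g * (X \<bullet> v) - h * (Y \<bullet> v)) * u g h z ^ a) * Q g h z)) (at z)"
    by (rule has_derivative_transform_within_open[OF _ open_quad z]) (simp only: f)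
  then show "\<exists>f'. (?f has_derivative f') (at z) \<and>
      f' s = u g h z ^ Suc a * R g h z - Suc a * g * u g h z ^ a * Q g h z"
    by (rule exI[of _ "\<lambda>v. u g h z ^ Suc a * Q' v + (Suc a * (- g * (X \<bullet> v) - h * (Y \<bullet> v)) * u g h z ^ a) * Q g h z",
          OF conjI]) (use Q'(2) frame in \<open>simp add: algebra_simps\<close>)
qed

lemma div_power_swap:
  assumes "continuous_on UNIV P" "a + 1 + d \<le> k"
    "\<And>g h. g \<in> {g1, g2} \<Longrightarrow> h \<in> {h1, h2} \<Longrightarrow> Q g h \<in> poly2 d"
    "\<And>g h z. g \<in> {g1, g2} \<Longrightarrow> h \<in> {h1, h2} \<Longrightarrow> z \<in> quad X Y m g h \<Longrightarrow> P z = Q g h z"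
    "\<And>g h z. g \<in> {g1, g2} \<Longrightarrow> h \<in> {h1, h2} \<Longrightarrow> z \<in> quad X Y m g h \<Longrightarrow>
        \<exists>Q'. (Q g h has_derivative Q') (at z) \<and> Q' t = R g h z"
  shows "(\<lambda>g h z. u g h z ^ Suc a * R g h z - Suc a * h * u g h z ^ a * Q g h z) \<in> S"
proof -
  have q: "quad Y X m h g = quad X Y m g h" for g h by (auto simp: quad_def)
  have "(\<lambda>h g z. (1 - h * y z - g * x z) ^ Suc a * R g h z - Suc a * h * (1 - h * y z - g * x z) ^ a * Q g h z)
      \<in> {F. (\<lambda>g h. F h g) \<in> S}"
    by (rule cross.div_power[OF swap assms(1,2)]) (use assms(3-5) q in auto)
  then show ?thesis by (simp add: algebra_simps)
qed

lemma has_derivative_xy: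
  "(x has_derivative (\<lambda>v. X \<bullet> v)) F" "(y has_derivative (\<lambda>v. Y \<bullet> v)) F"
  by (auto intro!: derivative_eq_intros)

text \<open>The radial field \<open>u\<^sup>i (x s + y t)\<close> passes from \<open>u\<^sup>i\<^sup>-\<^sup>1\<close> to \<open>u\<^sup>i\<close>.\<close>

lemma power_u: "Suc i \<le> k \<Longrightarrow> (\<lambda>g h z. u g h z ^ i) \<in> S"
proof (induction i)
  case 0
  then show ?case using one by simp
next
  case (Suc i)
  have 1: "(\<lambda>g h z. u g h z ^ Suc i * 1 - Suc i * g * u g h z ^ i * x z) \<in> S"
    using Suc.prems has_derivative_xy frame
    by (intro div_power[of x i 1 "\<lambda>_ _. x"]) (auto intro!: continuous_intros poly2_inner[unfolded One_nat_def] exI[of _ "\<lambda>v. X \<bullet> v"])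
  have 2: "(\<lambda>g h z. u g h z ^ Suc i * 1 - Suc i * h * u g h z ^ i * y z) \<in> S"
    using Suc.prems has_derivative_xy frame
    by (intro div_power_swap[of y i 1 "\<lambda>_ _. y"]) (auto intro!: continuous_intros poly2_inner[unfolded One_nat_def] exI[of _ "\<lambda>v. Y \<bullet> v"])
  have 3: "(\<lambda>g h z. u g h z ^ i) \<in> S" using Suc by simp
  \<comment> \<open>As \<open>g * x z + h * y z = 1 - u\<close>, the two divergences add up to
    \<open>(3 + i) * u ^ (i + 1) - (i + 1) * u ^ i\<close>; the induction hypothesis removes the
    last term.\<close>
  have 4: "(\<lambda>g h z. (1 / (3 + real i)) * ((u g h z ^ Suc i * 1 - Suc i * g * u g h z ^ i * x z +
      (u g h z ^ Suc i * 1 - Suc i * h * u g h z ^ i * y z)) + Suc i * u g h z ^ i)) \<in> S"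
    by (intro S_cmult S_add 1 2 3)
  have 5: "(1 / (3 + real i)) * ((u g h z ^ Suc i * 1 - Suc i * g * u g h z ^ i * x z +
      (u g h z ^ Suc i * 1 - Suc i * h * u g h z ^ i * y z)) + Suc i * u g h z ^ i) = u g h z ^ Suc i" for g h :: real and z
  proof -
    define U where "U = u g h z"
    have U: "g * x z = 1 - U - h * y z" by (simp add: U_def)
    have "(U ^ Suc i * 1 - Suc i * g * U ^ i * x z + (U ^ Suc i * 1 - Suc i * h * U ^ i * y z)) + Suc i * U ^ i
       = 2 * U ^ Suc i - Suc i * U ^ i * (g * x z + h * y z - 1)"
      by (simp add: algebra_simps)
    also have "\<dots> = (3 + real i) * U ^ Suc i" unfolding U by (simp add: algebra_simps)
    finally show ?thesis unfolding U_def by simp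
  qed
  show ?case by (rule S_cong[OF 4]) (rule 5)
qed

text \<open>A power of \<open>u\<close> times a constant direction \<open>s\<close> or
  \<open>t\<close> has divergence proportional to \<open>g * u ^ i\<close> or
  \<open>h * u ^ i\<close>. Combined with \<open>u ^ i\<close> itself, linear interpolation between
  the two values of the factor isolates one half.\<close>

lemma power_u_half:
  assumes "Suc i \<le> k"
  shows "h0 \<in> {h1, h2} \<Longrightarrow> (\<lambda>g h z. if h = h0 then u g h z ^ i else 0) \<in> S"
    and "g0 \<in> {g1, g2} \<Longrightarrow> (\<lambda>g h z. if g = g0 then u g h z ^ i else 0) \<in> S"
proof -
  have cont: "continuous_on UNIV (\<lambda>z::pt. 1::real)" by simp
  have g: "(\<lambda>g h z. u g h z ^ Suc i * 0 - Suc i * g * u g h z ^ i * 1) \<in> S"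
    using assms by (intro div_power[of "\<lambda>_. 1" i 0 "\<lambda>_ _ _. 1"]) (auto intro: exI[of _ "\<lambda>_. 0"])
  have h: "(\<lambda>g h z. u g h z ^ Suc i * 0 - Suc i * h * u g h z ^ i * 1) \<in> S"
    using assms by (intro div_power_swap[of "\<lambda>_. 1" i 0 "\<lambda>_ _ _. 1"]) (auto intro: exI[of _ "\<lambda>_. 0"])
  have g': "(\<lambda>g h z. g * u g h z ^ i) \<in> S"
    by (rule S_cong[OF S_cmult[OF g, of "- 1 / Suc i"]]) simp
  have h': "(\<lambda>g h z. h * u g h z ^ i) \<in> S"
    by (rule S_cong[OF S_cmult[OF h, of "- 1 / Suc i"]]) simp
  note ui = power_u[OF assms]
  show "(\<lambda>g h z. if h = h0 then u g h z ^ i else 0) \<in> S" if "h0 \<in> {h1, h2}"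
  proof -
    \<comment> \<open>The other admissible value: \<open>(h - a) / (h0 - a)\<close> is 1 at
      \<open>h0\<close> and 0 at \<open>a\<close>.\<close>
    define a where "a = (if h0 = h1 then h2 else h1)"
    have a: "a \<noteq> h0" "{h1, h2} = {h0, a}" using that signs by (auto simp: a_def)
    show ?thesis
      by (rule S_cong[OF S_cmult[of _ "1 / (h0 - a)", OF S_add[OF h' S_cmult[OF ui, of "- a"]]]])
        (use a in \<open>auto simp: field_simps\<close>)
  qed
  show "(\<lambda>g h z. if g = g0 then u g h z ^ i else 0) \<in> S" if "g0 \<in> {g1, g2}"
  proof -
    define a where "a = (if g0 = g1 then g2 else g1)"
    have a: "a \<noteq> g0" "{g1, g2} = {g0, a}" using that signs by (auto simp: a_def)
    show ?thesis
      by (rule S_cong[OF S_cmult[of _ "1 / (g0 - a)", OF S_add[OF g' S_cmult[OF ui, of "- a"]]]])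
        (use a in \<open>auto simp: field_simps\<close>)
  qed
qed

text \<open>The truncated coordinate is continuous and vanishes on one side of the line, so a field
  may be cut off there as soon as it carries a positive power of that coordinate.\<close>

lemma max_quad:
  assumes "h \<in> {h1, h2}" "h0 \<in> {h1, h2}" "z \<in> quad X Y m g h"
  shows "max 0 (h0 * y z) = (if h = h0 then h0 * y z else 0)"
proof -
  have "0 < h * y z" using assms by (auto simp: quad_def)
  then show ?thesis using assms(1,2) signs by (auto simp: max_def zero_less_mult_iff mult_le_0_iff zero_le_mult_iff)
qed

lemma max_quad':
  assumes "g \<in> {g1, g2}" "g0 \<in> {g1, g2}" "z \<in> quad X Y m g h"
  shows "max 0 (g0 * x z) = (if g = g0 then g0 * x z else 0)"
proof -
  have "0 < g * x z" using assms by (auto simp: quad_def)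
  then show ?thesis using assms(1,2) signs by (auto simp: max_def zero_less_mult_iff mult_le_0_iff zero_le_mult_iff)
qed

lemma poly2_xy_power: "(\<lambda>z. (g * x z) ^ i) \<in> poly2 i" "(\<lambda>z. (h * y z) ^ l) \<in> poly2 l"
  using poly2_power[OF poly2_cmult[OF poly2_inner[of X m], of g], of i]
    poly2_power[OF poly2_cmult[OF poly2_inner[of Y m], of h], of l] by simp_all

text \<open>Differentiating \<open>u ^ (a + 1) * (h0 * y) ^ (l + 1)\<close> along \<open>t\<close>
  gives a term with one power of the coordinate less and one power of \<open>u\<close> more, known
  by induction, and a nonzero multiple of the target.\<close>

lemma half_monom:
  assumes "h0 \<in> {h1, h2}"
  shows "a + l + 1 \<le> k \<Longrightarrow> (\<lambda>g h z. if h = h0 then u g h z ^ a * (h0 * y z) ^ l else 0) \<in> S"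
proof (induction l arbitrary: a)
  case 0
  then show ?case using power_u_half(1)[OF _ assms, of a] by (simp cong: if_cong)
next
  case (Suc l)
  let ?Q = "\<lambda>(g::real) h z. if h = h0 then (h0 * y z) ^ Suc l else 0"
  have "(\<lambda>g h z. u g h z ^ Suc a * (if h = h0 then Suc l * h0 * (h0 * y z) ^ l else 0)
      - Suc a * h * u g h z ^ a * ?Q g h z) \<in> S"
  proof (rule div_power_swap[of "\<lambda>z. max 0 (h0 * y z) ^ Suc l" a "Suc l" ?Q])
    show "continuous_on UNIV (\<lambda>z. max 0 (h0 * y z) ^ Suc l)" by (intro continuous_intros)
    fix g h assume *: "g \<in> {g1, g2}" "h \<in> {h1, h2}"
    show "?Q g h \<in> poly2 (Suc l)" using poly2_xy_power(2)[of h0 "Suc l"] by (cases "h = h0") auto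
    fix z assume z: "z \<in> quad X Y m g h"
    show "max 0 (h0 * y z) ^ Suc l = ?Q g h z" using max_quad[OF *(2) assms z] by simp
    have "((\<lambda>z. (h0 * y z) ^ Suc l) has_derivative (\<lambda>v. Suc l * (h0 * (Y \<bullet> v)) * (h0 * y z) ^ l)) (at z)"
      by (rule has_derivative_eq_rhs, (rule derivative_eq_intros refl)+) (auto simp: algebra_simps)
    then show "\<exists>Q'. (?Q g h has_derivative Q') (at z) \<and> Q' t = (if h = h0 then Suc l * h0 * (h0 * y z) ^ l else 0)"
      using frame
      by (cases "h = h0") (auto intro: exI[of _ "\<lambda>_. 0"] simp del: power_Suc)
  qed (use Suc.prems in auto)
  from S_add[OF S_cmult[OF this, of "-1"] S_cmult[OF Suc.IH[of "Suc a"], of "Suc l * h0"]] Suc.prems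
  have "(\<lambda>g h z. (1 / (Suc a * h0)) * (- 1 * (u g h z ^ Suc a * (if h = h0 then Suc l * h0 * (h0 * y z) ^ l else 0)
      - Suc a * h * u g h z ^ a * ?Q g h z) + Suc l * h0 * (if h = h0 then u g h z ^ Suc a * (h0 * y z) ^ l else 0))) \<in> S"
    by (intro S_cmult) simp
  then show ?case
    by (rule S_cong) (use assms signs in auto)
qed

text \<open>Along \<open>s\<close> the cut-off factor in \<open>y\<close> is constant, so only
  \<open>u\<close> is differentiated and the result carries the factor \<open>g\<close>;
  interpolation in \<open>g\<close> as in \<open>power_u_half\<close> narrows the half to a
  quadrant. The exponent \<open>Suc l\<close> keeps the cut-off field continuous.\<close>

lemma quarter_monom0:
  assumes "g0 \<in> {g1, g2}" "h0 \<in> {h1, h2}" "a + Suc l + 1 \<le> k"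
  shows "(\<lambda>g h z. if g = g0 \<and> h = h0 then u g h z ^ a * (h0 * y z) ^ Suc l else 0) \<in> S"
proof -
  let ?Q = "\<lambda>(g::real) h z. if h = h0 then (h0 * y z) ^ Suc l else 0"
  have 1: "(\<lambda>g h z. u g h z ^ Suc a * 0 - Suc a * g * u g h z ^ a * ?Q g h z) \<in> S"
  proof (rule div_power[of "\<lambda>z. max 0 (h0 * y z) ^ Suc l" a "Suc l" ?Q])
    show "continuous_on UNIV (\<lambda>z. max 0 (h0 * y z) ^ Suc l)" by (intro continuous_intros)
    fix g h assume *: "g \<in> {g1, g2}" "h \<in> {h1, h2}"
    show "?Q g h \<in> poly2 (Suc l)" using poly2_xy_power(2)[of h0 "Suc l"] by (cases "h = h0") auto
    fix z assume z: "z \<in> quad X Y m g h"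
    show "max 0 (h0 * y z) ^ Suc l = ?Q g h z" using max_quad[OF *(2) assms(2) z] by simp
    have "((\<lambda>z. (h0 * y z) ^ Suc l) has_derivative (\<lambda>v. Suc l * (h0 * (Y \<bullet> v)) * (h0 * y z) ^ l)) (at z)"
      by (rule has_derivative_eq_rhs, (rule derivative_eq_intros refl)+) (auto simp: algebra_simps)
    then show "\<exists>Q'. (?Q g h has_derivative Q') (at z) \<and> Q' s = 0"
      using frame
      by (cases "h = h0") (auto intro: exI[of _ "\<lambda>_. 0"] simp del: power_Suc)
  qed (use assms in auto)
  have 2: "(\<lambda>g h z. if h = h0 then u g h z ^ a * (h0 * y z) ^ Suc l else 0) \<in> S"
    using half_monom[OF assms(2), of a "Suc l"] assms(3) by simp
  define b where "b = (if g0 = g1 then g2 else g1)"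
  have b: "b \<noteq> g0" "{g1, g2} = {g0, b}" using assms(1) signs by (auto simp: b_def)
  show ?thesis
  proof (rule S_cong[OF S_cmult[of _ "1 / (g0 - b)", OF S_add[OF S_cmult[OF 1, of "-1 / Suc a"] S_cmult[OF 2, of "- b"]]]])
    fix g h z assume g: "g \<in> {g1, g2}"
    define A where "A = (if h = h0 then u g h z ^ a * (h0 * y z) ^ Suc l else 0)"
    have "-1 / Suc a * (u g h z ^ Suc a * 0 - Suc a * g * u g h z ^ a * ?Q g h z) = g * A"
      unfolding A_def by simp
    then have "1 / (g0 - b) * (-1 / Suc a * (u g h z ^ Suc a * 0 - Suc a * g * u g h z ^ a * ?Q g h z)
        + - b * (if h = h0 then u g h z ^ a * (h0 * y z) ^ Suc l else 0)) = 1 / (g0 - b) * (g * A + - b * A)"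
      unfolding A_def by (rule arg_cong)
    also have "\<dots> = (if g = g0 then A else 0)"
      using g b by (auto simp: left_diff_distrib[symmetric])
    finally show "1 / (g0 - b) * (-1 / Suc a * (u g h z ^ Suc a * 0 - Suc a * g * u g h z ^ a * ?Q g h z)
        + - b * (if h = h0 then u g h z ^ a * (h0 * y z) ^ Suc l else 0))
      = (if g = g0 \<and> h = h0 then u g h z ^ a * (h0 * y z) ^ Suc l else 0)"
      unfolding A_def by simp
  qed
qed

text \<open>The exchange of \<open>half_monom\<close>, now along \<open>s\<close>: a power of the
  first coordinate is traded for one of \<open>u\<close>. The field is cut off at both lines, which
  requires positive powers of both coordinates and leaves \<open>i = 0\<close> to
  \<open>quarter_monom0\<close>.\<close>

lemma quarter_monom:
  assumes "g0 \<in> {g1, g2}" "h0 \<in> {h1, h2}"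
  shows "a + i + Suc l + 1 \<le> k \<Longrightarrow>
    (\<lambda>g h z. if g = g0 \<and> h = h0 then u g h z ^ a * (g0 * x z) ^ i * (h0 * y z) ^ Suc l else 0) \<in> S"
proof (induction i arbitrary: a)
  case 0
  then show ?case using quarter_monom0[OF assms, of a l] by (simp cong: if_cong)
next
  case (Suc i)
  let ?Q = "\<lambda>g h z. if g = g0 \<and> h = h0 then (g0 * x z) ^ Suc i * (h0 * y z) ^ Suc l else 0"
  let ?R = "\<lambda>g h z. if g = g0 \<and> h = h0 then Suc i * g0 * (g0 * x z) ^ i * (h0 * y z) ^ Suc l else 0"
  have "(\<lambda>g h z. u g h z ^ Suc a * ?R g h z - Suc a * g * u g h z ^ a * ?Q g h z) \<in> S"
  proof (rule div_power[of "\<lambda>z. max 0 (g0 * x z) ^ Suc i * max 0 (h0 * y z) ^ Suc l" a "Suc i + Suc l" ?Q])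
    show "continuous_on UNIV (\<lambda>z. max 0 (g0 * x z) ^ Suc i * max 0 (h0 * y z) ^ Suc l)" by (intro continuous_intros)
    fix g h assume *: "g \<in> {g1, g2}" "h \<in> {h1, h2}"
    show "?Q g h \<in> poly2 (Suc i + Suc l)"
      using poly2_mult[OF poly2_xy_power(1)[of g0 "Suc i"] poly2_xy_power(2)[of h0 "Suc l"]]
      by (cases "g = g0 \<and> h = h0") auto
    fix z assume z: "z \<in> quad X Y m g h"
    show "max 0 (g0 * x z) ^ Suc i * max 0 (h0 * y z) ^ Suc l = ?Q g h z"
      using max_quad[OF *(2) assms(2) z] max_quad'[OF *(1) assms(1) z] by simp
    have "((\<lambda>z. (g0 * x z) ^ Suc i * (h0 * y z) ^ Suc l) has_derivative
       (\<lambda>v. Suc i * (g0 * (X \<bullet> v)) * (g0 * x z) ^ i * (h0 * y z) ^ Suc l +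
            (g0 * x z) ^ Suc i * (Suc l * (h0 * (Y \<bullet> v)) * (h0 * y z) ^ l))) (at z)"
      by (rule has_derivative_eq_rhs, (rule derivative_eq_intros refl)+) (auto simp: algebra_simps)
    then show "\<exists>Q'. (?Q g h has_derivative Q') (at z) \<and> Q' s = ?R g h z"
      using frame
      by (cases "g = g0 \<and> h = h0") (auto intro: exI[of _ "\<lambda>_. 0"] simp del: power_Suc)
  qed (use Suc.prems in auto)
  from S_add[OF S_cmult[OF this, of "-1"] S_cmult[OF Suc.IH[of "Suc a"], of "Suc i * g0"]] Suc.prems
  have "(\<lambda>g h z. (1 / (Suc a * g0)) * (- 1 * (u g h z ^ Suc a * ?R g h z - Suc a * g * u g h z ^ a * ?Q g h z)
     + Suc i * g0 * (if g = g0 \<and> h = h0 then u g h z ^ Suc a * (g0 * x z) ^ i * (h0 * y z) ^ Suc l else 0))) \<in> S"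
    by (intro S_cmult) simp
  then show ?case
    by (rule S_cong) (use assms signs in auto)
qed

lemma quarter_monom':
  assumes "g0 \<in> {g1, g2}" "h0 \<in> {h1, h2}" "a + Suc i + l + 1 \<le> k"
  shows "(\<lambda>g h z. if g = g0 \<and> h = h0 then u g h z ^ a * (g0 * x z) ^ Suc i * (h0 * y z) ^ l else 0) \<in> S"
proof -
  have "(\<lambda>h g z. if h = h0 \<and> g = g0 then (1 - h * y z - g * x z) ^ a * (h0 * y z) ^ l * (g0 * x z) ^ Suc i else 0)
      \<in> {F. (\<lambda>g h. F h g) \<in> S}"
    by (rule cross.quarter_monom[OF swap]) (use assms in auto)
  then have "(\<lambda>g h z. if h = h0 \<and> g = g0 then (1 - h * y z - g * x z) ^ a * (h0 * y z) ^ l * (g0 * x z) ^ Suc i else 0) \<in> S"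
    by simp
  then show ?thesis
  proof (rule S_cong)
    fix g h z
    have "1 - h * y z - g * x z = u g h z" by simp
    then show "(if h = h0 \<and> g = g0 then (1 - h * y z - g * x z) ^ a * (h0 * y z) ^ l * (g0 * x z) ^ Suc i else 0)
      = (if g = g0 \<and> h = h0 then u g h z ^ a * (g0 * x z) ^ Suc i * (h0 * y z) ^ l else 0)"
      by (simp only: mult.assoc mult.commute[of "(h0 * y z) ^ l"] conj_commute)
  qed
qed

text \<open>Expand \<open>q\<close> into barycentric monomials of degree exactly \<open>n\<close>.
  Those containing one of the two coordinates are covered by \<open>quarter_monom\<close> and
  \<open>quarter_monom'\<close>; the remaining coefficient, that of \<open>u ^ n\<close>, is the
  value \<open>q m\<close>.\<close>

lemma quarter_poly:
  assumes "g0 \<in> {g1, g2}" "h0 \<in> {h1, h2}" "q \<in> poly2 n" "n + 1 \<le> k"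
  shows "(\<lambda>g h z. if g = g0 \<and> h = h0 then q z - q m * u g h z ^ n else 0) \<in> S"
proof -
  \<comment> \<open>Barycentric coordinates on the quadrant with vertices \<open>m\<close>,
    \<open>m + s / g0\<close> and \<open>m + t / h0\<close>.\<close>
  have xyz: "z $ i = m $ i * u g0 h0 z + (m $ i + s $ i / g0) * (g0 * x z) + (m $ i + t $ i / h0) * (h0 * y z)" for z i
  proof -
    have "z $ i = m $ i + (z - m) $ i" by simp
    also have "\<dots> = m $ i + x z * s $ i + y z * t $ i" by (subst coords[of "z - m"]) simp
    finally show ?thesis using assms(1,2) signs by (auto simp: field_simps)
  qed
  show ?thesis
    using assms(3)
  proof (rule poly2_barycentric_induct[where u = "u g0 h0" and v = "\<lambda>z. g0 * x z" and w = "\<lambda>z. h0 * y z"])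
    fix a j i l assume n: "j + i + l = n"
    have ccong: "P \<in> S \<Longrightarrow> (\<And>g h z. P g h z = Q g h z) \<Longrightarrow> Q \<in> S" for P Q by (metis ext)
    consider "i = 0" "l = 0" | l' where "l = Suc l'" | i' where "i = Suc i'" by (cases i; cases l) auto
    then show "(\<lambda>g h z. if g = g0 \<and> h = h0 then a * u g0 h0 z ^ j * (g0 * x z) ^ i * (h0 * y z) ^ l -
        a * u g0 h0 m ^ j * (g0 * x m) ^ i * (h0 * y m) ^ l * u g h z ^ n else 0) \<in> S"
    proof cases
      case 1
      show ?thesis by (rule S_cong[OF S_cmult[OF one, of 0]]) (use 1 n in auto)
    next
      case (2 l')
      show ?thesis
        by (rule S_cong[OF S_cmult[OF quarter_monom[OF assms(1,2), of j i l'], of a]])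
          (use 2 n assms(4) in auto)
    next
      case (3 i')
      show ?thesis
        by (rule S_cong[OF S_cmult[OF quarter_monom'[OF assms(1,2), of j i' l], of a]])
          (use 3 n assms(4) in auto)
    qed
  next
    fix p q assume *: "(\<lambda>g h z. if g = g0 \<and> h = h0 then p z - p m * u g h z ^ n else 0) \<in> S"
      "(\<lambda>g h z. if g = g0 \<and> h = h0 then q z - q m * u g h z ^ n else 0) \<in> S"
    show "(\<lambda>g h z. if g = g0 \<and> h = h0 then p z + q z - (p m + q m) * u g h z ^ n else 0) \<in> S"
      by (rule S_cong[OF S_add[OF *]]) (auto simp: algebra_simps)
  qed (rule xyz | simp)+
qed

text \<open>After \<open>quarter_poly\<close> four multiples of \<open>u ^ n\<close> remain, one per
  quadrant. Available are \<open>u ^ n\<close> on all quadrants and on one half in each direction: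
  these three span exactly the coefficient arrays with vanishing alternating sum.\<close>

lemma all_poly:
  assumes q: "\<And>g h. g \<in> {g1, g2} \<Longrightarrow> h \<in> {h1, h2} \<Longrightarrow> q g h \<in> poly2 n" and n: "n + 1 \<le> k"
    and \<theta>: "q g1 h1 m - q g1 h2 m + q g2 h2 m - q g2 h1 m = 0"
  shows "q \<in> S"
proof -
  note sum4 = S_add[OF S_add[OF quarter_poly[of g1 h1 "q g1 h1" n] quarter_poly[of g1 h2 "q g1 h2" n]]
      S_add[OF quarter_poly[of g2 h1 "q g2 h1" n] quarter_poly[of g2 h2 "q g2 h2" n]]]
  have ne: "g1 \<noteq> g2" "h1 \<noteq> h2" using signs by auto
  have u: "(\<lambda>g h z. u g h z ^ n) \<in> S" using n by (intro power_u) simp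
  have uh: "(\<lambda>g h z. if h = h2 then u g h z ^ n else 0) \<in> S" using n by (intro power_u_half) auto
  have ug: "(\<lambda>g h z. if g = g2 then u g h z ^ n else 0) \<in> S" using n by (intro power_u_half) auto
  note rest = S_add[OF S_cmult[OF u, of "q g1 h1 m"] S_add[OF S_cmult[OF uh, of "q g1 h2 m - q g1 h1 m"]
      S_cmult[OF ug, of "q g2 h1 m - q g1 h1 m"]]]
  have q22: "q g2 h2 m = q g1 h1 m + (q g1 h2 m - q g1 h1 m) + (q g2 h1 m - q g1 h1 m)" using \<theta> by simp
  show ?thesis
    by (rule S_cong[OF S_add[OF sum4 rest]]) (use q n ne in \<open>auto simp: q22 algebra_simps\<close>)
qed

end


section \<open>Geometry of the Powell--Sabin refinement\<close>

text \<open>The matrix with rows \<open>X\<close>, \<open>Y\<close> is a left inverse of the one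
  with columns \<open>s\<close>, \<open>t\<close>, hence also a right inverse.\<close>

lemma frame_coords:
  fixes X Y s t z :: pt
  assumes "X \<bullet> s = 1" "X \<bullet> t = 0" "Y \<bullet> s = 0" "Y \<bullet> t = 1"
  shows "z = (X \<bullet> z) *\<^sub>R s + (Y \<bullet> z) *\<^sub>R t"
proof -
  have e: "X$1 * s$1 + X$2 * s$2 = 1" "X$1 * t$1 + X$2 * t$2 = 0"
    "Y$1 * s$1 + Y$2 * s$2 = 0" "Y$1 * t$1 + Y$2 * t$2 = 1"
    using assms by (auto simp: inner_vec_def sum_2)
  have "z$1 = (X$1 * z$1 + X$2 * z$2) * s$1 + (Y$1 * z$1 + Y$2 * z$2) * t$1"
    "z$2 = (X$1 * z$1 + X$2 * z$2) * s$2 + (Y$1 * z$1 + Y$2 * z$2) * t$2"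
    using e by algebra+
  then show ?thesis by (auto simp: vec_eq_iff forall_2 inner_vec_def sum_2)
qed

lemma dual_frame_exists:
  fixes X s t :: "'a::real_inner"
  assumes "X \<bullet> s = 1" "X \<bullet> t = 0" "t \<noteq> 0"
  shows "\<exists>Y. Y \<bullet> s = 0 \<and> Y \<bullet> t = 1"
  \<comment> \<open>The multiple of \<open>t\<close> dual to \<open>t\<close>, corrected by a
    multiple of \<open>X\<close>, which vanishes on \<open>t\<close>, so as to annihilate
    \<open>s\<close>.\<close>
  by (rule exI[of _ "(1 / (t \<bullet> t)) *\<^sub>R t - ((t \<bullet> s) / (t \<bullet> t)) *\<^sub>R X"])
     (use assms in \<open>auto simp: inner_diff_left\<close>)

definition ctri :: "pt \<Rightarrow> pt \<Rightarrow> pt \<Rightarrow> real \<Rightarrow> real \<Rightarrow> pt set" where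
  "ctri X Y m g h = {z. 0 \<le> g * (X \<bullet> (z - m)) \<and> 0 \<le> h * (Y \<bullet> (z - m)) \<and>
     g * (X \<bullet> (z - m)) + h * (Y \<bullet> (z - m)) \<le> 1}"

lemma convex_hull_eq_ctri:
  fixes X Y s t m :: pt
  assumes "X \<bullet> s = 1" "X \<bullet> t = 0" "Y \<bullet> s = 0" "Y \<bullet> t = 1" "g \<noteq> 0" "h \<noteq> 0"
  shows "convex hull {m + (1 / g) *\<^sub>R s, m + (1 / h) *\<^sub>R t, m} = ctri X Y m g h"
proof -
  let ?P = "\<lambda>u v w. u *\<^sub>R (m + (1 / g) *\<^sub>R s) + v *\<^sub>R (m + (1 / h) *\<^sub>R t) + w *\<^sub>R m"
  have P: "?P u v w - m = (u / g) *\<^sub>R s + (v / h) *\<^sub>R t" if "u + v + w = 1" for u v w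
  proof -
    have "?P u v w - m = (u / g) *\<^sub>R s + (v / h) *\<^sub>R t + (u + v + w) *\<^sub>R m - m"
      by (simp add: algebra_simps)
    then show ?thesis by (simp add: that)
  qed
  have "?P u v w \<in> ctri X Y m g h" if "0 \<le> u" "0 \<le> v" "0 \<le> w" "u + v + w = 1" for u v w
    using that assms unfolding ctri_def mem_Collect_eq P[OF that(4)] by (simp add: inner_add_right)
  moreover have "\<exists>u v w. 0 \<le> u \<and> 0 \<le> v \<and> 0 \<le> w \<and> u + v + w = 1 \<and> z = ?P u v w" if "z \<in> ctri X Y m g h" for z
  proof (intro exI conjI)
    let ?u = "g * (X \<bullet> (z - m))" and ?v = "h * (Y \<bullet> (z - m))"
    show "0 \<le> ?u" "0 \<le> ?v" "0 \<le> 1 - ?u - ?v" "?u + ?v + (1 - ?u - ?v) = 1"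
      using that by (auto simp: ctri_def)
    have "?P ?u ?v (1 - ?u - ?v) - m = z - m"
      using assms(5,6) frame_coords[OF assms(1-4), of "z - m"] by (subst P) auto
    then show "z = ?P ?u ?v (1 - ?u - ?v)" unfolding eq_commute[of z] by (metis diff_add_cancel)
  qed
  ultimately show ?thesis unfolding convex_hull_3 by blast
qed

lemma interior_ctri:
  assumes "X \<noteq> 0" "Y \<noteq> 0" "g \<noteq> 0" "h \<noteq> 0" "g *\<^sub>R X + h *\<^sub>R Y \<noteq> 0"
  shows "interior (ctri X Y m g h) = quad X Y m g h"
proof
  have "ctri X Y m g h \<subseteq> {z. (g *\<^sub>R X) \<bullet> z \<ge> (g *\<^sub>R X) \<bullet> m}" "ctri X Y m g h \<subseteq> {z. (h *\<^sub>R Y) \<bullet> z \<ge> (h *\<^sub>R Y) \<bullet> m}"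
    "ctri X Y m g h \<subseteq> {z. (g *\<^sub>R X + h *\<^sub>R Y) \<bullet> z \<le> 1 + (g *\<^sub>R X + h *\<^sub>R Y) \<bullet> m}"
    by (auto simp: ctri_def inner_diff_right inner_add_left algebra_simps)
  from this[THEN interior_mono] have "interior (ctri X Y m g h) \<subseteq> {z. (g *\<^sub>R X) \<bullet> z > (g *\<^sub>R X) \<bullet> m}"
    "interior (ctri X Y m g h) \<subseteq> {z. (h *\<^sub>R Y) \<bullet> z > (h *\<^sub>R Y) \<bullet> m}"
    "interior (ctri X Y m g h) \<subseteq> {z. (g *\<^sub>R X + h *\<^sub>R Y) \<bullet> z < 1 + (g *\<^sub>R X + h *\<^sub>R Y) \<bullet> m}"
    using assms by (simp_all only: interior_halfspace_ge interior_halfspace_le scaleR_eq_0_iff not_False_eq_True simp_thms)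
  then show "interior (ctri X Y m g h) \<subseteq> quad X Y m g h"
    by (auto simp: quad_def inner_diff_right inner_add_left algebra_simps)
  show "quad X Y m g h \<subseteq> interior (ctri X Y m g h)"
    by (intro interior_maximal open_quad) (auto simp: quad_def ctri_def)
qed

lemma hat_ctri:
  assumes "g1 > 0" "g2 < 0" "h1 > 0" "h2 < 0" "hat X Y m g1 g2 h1 h2 z > 0"
    "g \<in> {g1, g2}" "0 \<le> g * (X \<bullet> (z - m))"
  shows "\<exists>h\<in>{h1, h2}. z \<in> ctri X Y m g h"
proof -
  have "g * (X \<bullet> (z - m)) \<le> max (g1 * (X \<bullet> (z - m))) (g2 * (X \<bullet> (z - m)))" using assms(6) by auto
  moreover obtain h where "h \<in> {h1, h2}" "0 \<le> h * (Y \<bullet> (z - m))"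
    using assms(3,4) by (metis insertI1 insertI2 mult_nonneg_nonneg mult_nonpos_nonpos less_imp_le linorder_le_cases)
  moreover from this have "h * (Y \<bullet> (z - m)) \<le> max (h1 * (Y \<bullet> (z - m))) (h2 * (Y \<bullet> (z - m)))" by auto
  ultimately show ?thesis using assms(5,7) by (intro bexI[of _ h]) (auto simp: hat_def ctri_def)
qed

section \<open>Incidence of triangles, edges and edge points\<close>

locale ps_refinement =
  fixes \<Omega> :: "pt set" and \<T> :: "pt set set" and c m :: "pt set \<Rightarrow> pt"
  assumes domain: "polygonal_domain \<Omega>" and mesh: "conforming_mesh \<Omega> \<T>" and ps: "powell_sabin \<Omega> \<T> c m"
begin

lemma open_\<Omega>: "open \<Omega>" and connected_\<Omega>: "connected \<Omega>" and nonempty_\<Omega>: "\<Omega> \<noteq> {}"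
  and bounded_\<Omega>: "bounded \<Omega>" and interior_closure_\<Omega>: "interior (closure \<Omega>) = \<Omega>"
  using domain by (auto simp: polygonal_domain_def)

lemma finite_mesh: "finite \<T>" and simplex: "T \<in> \<T> \<Longrightarrow> 2 simplex T" and Union_mesh: "\<Union>\<T> = closure \<Omega>"
  and Int_face: "T \<in> \<T> \<Longrightarrow> T' \<in> \<T> \<Longrightarrow> (T \<inter> T') face_of T"
  using mesh by (auto simp: conforming_mesh_def triangulation_def)

lemma c_interior: "T \<in> \<T> \<Longrightarrow> c T \<in> interior T"
  using ps by (auto simp: powell_sabin_def)

lemma c_in: "T \<in> \<T> \<Longrightarrow> c T \<in> T" using c_interior interior_subset by blast

lemma convex_T: "T \<in> \<T> \<Longrightarrow> convex T" and compact_T: "T \<in> \<T> \<Longrightarrow> compact T"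
  and closed_T: "T \<in> \<T> \<Longrightarrow> closed T" and aff_dim_T: "T \<in> \<T> \<Longrightarrow> aff_dim T = 2"
  and polytope_T: "T \<in> \<T> \<Longrightarrow> polytope T"
  using simplex convex_simplex compact_simplex closed_simplex aff_dim_simplex
    simplex_imp_polytope by blast+

lemma interior_nonempty: "T \<in> \<T> \<Longrightarrow> interior T \<noteq> {}"
  using c_interior by blast

lemma closure_interior_T: "T \<in> \<T> \<Longrightarrow> closure (interior T) = T"
  using convex_closure_interior[OF convex_T interior_nonempty] closed_T by auto

lemma interior_subset_\<Omega>: "T \<in> \<T> \<Longrightarrow> interior T \<subseteq> \<Omega>"
  using Union_mesh interior_mono[of T "closure \<Omega>"] interior_closure_\<Omega> by auto

text \<open>A triangle contained in another would by conformity be a face of full dimension, hence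
  equal to it. So the intersection is a proper face and misses the interior.\<close>

lemma interior_Int_empty:
  assumes "T \<in> \<T>" "T' \<in> \<T>" "T \<noteq> T'" shows "interior T \<inter> T' = {}"
proof -
  have "T \<inter> T' \<noteq> T"
  proof
    assume "T \<inter> T' = T"
    then have "T face_of T'" using Int_face[OF assms(2,1)] by (simp add: Int_commute)
    then have "aff_dim T < aff_dim T'" using face_of_aff_dim_lt convex_T assms by blast
    then show False using assms aff_dim_T by simp
  qed
  then have "(T \<inter> T') \<inter> interior T = {}" using face_of_disjoint_interior Int_face assms by blast
  then show ?thesis using interior_subset by blast
qed

lemma edge_facts:
  assumes "T \<in> \<T>" "e edge_of T"
  shows "e face_of T" "e \<subseteq> T" "e \<inter> interior T = {}" "aff_dim e = 1"
proof -
  show 1: "e face_of T" "e \<subseteq> T" "aff_dim e = 1" using assms by (auto simp: edge_of_def face_of_imp_subset)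
  then have "e \<noteq> T" using aff_dim_T[OF assms(1)] by auto
  then show "e \<inter> interior T = {}" using face_of_disjoint_interior 1 by blast
qed

text \<open>One relative interior point suffices: a face of \<open>T\<close> that meets the relative
  interior of \<open>e\<close> contains \<open>e\<close>, and \<open>T \<inter> T'\<close>, being a
  proper face, has no larger dimension.\<close>

lemma edge_shared:
  assumes T: "T \<in> \<T>" and T': "T' \<in> \<T>" "T' \<noteq> T" and e: "e edge_of T" and z: "z \<in> rel_interior e" "z \<in> T'"
  shows "e edge_of T'" "T \<inter> T' = e"
proof -
  have F: "(T \<inter> T') face_of T" "(T \<inter> T') face_of T'"
    using Int_face[OF T T'(1)] Int_face[OF T'(1) T] by (auto simp: Int_commute)
  have zT: "z \<in> T" using z edge_facts[OF T e] rel_interior_subset by blast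
  have sub: "e \<subseteq> T \<inter> T'"
    by (rule subset_of_face_of[OF F(1)]) (use z zT edge_facts[OF T e] in auto)
  have "T \<inter> T' \<noteq> T" using interior_Int_empty[OF T T'(1)] T' interior_nonempty[OF T] interior_subset[of T] by blast
  then have "aff_dim (T \<inter> T') < 2" using face_of_aff_dim_lt[OF convex_T[OF T] F(1)] aff_dim_T[OF T] by simp
  moreover have "1 \<le> aff_dim (T \<inter> T')" using aff_dim_subset[OF sub] edge_facts[OF T e] by simp
  ultimately have dim: "aff_dim (T \<inter> T') = aff_dim e" using edge_facts[OF T e] by simp
  have "e face_of (T \<inter> T')" using face_of_subset[OF edge_facts(1)[OF T e] sub] by blast
  moreover have "convex (T \<inter> T')" using T T' convex_T by (simp add: convex_Int)
  ultimately show eq: "T \<inter> T' = e" using dim face_of_aff_dim_lt by fastforce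
  show "e edge_of T'" using F(2) edge_facts[OF T e] by (auto simp: eq edge_of_def)
qed

text \<open>Otherwise removing the finitely many other triangles from \<Omega> leaves an open
  neighbourhood of \<open>z\<close> inside \<open>T\<close>, although \<open>z\<close> lies on a
  proper face.\<close>

lemma shared_of_mem_\<Omega>:
  assumes T: "T \<in> \<T>" and e: "e edge_of T" and z: "z \<in> rel_interior e" "z \<in> \<Omega>"
  shows "\<exists>T'\<in>\<T>. T' \<noteq> T \<and> e edge_of T'"
proof (rule ccontr)
  assume no: "\<not> ?thesis"
  then have no': "z \<notin> T'" if "T' \<in> \<T>" "T' \<noteq> T" for T'
    using edge_shared(1)[OF T _ _ e z(1)] that by blast
  have "open (\<Omega> - \<Union>(\<T> - {T}))"
    using finite_mesh closed_T open_\<Omega> by (intro open_Diff closed_Union) auto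
  moreover have "\<Omega> - \<Union>(\<T> - {T}) \<subseteq> T" using Union_mesh closure_subset by fastforce
  moreover have "z \<in> \<Omega> - \<Union>(\<T> - {T})" using z no' by auto
  ultimately have "z \<in> interior T" using interiorI by blast
  then show False using z edge_facts[OF T e] rel_interior_subset by blast
qed

text \<open>\<open>powell_sabin\<close> places \<open>m e\<close> for shared edges and for edges in
  the frontier. An unshared edge is of the second kind: its relative interior misses \<Omega>, and
  so does the whole edge, since the complement of \<Omega> is closed.\<close>

lemma m_rel_interior:
  assumes T: "T \<in> \<T>" and e: "e edge_of T" shows "m e \<in> rel_interior e"
proof (cases "\<exists>T'\<in>\<T>. T' \<noteq> T \<and> e edge_of T'")
  case True
  then obtain T' where "T' \<in> \<T>" "T \<noteq> T'" "e edge_of T'" by auto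
  then have "closed_segment (c T) (c T') \<inter> rel_interior e = {m e}"
    using ps T e unfolding powell_sabin_def by blast
  then show ?thesis by blast
next
  case False
  then have "rel_interior e \<subseteq> - \<Omega>" using shared_of_mem_\<Omega>[OF T e] by blast
  then have "closure (rel_interior e) \<subseteq> - \<Omega>" using open_\<Omega> by (intro closure_minimal) auto
  moreover have "closure (rel_interior e) = closure e"
    using convex_closure_rel_interior face_of_imp_convex edge_facts(1)[OF T e] by blast
  ultimately have "e \<subseteq> - \<Omega>" using closure_subset by blast
  moreover have "e \<subseteq> closure \<Omega>" using edge_facts(2)[OF T e] T Union_mesh by blast
  ultimately have "e \<subseteq> frontier \<Omega>" using open_\<Omega> by (auto simp: frontier_def interior_open)
  then show ?thesis using ps T e unfolding powell_sabin_def by blast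
qed

lemma m_in_e: "T \<in> \<T> \<Longrightarrow> e edge_of T \<Longrightarrow> m e \<in> e"
  using m_rel_interior rel_interior_subset by blast

section \<open>Normalized affine functions vanishing on an edge\<close>

lemma normal_exists:
  assumes T: "T \<in> \<T>" and e: "e edge_of T"
  shows "\<exists>X. X \<bullet> (c T - m e) = 1 \<and> (\<forall>z\<in>T. 0 \<le> X \<bullet> (z - m e)) \<and> e = {z\<in>T. X \<bullet> (z - m e) = 0}"
proof -
  have "e exposed_face_of T"
    using exposed_face_of_polyhedron[OF polytope_imp_polyhedron[OF polytope_T[OF T]]] edge_facts[OF T e] by blast
  then obtain a b where ab: "T \<subseteq> {x. a \<bullet> x \<le> b}" "e = T \<inter> {x. a \<bullet> x = b}"
    unfolding exposed_face_of_def by blast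
  have c: "a \<bullet> c T < b" using ab edge_facts(3)[OF T e] c_interior[OF T] c_in[OF T] by force
  have m: "a \<bullet> m e = b" using ab m_in_e[OF T e] by auto
  \<comment> \<open>The supporting functional is rescaled to take the value 1 at \<open>c T\<close>;
    with this common normalization the functions of two edges agree on a line through
    \<open>c T\<close>.\<close>
  have eq: "(- 1 / (b - a \<bullet> c T)) *\<^sub>R a \<bullet> (z - m e) = (b - a \<bullet> z) / (b - a \<bullet> c T)" for z
  proof -
    have "- 1 / d * u = (- u) / d" for d u :: real by simp
    then show ?thesis unfolding inner_scaleR_left inner_diff_right m
      by (simp add: diff_divide_distrib)
  qed
  show ?thesis
    by (rule exI[of _ "(- 1 / (b - a \<bullet> c T)) *\<^sub>R a"], unfold eq) (use ab c in auto)
qed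

definition nrm :: "pt set \<Rightarrow> pt set \<Rightarrow> pt" where
  "nrm T e = (SOME X. X \<bullet> (c T - m e) = 1 \<and> (\<forall>z\<in>T. 0 \<le> X \<bullet> (z - m e)) \<and> e = {z\<in>T. X \<bullet> (z - m e) = 0})"

text \<open>On \<open>tri T e\<close> this is the barycentric coordinate belonging to
  \<open>c T\<close>.\<close>

definition ell :: "pt set \<Rightarrow> pt set \<Rightarrow> pt \<Rightarrow> real" where
  "ell T e z = nrm T e \<bullet> (z - m e)"

lemma ell:
  assumes "T \<in> \<T>" "e edge_of T"
  shows ell_c: "ell T e (c T) = 1" and ell_nonneg: "z \<in> T \<Longrightarrow> 0 \<le> ell T e z"
    and edge_iff_ell: "z \<in> T \<Longrightarrow> z \<in> e \<longleftrightarrow> ell T e z = 0"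
  using someI_ex[OF normal_exists[OF assms]] unfolding ell_def nrm_def[symmetric] by blast+

lemma ell_edge: "T \<in> \<T> \<Longrightarrow> e edge_of T \<Longrightarrow> z \<in> e \<Longrightarrow> ell T e z = 0"
  using edge_iff_ell edge_facts(2) by blast

lemma ell_affine: "u + v = 1 \<Longrightarrow> ell T e (u *\<^sub>R y + v *\<^sub>R z) = u * ell T e y + v * ell T e z"
proof -
  assume "u + v = 1"
  then have "u *\<^sub>R y + v *\<^sub>R z - m e = u *\<^sub>R (y - m e) + v *\<^sub>R (z - m e)"
    by (simp add: algebra_simps flip: scaleR_add_left)
  then show ?thesis by (simp add: ell_def inner_add_right)
qed

definition has_vertices :: "pt set \<Rightarrow> pt \<Rightarrow> pt \<Rightarrow> pt \<Rightarrow> bool" where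
  "has_vertices T p q r \<longleftrightarrow> T = convex hull {p, q, r} \<and> p \<noteq> q \<and> p \<noteq> r \<and> q \<noteq> r \<and>
    (\<forall>e. e edge_of T \<longleftrightarrow> e = closed_segment p q \<or> e = closed_segment p r \<or> e = closed_segment q r)"

lemma has_verticesD:
  assumes "has_vertices T p q r"
  shows "T = convex hull {p, q, r}" "p \<noteq> q" "p \<noteq> r" "q \<noteq> r"
    "e edge_of T \<longleftrightarrow> e = closed_segment p q \<or> e = closed_segment p r \<or> e = closed_segment q r"
proof -
  note * = assms[unfolded has_vertices_def]
  show "T = convex hull {p, q, r}" by (rule *[THEN conjunct1])
  show "p \<noteq> q" "p \<noteq> r" "q \<noteq> r"
    using *[THEN conjunct2, THEN conjunct1] *[THEN conjunct2, THEN conjunct2, THEN conjunct1]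
      *[THEN conjunct2, THEN conjunct2, THEN conjunct2, THEN conjunct1] .
  show "e edge_of T \<longleftrightarrow> e = closed_segment p q \<or> e = closed_segment p r \<or> e = closed_segment q r"
    by (rule spec[OF *[THEN conjunct2, THEN conjunct2, THEN conjunct2, THEN conjunct2]])
qed

lemma has_vertices_exists:
  assumes "T \<in> \<T>"
  shows "\<exists>p q r. has_vertices T p q r"
proof -
  obtain C where C: "\<not> affine_dependent C" "int (card C) = 2 + 1" "T = convex hull C"
    using simplex[OF assms] by (auto simp: simplex_def)
  then have "card C = 3" by simp
  then obtain p q r where pqr: "C = {p, q, r}" "p \<noteq> q" "p \<noteq> r" "q \<noteq> r" unfolding card_3_iff by blast
  have fin: "finite C" using pqr by simp
  have edge: "e edge_of T \<longleftrightarrow> (\<exists>D\<subseteq>C. card D = 2 \<and> e = convex hull D)" for e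
  proof -
    have "aff_dim (convex hull D) = 1 \<longleftrightarrow> card D = 2" if "D \<subseteq> C" for D
      using aff_dim_affine_independent[OF affine_independent_subset[OF C(1) that]] 
      unfolding aff_dim_convex_hull by arith
    then show ?thesis
      unfolding edge_of_def C(3) face_of_convex_hull_affine_independent[OF C(1)] by blast
  qed
  have two: "D \<subseteq> C \<and> card D = 2 \<longleftrightarrow> D = {p, q} \<or> D = {p, r} \<or> D = {q, r}" for D
    unfolding pqr(1) using pqr(2-4) by (auto simp: card_2_iff doubleton_eq_iff)
  have "e edge_of T \<longleftrightarrow> e = closed_segment p q \<or> e = closed_segment p r \<or> e = closed_segment q r" for e
  proof -
    have "e edge_of T \<longleftrightarrow> (\<exists>D. (D \<subseteq> C \<and> card D = 2) \<and> e = convex hull D)" unfolding edge by auto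
    then show ?thesis unfolding two segment_convex_hull by auto
  qed
  then have "has_vertices T p q r" using C(3) pqr by (simp add: has_vertices_def)
  then show ?thesis by blast
qed

lemma finite_edges: "T \<in> \<T> \<Longrightarrow> finite {e. e edge_of T}"
proof -
  assume "T \<in> \<T>"
  then obtain p q r where "has_vertices T p q r" using has_vertices_exists by blast
  then have "{e. e edge_of T} \<subseteq> {closed_segment p q, closed_segment p r, closed_segment q r}"
    by (auto simp: has_verticesD(5))
  then show ?thesis by (rule finite_subset) simp
qed

lemma ex_edge: "T \<in> \<T> \<Longrightarrow> \<exists>e. e edge_of T"
  using has_vertices_exists[of T] by (auto simp: has_verticesD(5))

lemma edge_segment:
  assumes "T \<in> \<T>" "e edge_of T"
  obtains a b where "a \<noteq> b" "e = closed_segment a b"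
proof -
  obtain p q r where v: "has_vertices T p q r" using has_vertices_exists[OF assms(1)] by blast
  then have "e = closed_segment p q \<or> e = closed_segment p r \<or> e = closed_segment q r"
    using assms(2) has_verticesD(5) by blast
  moreover have "p \<noteq> q" "p \<noteq> r" "q \<noteq> r" using has_verticesD(2-4)[OF v] .
  ultimately show ?thesis using that by blast
qed

lemma ell_pos_vertex:
  assumes T: "T \<in> \<T>" and e: "e edge_of T" and hull: "T = convex hull {p, q, r}" and pq: "p \<in> e" "q \<in> e"
  shows "0 < ell T e r"
proof -
  have r: "r \<in> T" using hull by (simp add: hull_inc)
  have "r \<notin> e"
  proof
    assume "r \<in> e"
    then have "T \<subseteq> e"
      unfolding hull using pq face_of_imp_convex[OF edge_facts(1)[OF T e]] by (intro hull_minimal) auto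
    then show False using c_interior[OF T] c_in[OF T] edge_facts(3)[OF T e] by blast
  qed
  then show ?thesis using ell_nonneg[OF T e r] edge_iff_ell[OF T e r] by simp
qed

text \<open>\<open>w\<close> is the direction of the third edge, from its endpoint on
  \<open>e\<close> to its endpoint on \<open>e'\<close>: along it the function of \<open>e\<close>
  grows from 0, while that of \<open>e'\<close> falls to 0.\<close>

lemma two_edges_direction:
  assumes T: "T \<in> \<T>" and e: "e edge_of T" "e' edge_of T" "e \<noteq> e'"
  shows "\<exists>w. 0 < nrm T e \<bullet> w \<and> nrm T e' \<bullet> w < 0 \<and>
     (\<forall>e''. e'' edge_of T \<and> e'' \<noteq> e \<and> e'' \<noteq> e' \<longrightarrow> nrm T e'' \<bullet> w = 0)"
proof -
  have *: "\<exists>w. 0 < nrm T e \<bullet> w \<and> nrm T e' \<bullet> w < 0 \<and>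
     (\<forall>e''. e'' edge_of T \<and> e'' \<noteq> e \<and> e'' \<noteq> e' \<longrightarrow> nrm T e'' \<bullet> w = 0)"
    if hull: "T = convex hull {p, q, r}"
      and ed: "\<And>e''. e'' edge_of T \<Longrightarrow> e'' = e \<or> e'' = e' \<or> e'' = closed_segment q r"
      and in_e: "p \<in> e" "q \<in> e" "p \<in> e'" "r \<in> e'" for p q r
  proof (intro exI conjI allI impI)
    have d: "nrm T e'' \<bullet> (r - q) = ell T e'' r - ell T e'' q" for e''
      by (simp add: ell_def inner_diff_right)
    show "0 < nrm T e \<bullet> (r - q)"
      unfolding d using ell_pos_vertex[OF T e(1) hull in_e(1,2)] ell_edge[OF T e(1) in_e(2)] by simp
    have "T = convex hull {p, r, q}" using hull by (simp add: insert_commute)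
    then show "nrm T e' \<bullet> (r - q) < 0"
      unfolding d using ell_pos_vertex[OF T e(2) _ in_e(3,4), of q] ell_edge[OF T e(2) in_e(4)] by simp
    fix e'' assume "e'' edge_of T \<and> e'' \<noteq> e \<and> e'' \<noteq> e'"
    then have e'': "e'' edge_of T" "e'' = closed_segment q r" using ed by auto
    then have "ell T e'' r = 0" "ell T e'' q = 0" using ell_edge[OF T e''(1)] by auto
    then show "nrm T e'' \<bullet> (r - q) = 0" unfolding d by simp
  qed
  obtain p q r where v: "has_vertices T p q r" using has_vertices_exists[OF T] by blast
  note T' = has_verticesD(1)[OF v]
  have ed: "e edge_of T \<longleftrightarrow> e = closed_segment p q \<or> e = closed_segment p r \<or> e = closed_segment q r" for e
    by (rule has_verticesD(5)[OF v])
  have perm: "T = convex hull {p, r, q}" "T = convex hull {q, p, r}" "T = convex hull {q, r, p}"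
    "T = convex hull {r, p, q}" "T = convex hull {r, q, p}"
    using T' by (simp_all add: insert_commute)
  consider "e = closed_segment p q" "e' = closed_segment p r" | "e = closed_segment p q" "e' = closed_segment q r"
    | "e = closed_segment p r" "e' = closed_segment p q" | "e = closed_segment p r" "e' = closed_segment q r"
    | "e = closed_segment q r" "e' = closed_segment p q" | "e = closed_segment q r" "e' = closed_segment p r"
    using ed e by metis
  then show ?thesis
  proof cases
    case 1 then show ?thesis by (intro *[OF T']) (auto simp: ed)
  next
    case 2 then show ?thesis by (intro *[OF perm(2)]) (auto simp: ed)
  next
    case 3 then show ?thesis by (intro *[OF perm(1)]) (auto simp: ed closed_segment_commute)
  next
    case 4 then show ?thesis by (intro *[OF perm(4)]) (auto simp: ed)
  next
    case 5 then show ?thesis by (intro *[OF perm(3)]) (auto simp: ed closed_segment_commute)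
  next
    case 6 then show ?thesis by (intro *[OF perm(5)]) (auto simp: ed closed_segment_commute)
  qed
qed

section \<open>Subdivision of a triangle\<close>

definition tri :: "pt set \<Rightarrow> pt set \<Rightarrow> pt set" where
  "tri T e = convex hull (insert (c T) e)"

lemma tri_subset_T: "T \<in> \<T> \<Longrightarrow> e edge_of T \<Longrightarrow> tri T e \<subseteq> T"
  unfolding tri_def using c_in edge_facts(2) convex_T by (intro hull_minimal) auto

text \<open>Both sides are affine, so they need only be compared at \<open>c T\<close>, where both
  are 1, and on \<open>e\<close>, where the left one vanishes.\<close>

lemma tri_ell_le:
  assumes T: "T \<in> \<T>" and e: "e edge_of T" "e' edge_of T" and z: "z \<in> tri T e"
  shows "ell T e z \<le> ell T e' z"
proof -
  have "tri T e \<subseteq> {z. ell T e z \<le> ell T e' z}"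
    unfolding tri_def
  proof (rule hull_minimal)
    show "insert (c T) e \<subseteq> {z. ell T e z \<le> ell T e' z}"
      using ell_c[OF T] e ell_edge[OF T e(1)] ell_nonneg[OF T e(2)] edge_facts(2)[OF T e(1)] by auto
    show "convex {z. ell T e z \<le> ell T e' z}"
      by (rule convexI) (auto simp: ell_affine intro!: add_mono mult_left_mono)
  qed
  then show ?thesis using z by blast
qed

text \<open>The line on which the functions of \<open>e\<close> and \<open>e'\<close> agree
  separates the two pieces.\<close>

lemma tri_interior_Int:
  assumes T: "T \<in> \<T>" and e: "e edge_of T" "e' edge_of T" "e \<noteq> e'"
  shows "interior (tri T e') \<inter> tri T e = {}"
proof -
  let ?a = "nrm T e' - nrm T e" and ?b = "nrm T e' \<bullet> m e' - nrm T e \<bullet> m e"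
  have eq: "ell T e' z - ell T e z = ?a \<bullet> z - ?b" for z
    by (simp add: ell_def inner_diff_right inner_diff_left algebra_simps)
  \<comment> \<open>Equal normals would force equal functions, both being 1 at \<open>c T\<close>,
    and then equal edges.\<close>
  have "?a \<noteq> 0"
  proof
    assume a: "?a = 0"
    then have "?b = 0" using eq[of "c T"] ell_c[OF T] e by simp
    then have "ell T e' z = ell T e z" for z using eq[of z] a by simp
    then have "z \<in> e \<longleftrightarrow> z \<in> e'" if "z \<in> T" for z using edge_iff_ell[OF T] e that by simp
    then show False using e(3) edge_facts(2)[OF T] e(1,2) by blast
  qed
  have "tri T e' \<subseteq> {z. ?a \<bullet> z \<le> ?b}"
    using tri_ell_le[OF T e(2,1)] eq by (smt (verit) mem_Collect_eq subsetI)
  then have "interior (tri T e') \<subseteq> {z. ?a \<bullet> z < ?b}"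
    using interior_mono interior_halfspace_le[OF \<open>?a \<noteq> 0\<close>] by blast
  moreover have "\<not> ?a \<bullet> z < ?b" if "z \<in> tri T e" for z
    using tri_ell_le[OF T e(1,2) that] eq[of z] by simp
  ultimately show ?thesis by blast
qed

text \<open>Radial projection from the interior point \<open>c T\<close> to the boundary.\<close>

lemma T_eq_Union_tri:
  assumes T: "T \<in> \<T>" and z: "z \<in> T" shows "\<exists>e y. e edge_of T \<and> y \<in> e \<and> z \<in> closed_segment (c T) y"
proof -
  have "c T \<in> rel_interior T" using c_interior[OF T] interior_subset_rel_interior by blast
  moreover have "\<not> (c T = z \<and> T = {c T})" using aff_dim_T[OF T] aff_dim_sing[of "c T"]
    by (metis zero_neq_numeral)
  ultimately obtain y where y: "y \<in> rel_frontier T" "z \<in> closed_segment (c T) y"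
    using segment_to_rel_frontier[OF convex_T[OF T] compact_imp_bounded[OF compact_T[OF T]]] z by metis
  then obtain e where "e facet_of T" "y \<in> e"
    using rel_frontier_of_polyhedron[OF polytope_imp_polyhedron[OF polytope_T[OF T]]] by auto
  then have "e edge_of T" using aff_dim_T[OF T] by (auto simp: facet_of_def edge_of_def)
  then show ?thesis using \<open>y \<in> e\<close> y by blast
qed

lemma ps_split_iff: "K \<in> ps_split c m T \<longleftrightarrow> (\<exists>e a. e edge_of T \<and> a extreme_point_of e \<and> K = convex hull {c T, a, m e})"
  by (auto simp: ps_split_def)

lemma split_subset_tri:
  assumes "T \<in> \<T>" "e edge_of T" "a extreme_point_of e"
  shows "convex hull {c T, a, m e} \<subseteq> tri T e"
  unfolding tri_def using m_in_e[OF assms(1,2)] assms(3) by (intro hull_mono) (auto simp: extreme_point_of_def)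

lemma split_covers:
  assumes T: "T \<in> \<T>" shows "T = \<Union>(ps_split c m T)"
proof
  show "\<Union>(ps_split c m T) \<subseteq> T"
  proof (intro Union_least)
    fix K assume "K \<in> ps_split c m T"
    then obtain e a where e: "e edge_of T" "a extreme_point_of e" "K = convex hull {c T, a, m e}"
      unfolding ps_split_iff by blast
    show "K \<subseteq> T" using split_subset_tri[OF T e(1,2)] tri_subset_T[OF T e(1)] unfolding e(3) by (rule subset_trans)
  qed
  show "T \<subseteq> \<Union>(ps_split c m T)"
  proof
    fix z assume "z \<in> T"
    then obtain e y where e: "e edge_of T" "y \<in> e" "z \<in> closed_segment (c T) y" using T_eq_Union_tri[OF T] by blast
    obtain a b where ab: "a \<noteq> b" "e = closed_segment a b" using edge_segment[OF T e(1)] .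
    have "y \<in> closed_segment a (m e) \<union> closed_segment (m e) b"
      using e(2) m_in_e[OF T e(1)] ab Un_closed_segment by blast
    then obtain d where d: "d \<in> {a, b}" "y \<in> closed_segment d (m e)" by (auto simp: closed_segment_commute)
    then have "y \<in> convex hull {c T, d, m e}" using hull_mono[of "{d, m e}" "{c T, d, m e}"]
      by (auto simp: segment_convex_hull)
    then have "closed_segment (c T) y \<subseteq> convex hull {c T, d, m e}"
      by (intro closed_segment_subset convex_convex_hull) (auto simp: hull_inc)
    then have "z \<in> convex hull {c T, d, m e}" using e(3) by blast
    moreover have "d extreme_point_of e" using d ab by (auto simp: extreme_point_of_segment)
    then have "convex hull {c T, d, m e} \<in> ps_split c m T" unfolding ps_split_iff using e(1) by blast
    ultimately show "z \<in> \<Union>(ps_split c m T)" by blast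
  qed
qed

lemma finite_split: assumes "T \<in> \<T>" shows "finite (ps_split c m T)"
proof -
  have 1: "ps_split c m T \<subseteq> (\<lambda>(e, a). convex hull {c T, a, m e}) ` (SIGMA e:{e. e edge_of T}. {a. a extreme_point_of e})"
    by (auto simp: ps_split_iff image_iff)
  have "finite {a. a extreme_point_of e}" if e: "e edge_of T" for e
  proof -
    obtain a b where "a \<noteq> b" "e = closed_segment a b" using edge_segment[OF assms e] .
    then have "{a. a extreme_point_of e} = {a, b}" by (auto simp: extreme_point_of_segment)
    then show ?thesis by simp
  qed
  then have "finite (SIGMA e:{e. e edge_of T}. {a. a extreme_point_of e})"
    by (intro finite_SigmaI finite_edges[OF assms]) (simp only: mem_Collect_eq)
  then show ?thesis by (rule finite_surj) (rule 1)
qed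

lemma finite_ps_mesh: "finite (ps_mesh c m \<T>)"
  using finite_mesh finite_split by (simp add: ps_mesh_def)

lemma ps_mesh_covers: "\<Union>(ps_mesh c m \<T>) = closure \<Omega>"
proof -
  have "\<Union>(ps_split c m T) = T" if "T \<in> \<T>" for T using split_covers[OF that] by (rule sym)
  then have "\<Union>(ps_mesh c m \<T>) = \<Union>\<T>" unfolding ps_mesh_def by blast
  then show ?thesis using Union_mesh by simp
qed

lemma ps_meshE:
  assumes "K \<in> ps_mesh c m \<T>"
  obtains T e a where "T \<in> \<T>" "e edge_of T" "a extreme_point_of e" "K = convex hull {c T, a, m e}"
  using assms by (auto simp: ps_mesh_def ps_split_iff)

lemma ps_meshI: "T \<in> \<T> \<Longrightarrow> e edge_of T \<Longrightarrow> a extreme_point_of e \<Longrightarrow> convex hull {c T, a, m e} \<in> ps_mesh c m \<T>"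
  by (auto simp: ps_mesh_def ps_split_iff)

lemma interior_meets_tri:
  assumes T: "T \<in> \<T>" "e edge_of T" and K: "K \<in> ps_mesh c m \<T>" and z: "z \<in> interior K" "z \<in> tri T e"
  shows "\<exists>a. a extreme_point_of e \<and> K = convex hull {c T, a, m e}"
proof -
  obtain T' e' a where T': "T' \<in> \<T>" "e' edge_of T'" "a extreme_point_of e'" "K = convex hull {c T', a, m e'}"
    using ps_meshE[OF K] .
  have z': "z \<in> interior (tri T' e')"
    using z(1) interior_mono[OF split_subset_tri[OF T'(1-3)]] T'(4) by blast
  then have "z \<in> interior T'" using interior_mono[OF tri_subset_T[OF T'(1,2)]] by blast
  then have "T' = T" using interior_Int_empty[OF T'(1) T(1)] z(2) tri_subset_T[OF T] by blast
  moreover from this have "e' = e" using tri_interior_Int[OF T(1) T(2), of e'] T' z' z(2) by blast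
  ultimately show ?thesis using T' by blast
qed

section \<open>Affine frames at edge points\<close>

lemma edge_frame:
  assumes T: "T \<in> \<T>" and e: "e edge_of T"
  obtains a b s t Y \<beta> where "a \<noteq> b" "e = closed_segment a b" "0 < \<beta>"
    "c T = m e + s" "a = m e + t" "b = m e - \<beta> *\<^sub>R t"
    "nrm T e \<bullet> s = 1" "nrm T e \<bullet> t = 0" "Y \<bullet> s = 0" "Y \<bullet> t = 1"
proof -
  obtain a b where ab: "a \<noteq> b" "e = closed_segment a b" using edge_segment[OF T e] .
  have "m e \<in> open_segment a b" using m_rel_interior[OF T e] ab by (simp add: rel_interior_closed_segment)
  then obtain u where u: "0 < u" "u < 1" "m e = (1 - u) *\<^sub>R a + u *\<^sub>R b" by (auto simp: in_segment)
  define s where "s = c T - m e"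
  define t where "t = a - m e"
  \<comment> \<open>The ratio in which \<open>m e\<close> divides \<open>e\<close>: in units of
    \<open>t\<close>, the endpoint \<open>b\<close> lies at distance \<beta> on the other side of
    \<open>m e\<close>.\<close>
  define \<beta> where "\<beta> = (1 - u) / u"
  have t: "t = u *\<^sub>R (a - b)" by (simp add: t_def u algebra_simps)
  have "\<beta> *\<^sub>R t = (1 - u) *\<^sub>R (a - b)" using u by (simp add: t \<beta>_def)
  then have b: "b = m e - \<beta> *\<^sub>R t" by (simp add: u algebra_simps)
  have "ell T e a = 0" using ell_edge[OF T e] ab by simp
  then have Xt: "nrm T e \<bullet> t = 0" by (simp add: ell_def t_def)
  have Xs: "nrm T e \<bullet> s = 1" using ell_c[OF T e] by (simp add: ell_def s_def)
  have "t \<noteq> 0" using t u(1) ab(1) by simp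
  then obtain Y where Y: "Y \<bullet> s = 0" "Y \<bullet> t = 1" using dual_frame_exists[OF Xs Xt] by auto
  have "0 < \<beta>" "c T = m e + s" "a = m e + t" using u(1,2) by (simp_all add: \<beta>_def s_def t_def)
  then show ?thesis using that[OF ab] b Xs Xt Y by blast
qed

text \<open>Here the position of the interior points enters: \<open>m e\<close> lies between
  \<open>c T\<close> and \<open>c T'\<close>, so these are seen from \<open>m e\<close> in opposite
  directions and the cells around \<open>m e\<close> are cut out by two lines.\<close>

lemma shared_frame:
  assumes T: "T \<in> \<T>" "T' \<in> \<T>" "T \<noteq> T'" and e: "e edge_of T" "e edge_of T'"
  obtains \<alpha> where "0 < \<alpha>" "c T' = m e - \<alpha> *\<^sub>R (c T - m e)"
proof -
  have "closed_segment (c T) (c T') \<inter> rel_interior e = {m e}" using ps T e unfolding powell_sabin_def by blast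
  then have "m e \<in> closed_segment (c T) (c T')" by blast
  moreover have "m e \<notin> interior T" using m_in_e[OF T(1) e(1)] edge_facts(3)[OF T(1) e(1)] by blast
  then have "m e \<noteq> c T" using c_interior[OF T(1)] by auto
  moreover have "m e \<notin> interior T'" using m_in_e[OF T(1) e(1)] edge_facts(3)[OF T(2) e(2)] by blast
  then have "m e \<noteq> c T'" using c_interior[OF T(2)] by auto
  ultimately have "m e \<in> open_segment (c T) (c T')" by (simp add: open_segment_def)
  then obtain u where u: "0 < u" "u < 1" "m e = (1 - u) *\<^sub>R c T + u *\<^sub>R c T'" by (auto simp: in_segment)
  have "c T - m e = u *\<^sub>R (c T - c T')" by (simp add: u algebra_simps)
  then have "((1 - u) / u) *\<^sub>R (c T - m e) = (1 - u) *\<^sub>R (c T - c T')" using u by simp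
  then have "c T' = m e - ((1 - u) / u) *\<^sub>R (c T - m e)" by (simp add: u algebra_simps)
  then show ?thesis using that[of "(1 - u) / u"] u by simp
qed

end


lemma open_Diff_finite_nonempty:
  fixes U :: "pt set"
  assumes "open U" "U \<noteq> {}" "finite F" shows "U - F \<noteq> {}"
proof
  assume "U - F = {}"
  then have "U \<subseteq> F" by (simp only: Diff_eq_empty_iff)
  then have "finite U" using assms(3) by (rule finite_subset)
  then show False using finite_imp_not_open[OF _ assms(1)] assms(2) by blast
qed

lemma continuous_on_Min:
  fixes f :: "'i \<Rightarrow> 'a::topological_space \<Rightarrow> 'b::linorder_topology"
  assumes "finite I" "I \<noteq> {}" "\<And>i. i \<in> I \<Longrightarrow> continuous_on S (f i)"
  shows "continuous_on S (\<lambda>z. Min ((\<lambda>i. f i z) ` I))"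
  using assms
proof (induction I rule: finite_ne_induct)
  case (insert i I)
  then have "(\<lambda>z. Min ((\<lambda>i. f i z) ` insert i I)) = (\<lambda>z. min (f i z) (Min ((\<lambda>i. f i z) ` I)))" by auto
  then show ?case using insert by (auto intro!: continuous_on_min)
qed auto

context ps_refinement
begin

section \<open>Continuous piecewise polynomial fields and their divergences\<close>

text \<open>Continuity is demanded up to the boundary of \<Omega>, so that the restriction to a
  closed triangle is its own continuous extension.\<close>

definition fields :: "nat \<Rightarrow> (pt \<Rightarrow> pt) set" where
  "fields k = {v. (\<forall>i. continuous_on (closure \<Omega>) (\<lambda>z. v z $ i)) \<and>
     (\<forall>K\<in>ps_mesh c m \<T>. \<forall>i. \<exists>p\<in>poly2 k. \<forall>z\<in>interior K. v z $ i = p z)}"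

text \<open>Compared on open cells only, because the field need not be differentiable on the
  skeleton.\<close>

definition divs :: "nat \<Rightarrow> (pt \<Rightarrow> real) set" where
  "divs k = {f. \<exists>v\<in>fields k. \<forall>K\<in>ps_mesh c m \<T>. \<forall>z\<in>interior K. divergence v z = f z}"

lemma fields_differentiable:
  assumes "v \<in> fields k" "K \<in> ps_mesh c m \<T>" "z \<in> interior K"
  shows "(\<lambda>y. v y $ i) differentiable (at z)"
proof -
  obtain p where "p \<in> poly2 k" "\<forall>z\<in>interior K. v z $ i = p z"
    using assms(1,2) unfolding fields_def by blast
  then show ?thesis
    using partial_cong_open(1)[OF open_interior assms(3), of "\<lambda>y. v y $ i" p] poly2_differentiable by blast
qed

lemma divs_cong:
  assumes "f \<in> divs k" "\<And>K z. K \<in> ps_mesh c m \<T> \<Longrightarrow> z \<in> interior K \<Longrightarrow> f z = g z"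
  shows "g \<in> divs k"
  using assms unfolding divs_def by fastforce

lemma divs_add:
  assumes "f \<in> divs k" "g \<in> divs k" shows "(\<lambda>z. f z + g z) \<in> divs k"
proof -
  obtain v w where v: "v \<in> fields k" "\<And>K z. K \<in> ps_mesh c m \<T> \<Longrightarrow> z \<in> interior K \<Longrightarrow> divergence v z = f z"
    and w: "w \<in> fields k" "\<And>K z. K \<in> ps_mesh c m \<T> \<Longrightarrow> z \<in> interior K \<Longrightarrow> divergence w z = g z"
    using assms unfolding divs_def by blast
  have "(\<lambda>z. v z + w z) \<in> fields k"
    unfolding fields_def
  proof (intro CollectI conjI allI ballI)
    fix i show "continuous_on (closure \<Omega>) (\<lambda>z. (v z + w z) $ i)"
      using v(1) w(1) by (auto simp: fields_def intro!: continuous_on_add)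
  next
    fix K i assume K: "K \<in> ps_mesh c m \<T>"
    obtain p q where "p \<in> poly2 k" "\<forall>z\<in>interior K. v z $ i = p z" "q \<in> poly2 k" "\<forall>z\<in>interior K. w z $ i = q z"
      using v(1) w(1) K unfolding fields_def by blast
    then show "\<exists>p\<in>poly2 k. \<forall>z\<in>interior K. (v z + w z) $ i = p z"
      by (intro bexI[of _ "\<lambda>z. p z + q z"]) (auto intro: poly2_add)
  qed
  moreover have "divergence (\<lambda>z. v z + w z) z = f z + g z" if "K \<in> ps_mesh c m \<T>" "z \<in> interior K" for K z
    using partial_add[OF fields_differentiable[OF v(1) that] fields_differentiable[OF w(1) that]]
      v(2)[OF that] w(2)[OF that] by (simp add: divergence_def sum.distrib)
  ultimately show ?thesis unfolding divs_def by blast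
qed

lemma divs_cmult:
  assumes "f \<in> divs k" shows "(\<lambda>z. a * f z) \<in> divs k"
proof -
  obtain v where v: "v \<in> fields k" "\<And>K z. K \<in> ps_mesh c m \<T> \<Longrightarrow> z \<in> interior K \<Longrightarrow> divergence v z = f z"
    using assms unfolding divs_def by blast
  have "(\<lambda>z. a *\<^sub>R v z) \<in> fields k"
    unfolding fields_def
  proof (intro CollectI conjI allI ballI)
    fix i show "continuous_on (closure \<Omega>) (\<lambda>z. (a *\<^sub>R v z) $ i)"
      using v(1) by (simp add: fields_def continuous_on_mult_left)
  next
    fix K i assume K: "K \<in> ps_mesh c m \<T>"
    obtain p where "p \<in> poly2 k" "\<forall>z\<in>interior K. v z $ i = p z" using v(1) K unfolding fields_def by blast
    then show "\<exists>p\<in>poly2 k. \<forall>z\<in>interior K. (a *\<^sub>R v z) $ i = p z"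
      by (intro bexI[of _ "\<lambda>z. a * p z"]) (auto intro: poly2_cmult)
  qed
  moreover have "divergence (\<lambda>z. a *\<^sub>R v z) z = a * f z" if "K \<in> ps_mesh c m \<T>" "z \<in> interior K" for K z
    using partial_cmult[OF fields_differentiable[OF v(1) that]]
      v(2)[OF that] by (simp add: divergence_def sum_distrib_left[symmetric])
  ultimately show ?thesis unfolding divs_def by blast
qed

text \<open>For a scalar function times a constant direction \<open>w\<close> the divergence is the
  derivative along \<open>w\<close>. The fields constructed below are sums of such ones.\<close>

lemma divs_field:
  assumes f: "continuous_on (closure \<Omega>) f"
    and p: "\<And>K. K \<in> ps_mesh c m \<T> \<Longrightarrow> \<exists>p\<in>poly2 k. \<forall>z\<in>interior K. f z = p z"
    and F: "\<And>K z. K \<in> ps_mesh c m \<T> \<Longrightarrow> z \<in> interior K \<Longrightarrow> \<exists>f'. (f has_derivative f') (at z) \<and> f' w = F z"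
  shows "F \<in> divs k"
proof -
  have "(\<lambda>z. f z *\<^sub>R w) \<in> fields k"
    unfolding fields_def
  proof (intro CollectI conjI allI ballI)
    fix i show "continuous_on (closure \<Omega>) (\<lambda>z. (f z *\<^sub>R w) $ i)" using f by (auto intro!: continuous_intros)
  next
    fix K i assume "K \<in> ps_mesh c m \<T>"
    then obtain q where "q \<in> poly2 k" "\<forall>z\<in>interior K. f z = q z" using p by blast
    then show "\<exists>p\<in>poly2 k. \<forall>z\<in>interior K. (f z *\<^sub>R w) $ i = p z"
      by (intro bexI[of _ "\<lambda>z. w $ i * q z"]) (auto intro: poly2_cmult)
  qed
  moreover have "divergence (\<lambda>z. f z *\<^sub>R w) z = F z" if z: "K \<in> ps_mesh c m \<T>" "z \<in> interior K" for K z
  proof -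
    obtain f' where f': "(f has_derivative f') (at z)" "f' w = F z" using F[OF z] by blast
    then interpret linear f' using has_derivative_linear by blast
    have fd: "f differentiable (at z)" using f' unfolding differentiable_def by blast
    have "divergence (\<lambda>z. f z *\<^sub>R w) z = w $ 1 * f' (axis 1 1) + w $ 2 * f' (axis 2 1)"
      using partial_cmult[OF fd, of _ "w $ _"] has_derivative_imp_partial[OF f'(1)]
      by (simp add: divergence_def sum_2 mult.commute)
    also have "\<dots> = f' (w $ 1 *\<^sub>R axis 1 1 + w $ 2 *\<^sub>R axis 2 1)" by (simp add: add scale)
    also have "w $ 1 *\<^sub>R axis 1 1 + w $ 2 *\<^sub>R axis 2 1 = w"
      by (auto simp: vec_eq_iff forall_2 axis_def)
    finally show ?thesis using f' by simp
  qed
  ultimately show ?thesis unfolding divs_def by blast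
qed

lemma divs_0: "(\<lambda>z. 0) \<in> divs k"
  by (rule divs_field[of "\<lambda>_. 0"]) (auto intro!: exI[of _ "\<lambda>_. 0"] bexI[of _ "\<lambda>_. 0"])

lemma divs_sum:
  assumes "finite I" "\<And>i. i \<in> I \<Longrightarrow> f i \<in> divs k"
  shows "(\<lambda>z. \<Sum>i\<in>I. f i z) \<in> divs k"
  using assms
proof (induction I rule: finite_induct)
  case empty
  then show ?case using divs_0 by simp
next
  case (insert i I)
  then show ?case using divs_add[of "f i" k "\<lambda>z. \<Sum>i\<in>I. f i z"] by simp
qed

lemma divs_transfer:
  assumes "(\<lambda>z. a * f z + b * g z) \<in> divs k" "a \<noteq> 0" "f \<in> divs k" "b \<noteq> 0"
  shows "g \<in> divs k"
  using divs_cmult[OF divs_add[OF assms(1) divs_cmult[OF assms(3), of "- a"]], of "1 / b"] assms(4) by simp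

text \<open>Nothing has to be checked where \<open>T\<close> meets the frontier of \<Omega> but no
  other triangle; this freedom is what makes boundary edges useful.\<close>

lemma paste_continuous:
  assumes T: "T \<in> \<T>" and f: "continuous_on T f"
    and 0: "\<And>T' z. T' \<in> \<T> \<Longrightarrow> T' \<noteq> T \<Longrightarrow> z \<in> T \<Longrightarrow> z \<in> T' \<Longrightarrow> f z = (0::real)"
  shows "continuous_on (closure \<Omega>) (\<lambda>z. if z \<in> T then f z else 0)"
proof -
  have "continuous_on (T \<union> \<Union>(\<T> - {T})) (\<lambda>z. if z \<in> T then f z else 0)"
    using finite_mesh closed_T T f 0 by (intro continuous_on_cases closed_Union) auto
  moreover have "T \<union> \<Union>(\<T> - {T}) = closure \<Omega>" using Union_mesh T by blast
  ultimately show ?thesis by simp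
qed


subsection \<open>Bubble functions\<close>

definition ind :: "pt set \<Rightarrow> pt set \<Rightarrow> pt \<Rightarrow> real" where
  "ind T e z = (if z \<in> tri T e then 1 else 0)"

lemma edge_of_boundary_point:
  assumes T: "T \<in> \<T>" and z: "z \<in> T" "z \<notin> interior T"
  shows "\<exists>e. e edge_of T \<and> z \<in> e"
proof -
  have "rel_interior T = interior T" using interior_nonempty[OF T] rel_interior_nonempty_interior by blast
  then have "z \<in> rel_frontier T" using z closed_T[OF T] by (simp add: rel_frontier_def)
  then obtain e where "e facet_of T" "z \<in> e"
    using rel_frontier_of_polyhedron[OF polytope_imp_polyhedron[OF polytope_T[OF T]]] by auto
  then show ?thesis using aff_dim_T[OF T] by (auto simp: facet_of_def edge_of_def)
qed

lemma ind_split: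
  assumes T: "T \<in> \<T>" "e edge_of T" and T': "T' \<in> \<T>" "e' edge_of T'" "a extreme_point_of e'"
    and z: "z \<in> interior (convex hull {c T', a, m e'})"
  shows "ind T e z = (if T = T' \<and> e = e' then 1 else 0)"
proof -
  have z': "z \<in> interior (tri T' e')" using z interior_mono[OF split_subset_tri[OF T']] by blast
  have zT': "z \<in> interior T'" using z' interior_mono[OF tri_subset_T[OF T'(1,2)]] by blast
  show ?thesis
  proof (cases "T = T' \<and> e = e'")
    case True
    then show ?thesis using z' interior_subset by (auto simp: ind_def)
  next
    case False
    have "z \<notin> tri T e"
    proof (cases "T = T'")
      case True
      then show ?thesis using tri_interior_Int[OF T, of e'] False T' z' by blast
    next
      case F: False
      then show ?thesis using interior_Int_empty[OF T'(1) T(1)] tri_subset_T[OF T] zT' by blast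
    qed
    then show ?thesis using False by (simp add: ind_def)
  qed
qed

text \<open>The hat function of the interior point \<open>c T\<close>, written as a minimum so that
  its continuity needs no gluing of the three pieces.\<close>

definition bubble :: "pt set \<Rightarrow> pt \<Rightarrow> real" where
  "bubble T z = (if z \<in> T then Min ((\<lambda>e. ell T e z) ` {e. e edge_of T}) else 0)"

lemma bubble_tri:
  assumes T: "T \<in> \<T>" "e edge_of T" and z: "z \<in> tri T e"
  shows "bubble T z = ell T e z"
proof -
  have "Min ((\<lambda>e. ell T e z) ` {e. e edge_of T}) = ell T e z"
    using finite_edges[OF T(1)] T(2) tri_ell_le[OF T(1,2) _ z] by (intro Min_eqI) auto
  then show ?thesis using tri_subset_T[OF T] z by (auto simp: bubble_def)
qed

lemma bubble_outside:
  assumes T: "T \<in> \<T>" and T': "T' \<in> \<T>" "T \<noteq> T'" and z: "z \<in> interior T'"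
  shows "bubble T z = 0"
  using interior_Int_empty[OF T'(1) T] T' z by (auto simp: bubble_def)

lemma continuous_on_ell: "continuous_on S (ell T e)"
  unfolding ell_def by (intro continuous_intros)

lemma continuous_on_bubble:
  assumes T: "T \<in> \<T>" shows "continuous_on (closure \<Omega>) (bubble T)"
  unfolding bubble_def
proof (rule paste_continuous[OF T])
  show "continuous_on T (\<lambda>z. Min ((\<lambda>e. ell T e z) ` {e. e edge_of T}))"
    using finite_edges[OF T] ex_edge[OF T] continuous_on_ell by (intro continuous_on_Min) auto
  fix T' z assume *: "T' \<in> \<T>" "T' \<noteq> T" "z \<in> T" "z \<in> T'"
  then have "z \<notin> interior T" using interior_Int_empty[OF T *(1)] by blast
  then obtain e where e: "e edge_of T" "z \<in> e" using edge_of_boundary_point[OF T *(3)] by blast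
  show "Min ((\<lambda>e. ell T e z) ` {e. e edge_of T}) = 0"
    using finite_edges[OF T] e ell_edge[OF T e] ell_nonneg[OF T _ *(3)]
    by (intro Min_eqI) (auto intro!: image_eqI[of _ _ e])
qed

lemma has_derivative_ell: "(ell T e has_derivative (\<lambda>h. nrm T e \<bullet> h)) F"
  unfolding ell_def by (auto intro!: derivative_eq_intros)

text \<open>The hat function at \<open>c T\<close> is taken in a direction parallel to the third
  edge: the divergence vanishes on the third piece and is a nonzero constant on each of the other
  two.\<close>

lemma divs_ind_other_edge:
  assumes T: "T \<in> \<T>" and e: "e edge_of T" "e' edge_of T" and k: "1 \<le> k"
    and ind: "ind T e \<in> divs k"
  shows "ind T e' \<in> divs k"
proof (cases "e = e'")
  case ne: False
  obtain w where w: "0 < nrm T e \<bullet> w" "nrm T e' \<bullet> w < 0"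
    "\<And>e''. e'' edge_of T \<Longrightarrow> e'' \<noteq> e \<Longrightarrow> e'' \<noteq> e' \<Longrightarrow> nrm T e'' \<bullet> w = 0"
    using two_edges_direction[OF T e ne] by blast
  have "(\<lambda>z. (nrm T e \<bullet> w) * ind T e z + (nrm T e' \<bullet> w) * ind T e' z) \<in> divs k"
  proof (rule divs_field[OF continuous_on_bubble[OF T]])
    fix K assume "K \<in> ps_mesh c m \<T>"
    then obtain T0 e0 a where K: "T0 \<in> \<T>" "e0 edge_of T0" "a extreme_point_of e0" "K = convex hull {c T0, a, m e0}"
      by (rule ps_meshE)
    define q where "q = (if T0 = T then ell T e0 else (\<lambda>_. 0))"
    have q: "bubble T z = q z" if "z \<in> interior K" for z
    proof (cases "T0 = T")
      case True
      then show ?thesis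
        using bubble_tri[OF K(1,2)] split_subset_tri[OF K(1-3)] K(4) interior_subset that by (auto simp: q_def)
    next
      case False
      have "z \<in> interior T0" using that K(4) interior_mono[OF split_subset_tri[OF K(1-3)]]
          interior_mono[OF tri_subset_T[OF K(1,2)]] by blast
      then show ?thesis using bubble_outside[OF T K(1)] False by (simp add: q_def)
    qed
    have "q \<in> poly2 1" unfolding q_def ell_def[abs_def] using poly2_inner by auto
    then show "\<exists>p\<in>poly2 k. \<forall>z\<in>interior K. bubble T z = p z" using q poly2_mono[OF _ k] by blast
    fix z assume z: "z \<in> interior K"
    let ?D = "if T0 = T then \<lambda>h. nrm T e0 \<bullet> h else (\<lambda>h. 0)"
    have "(q has_derivative ?D) (at z)" unfolding q_def using has_derivative_ell by auto
    then have "(bubble T has_derivative ?D) (at z)"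
      by (rule has_derivative_transform_within_open[OF _ open_interior z]) (simp add: q)
    moreover have "?D w = (nrm T e \<bullet> w) * ind T e z + (nrm T e' \<bullet> w) * ind T e' z"
      using ind_split[OF T e(1) K(1-3), of z] ind_split[OF T e(2) K(1-3), of z] z K(4) w(3)[of e0] K(2) ne by auto
    ultimately show "\<exists>f'. (bubble T has_derivative f') (at z) \<and>
        f' w = (nrm T e \<bullet> w) * ind T e z + (nrm T e' \<bullet> w) * ind T e' z" by blast
  qed
  then show ?thesis by (rule divs_transfer) (use w ind in auto)
qed (use ind in simp)

end


subsection \<open>Fields around an edge point\<close>

text \<open>\<open>G\<close> is \<open>{g1, g2}\<close> at an interior edge; at a boundary edge it is \<open>{g1}\<close>, the quadrants of \<open>g2\<close> being
  virtual.\<close>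

locale edge_cross = ps_refinement +
  fixes p X Y s t :: pt and g1 g2 h1 h2 :: real and k :: nat and G :: "real set"
  assumes k: "1 \<le> k" and signs: "g1 > 0" "g2 < 0" "h1 > 0" "h2 < 0"
    and frame: "X \<bullet> s = 1" "X \<bullet> t = 0" "Y \<bullet> s = 0" "Y \<bullet> t = 1" and G: "G \<subseteq> {g1, g2}"
    and cell: "\<And>K. K \<in> ps_mesh c m \<T> \<Longrightarrow> (\<exists>g\<in>G. \<exists>h\<in>{h1, h2}. interior K = quad X Y p g h) \<or>
        interior K \<inter> (\<Union>g\<in>G. \<Union>h\<in>{h1, h2}. ctri X Y p g h) = {}"
    and cut: "\<And>f :: pt \<Rightarrow> real. continuous_on UNIV f \<Longrightarrow> (\<And>z. hat X Y p g1 g2 h1 h2 z \<le> 0 \<Longrightarrow> f z = 0) \<Longrightarrow>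
        continuous_on (closure \<Omega>) (\<lambda>z. if z \<in> (\<Union>g\<in>G. \<Union>h\<in>{h1, h2}. ctri X Y p g h) then f z else 0)"
begin

abbreviation D where "D \<equiv> \<Union>g\<in>G. \<Union>h\<in>{h1, h2}. ctri X Y p g h"

text \<open>Turns a family indexed by quadrants into one function; as the sum runs over
  \<open>G\<close>, components on virtual quadrants are dropped.\<close>

definition pw :: "(real \<Rightarrow> real \<Rightarrow> pt \<Rightarrow> real) \<Rightarrow> pt \<Rightarrow> real" where
  "pw F z = (\<Sum>g\<in>G. \<Sum>h\<in>{h1, h2}. if z \<in> quad X Y p g h then F g h z else 0)"

lemma pw_quad:
  assumes "g \<in> G" "h \<in> {h1, h2}" "z \<in> quad X Y p g h" shows "pw F z = F g h z"
proof -
  have uniq: "g' = g \<and> h' = h" if "g' \<in> G" "h' \<in> {h1, h2}" "z \<in> quad X Y p g' h'" for g' h'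
    by (rule quad_unique[OF signs _ assms(2) _ that(2) assms(3) that(3)]) (use G assms(1) that(1) in blast)+
  have "(if z \<in> quad X Y p g' h' then F g' h' z else 0) = (if g' = g then if h' = h then F g h z else 0 else 0)"
    if gh: "g' \<in> G" "h' \<in> {h1, h2}" for g' h'
  proof (cases "z \<in> quad X Y p g' h'")
    case True
    then show ?thesis using uniq[OF gh True] by simp
  next
    case False
    then have "\<not> (g' = g \<and> h' = h)" using assms(3) by blast
    then show ?thesis using False by simp
  qed
  then have "pw F z = (\<Sum>g'\<in>G. \<Sum>h'\<in>{h1, h2}. if g' = g then if h' = h then F g h z else 0 else 0)"
    unfolding pw_def by (intro sum.cong) auto
  also have "\<dots> = (\<Sum>g'\<in>G. if g' = g then \<Sum>h'\<in>{h1, h2}. if h' = h then F g h z else 0 else 0)"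
    by (intro sum.cong) auto
  also have "\<dots> = F g h z" using assms finite_subset[OF G] by (simp only: sum.delta finite.intros) simp
  finally show ?thesis .
qed

lemma quad_subset_D: "g \<in> G \<Longrightarrow> h \<in> {h1, h2} \<Longrightarrow> quad X Y p g h \<subseteq> D"
  by (auto simp: quad_def ctri_def)

lemma pw_outside: "z \<notin> D \<Longrightarrow> pw F z = 0"
  unfolding pw_def using quad_subset_D by (intro sum.neutral ballI) (meson subsetD)

text \<open>The field is cut off to the union \<open>D\<close> of the actual cells;
  \<open>cut\<close> keeps it continuous, and by \<open>cell\<close> each open cell of the mesh is
  either one of the quadrants or disjoint from \<open>D\<close>.\<close>

lemma pw_divs:
  assumes f: "continuous_on UNIV f" and 0: "\<And>z. hat X Y p g1 g2 h1 h2 z \<le> 0 \<Longrightarrow> f z = 0"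
    and q: "\<And>g h. g \<in> {g1, g2} \<Longrightarrow> h \<in> {h1, h2} \<Longrightarrow> \<exists>q\<in>poly2 k. \<forall>z\<in>quad X Y p g h. f z = q z"
    and F: "\<And>g h z. g \<in> {g1, g2} \<Longrightarrow> h \<in> {h1, h2} \<Longrightarrow> z \<in> quad X Y p g h \<Longrightarrow>
           \<exists>f'. (f has_derivative f') (at z) \<and> f' w = F g h z"
  shows "pw F \<in> divs k"
proof (rule divs_field[OF cut[OF f 0]])
  let ?f = "\<lambda>z. if z \<in> D then f z else 0"
  fix K assume "K \<in> ps_mesh c m \<T>"
  from cell[OF this]
  have "(\<exists>q\<in>poly2 k. \<forall>z\<in>interior K. ?f z = q z) \<and> (\<forall>z\<in>interior K. \<exists>f'. (?f has_derivative f') (at z) \<and> f' w = pw F z)"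
  proof
    assume "\<exists>g\<in>G. \<exists>h\<in>{h1, h2}. interior K = quad X Y p g h"
    then obtain g h where gh: "g \<in> G" "h \<in> {h1, h2}" "interior K = quad X Y p g h" by blast
    have g: "g \<in> {g1, g2}" using gh G by blast
    have eq: "?f z = f z" if "z \<in> interior K" for z using quad_subset_D[OF gh(1,2)] gh(3) that by auto
    show ?thesis
    proof (intro conjI ballI)
      show "\<exists>q\<in>poly2 k. \<forall>z\<in>interior K. ?f z = q z" using q[OF g gh(2)] eq gh(3) by simp
      fix z assume z: "z \<in> interior K"
      obtain f' where f': "(f has_derivative f') (at z)" "f' w = F g h z" using F[OF g gh(2)] z gh(3) by blast
      have "(?f has_derivative f') (at z)"
        by (rule has_derivative_transform_within_open[OF f'(1) open_interior z]) (rule eq[symmetric])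
      then show "\<exists>f'. (?f has_derivative f') (at z) \<and> f' w = pw F z"
        using f'(2) pw_quad[OF gh(1,2)] z gh(3) by auto
    qed
  next
    assume dis: "interior K \<inter> D = {}"
    have eq: "?f z = 0" if "z \<in> interior K" for z using dis that by auto
    show ?thesis
    proof (intro conjI ballI)
      show "\<exists>q\<in>poly2 k. \<forall>z\<in>interior K. ?f z = q z" using eq by (intro bexI[of _ "\<lambda>_. 0"]) auto
      fix z assume z: "z \<in> interior K"
      have "(?f has_derivative (\<lambda>_. 0)) (at z)"
        by (rule has_derivative_transform_within_open[OF has_derivative_const open_interior z]) (rule eq[symmetric])
      moreover have "pw F z = 0" using pw_outside dis z by blast
      ultimately show "\<exists>f'. (?f has_derivative f') (at z) \<and> f' w = pw F z" by auto
    qed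
  qed
  then show "\<exists>p\<in>poly2 k. \<forall>z\<in>interior K. ?f z = p z"
    "\<And>z. z \<in> interior K \<Longrightarrow> \<exists>f'. (?f has_derivative f') (at z) \<and> f' w = pw F z" by blast+
qed

lemma pw_add: "pw (\<lambda>g h z. F1 g h z + F2 g h z) z = pw F1 z + pw F2 z"
  unfolding pw_def sum.distrib[symmetric] by (intro sum.cong) auto

lemma pw_cmult: "pw (\<lambda>g h z. a * F g h z) z = a * pw F z"
  unfolding pw_def sum_distrib_left by (intro sum.cong) auto

lemma pw_cong:
  assumes "\<And>g h z. g \<in> {g1, g2} \<Longrightarrow> h \<in> {h1, h2} \<Longrightarrow> z \<in> quad X Y p g h \<Longrightarrow> F1 g h z = F2 g h z"
  shows "pw F1 = pw F2"
  unfolding pw_def using G by (intro ext sum.cong refl) (auto intro!: assms)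

text \<open>That the constant 1 is attained stays a hypothesis: it comes from the indicators, for
  which a global argument over the mesh is needed first.\<close>

lemma cross:
  assumes one: "pw (\<lambda>g h z. 1) \<in> divs k"
  shows "cross X Y p s t g1 g2 h1 h2 k {F. pw F \<in> divs k}"
proof
  show "z = (X \<bullet> z) *\<^sub>R s + (Y \<bullet> z) *\<^sub>R t" for z using frame_coords[OF frame] .
  show "(\<lambda>g h z. F g h z + F' g h z) \<in> {F. pw F \<in> divs k}"
    if "F \<in> {F. pw F \<in> divs k}" "F' \<in> {F. pw F \<in> divs k}" for F F'
    using divs_add[of "pw F" k "pw F'"] that by (simp add: pw_add[abs_def] ext)
  show "(\<lambda>g h z. a * F g h z) \<in> {F. pw F \<in> divs k}" if "F \<in> {F. pw F \<in> divs k}" for F a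
    using divs_cmult[of "pw F" k a] that by (simp add: pw_cmult[abs_def])
  show "F' \<in> {F. pw F \<in> divs k}" if "F \<in> {F. pw F \<in> divs k}"
    "\<And>g h z. g \<in> {g1, g2} \<Longrightarrow> h \<in> {h1, h2} \<Longrightarrow> z \<in> quad X Y p g h \<Longrightarrow> F g h z = F' g h z" for F F'
    using pw_cong[of F F'] that by simp
  fix f :: "pt \<Rightarrow> real" and w F
  assume "continuous_on UNIV f" "\<And>z. hat X Y p g1 g2 h1 h2 z \<le> 0 \<Longrightarrow> f z = 0"
    "\<And>g h. g \<in> {g1, g2} \<Longrightarrow> h \<in> {h1, h2} \<Longrightarrow> \<exists>q\<in>poly2 k. \<forall>z\<in>quad X Y p g h. f z = q z"
    "\<And>g h z. g \<in> {g1, g2} \<Longrightarrow> h \<in> {h1, h2} \<Longrightarrow> z \<in> quad X Y p g h \<Longrightarrow>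
           \<exists>f'. (f has_derivative f') (at z) \<and> f' w = F g h z"
  from pw_divs[OF this] show "F \<in> {F. pw F \<in> divs k}" by simp
qed (use signs frame one in auto)

text \<open>The hat function has slope \<open>- g\<close> in the direction \<open>s\<close>,
  transversal to the edge. This relation carries indicators across edges.\<close>

lemma pw_hat: "pw (\<lambda>g h z. - g) \<in> divs k"
proof (rule pw_divs[of "\<lambda>z. max 0 (hat X Y p g1 g2 h1 h2 z)" s])
  show "continuous_on UNIV (\<lambda>z. max 0 (hat X Y p g1 g2 h1 h2 z))" by (intro continuous_intros continuous_on_hat)
  fix g h assume gh: "g \<in> {g1, g2}" "h \<in> {h1, h2}"
  have f: "max 0 (hat X Y p g1 g2 h1 h2 z) = 1 - g * (X \<bullet> (z - p)) - h * (Y \<bullet> (z - p))" if "z \<in> quad X Y p g h" for z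
    using hat_quad[OF signs gh that] that by (simp add: quad_def)
  have "(\<lambda>z. 1 - g * (X \<bullet> (z - p)) - h * (Y \<bullet> (z - p))) \<in> poly2 1"
    by (intro poly2_diff poly2_cmult poly2_inner poly2_const)
  then have "(\<lambda>z. 1 - g * (X \<bullet> (z - p)) - h * (Y \<bullet> (z - p))) \<in> poly2 k" by (rule poly2_mono[OF _ k])
  then show "\<exists>q\<in>poly2 k. \<forall>z\<in>quad X Y p g h. max 0 (hat X Y p g1 g2 h1 h2 z) = q z"
    by (rule rev_bexI) (rule ballI, rule f)
  fix z assume z: "z \<in> quad X Y p g h"
  have "((\<lambda>z. 1 - g * (X \<bullet> (z - p)) - h * (Y \<bullet> (z - p))) has_derivative (\<lambda>v. - g * (X \<bullet> v) - h * (Y \<bullet> v))) (at z)"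
    by (rule has_derivative_eq_rhs, (rule derivative_eq_intros refl)+) (auto simp: algebra_simps)
  then have "((\<lambda>z. max 0 (hat X Y p g1 g2 h1 h2 z)) has_derivative (\<lambda>v. - g * (X \<bullet> v) - h * (Y \<bullet> v))) (at z)"
    by (rule has_derivative_transform_within_open[OF _ open_quad z]) (simp add: f)
  then show "\<exists>f'. ((\<lambda>z. max 0 (hat X Y p g1 g2 h1 h2 z)) has_derivative f') (at z) \<and> f' s = - g"
    using frame by (intro exI[of _ "\<lambda>v. - g * (X \<bullet> v) - h * (Y \<bullet> v)"]) simp
qed auto

end


section \<open>Interior and boundary edges\<close>

locale framed_edge = ps_refinement +
  fixes T e :: "pt set" and a b s t Y :: pt and \<beta> :: real and k :: nat
  assumes k: "1 \<le> k" and T: "T \<in> \<T>" and e: "e edge_of T"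
    and ab: "a \<noteq> b" "e = closed_segment a b" "0 < \<beta>"
    "c T = m e + s" "a = m e + t" "b = m e - \<beta> *\<^sub>R t"
    and frame: "nrm T e \<bullet> s = 1" "nrm T e \<bullet> t = 0" "Y \<bullet> s = 0" "Y \<bullet> t = 1"
begin

abbreviation X where "X \<equiv> nrm T e"
text \<open>The endpoint \<open>b\<close> is \<open>m e\<close> plus \<open>t\<close> divided by
  this factor.\<close>

abbreviation h2 where "h2 \<equiv> - 1 / \<beta>"
abbreviation C where "C g h \<equiv> ctri X Y (m e) g h"
abbreviation Q where "Q g h \<equiv> quad X Y (m e) g h"

lemma coords: "z = (X \<bullet> z) *\<^sub>R s + (Y \<bullet> z) *\<^sub>R t"
  using frame_coords[OF frame] .

lemma extreme_e: "d extreme_point_of e \<longleftrightarrow> d = a \<or> d = b"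
  unfolding ab(2) by (rule extreme_point_of_segment)

lemma a_minus_m: "a - m e = t" and b_minus_m: "b - m e = - \<beta> *\<^sub>R t"
proof -
  show "a - m e = t" by (subst ab(5)) simp
  show "b - m e = - \<beta> *\<^sub>R t" by (subst ab(6)) simp
qed

lemma rel_interior_e: "rel_interior e = open_segment a b"
  using ab(1) unfolding ab(2) by (simp add: rel_interior_closed_segment)

lemma cells:
  "convex hull {c T, a, m e} = C 1 1" "convex hull {c T, b, m e} = C 1 h2"
  "0 < \<alpha> \<Longrightarrow> convex hull {m e - \<alpha> *\<^sub>R s, a, m e} = C (- 1 / \<alpha>) 1"
  "0 < \<alpha> \<Longrightarrow> convex hull {m e - \<alpha> *\<^sub>R s, b, m e} = C (- 1 / \<alpha>) h2"
proof -
  have a: "m e + (1 / 1) *\<^sub>R t = a" and b: "m e + (1 / h2) *\<^sub>R t = b" and c: "m e + (1 / 1) *\<^sub>R s = c T"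
    using ab(3) a_minus_m b_minus_m ab(4)[symmetric] by (simp_all add: algebra_simps)
  have c': "0 < \<alpha> \<Longrightarrow> m e + (1 / (- 1 / \<alpha>)) *\<^sub>R s = m e - \<alpha> *\<^sub>R s" by simp
  have h2: "h2 \<noteq> 0" using ab(3) by simp
  show "convex hull {c T, a, m e} = C 1 1" "convex hull {c T, b, m e} = C 1 h2"
    using convex_hull_eq_ctri[OF frame, of 1 1 "m e"] convex_hull_eq_ctri[OF frame _ h2, of 1 "m e"]
    unfolding a b c by simp_all
  show "convex hull {m e - \<alpha> *\<^sub>R s, a, m e} = C (- 1 / \<alpha>) 1"
    "convex hull {m e - \<alpha> *\<^sub>R s, b, m e} = C (- 1 / \<alpha>) h2" if "0 < \<alpha>"
    using convex_hull_eq_ctri[OF frame, of "- 1 / \<alpha>" 1 "m e"] convex_hull_eq_ctri[OF frame _ h2, of "- 1 / \<alpha>" "m e"] that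
    unfolding c'[OF that] a b by simp_all
qed

lemma XY_nonzero: "X \<noteq> 0" "Y \<noteq> 0" "g \<noteq> 0 \<Longrightarrow> g *\<^sub>R X + h *\<^sub>R Y \<noteq> 0"
proof -
  show "X \<noteq> 0" "Y \<noteq> 0" using frame by auto
  have "(g *\<^sub>R X + h *\<^sub>R Y) \<bullet> s = g" using frame by (simp add: inner_add_left)
  then show "g \<noteq> 0 \<Longrightarrow> g *\<^sub>R X + h *\<^sub>R Y \<noteq> 0" by auto
qed

lemma interior_C: "g \<noteq> 0 \<Longrightarrow> h \<noteq> 0 \<Longrightarrow> interior (C g h) = Q g h"
  using XY_nonzero by (intro interior_ctri) auto

lemma Q_nonempty: assumes "g \<noteq> 0" "h \<noteq> 0" shows "Q g h \<noteq> {}"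
proof -
  have "m e + (1 / (3 * g)) *\<^sub>R s + (1 / (3 * h)) *\<^sub>R t \<in> Q g h"
    using frame assms by (simp add: quad_def inner_add_right)
  then show ?thesis by blast
qed

lemma closure_Q:
  assumes "g \<noteq> 0" "h \<noteq> 0" shows "closure (Q g h) = C g h"
proof -
  have C: "C g h = convex hull {m e + (1 / g) *\<^sub>R s, m e + (1 / h) *\<^sub>R t, m e}"
    using convex_hull_eq_ctri[OF frame assms] by simp
  have "closed (C g h)" "convex (C g h)" unfolding C
    by (simp_all add: compact_imp_closed finite_imp_compact_convex_hull)
  then show ?thesis
    using convex_closure_interior[of "C g h"] Q_nonempty[OF assms] interior_C[OF assms] by simp
qed

lemma C_subset_tri: "h \<in> {1, h2} \<Longrightarrow> C 1 h \<subseteq> tri T e"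
  using split_subset_tri[OF T e, of a] split_subset_tri[OF T e, of b] cells(1,2) extreme_e by auto

lemma hat_m: "hat X Y (m e) 1 g2 1 h2 (m e) = 1" by (simp add: hat_def)

text \<open>At both endpoints of \<open>e\<close> the hat function is zero.\<close>

lemma hat_rel_interior:
  assumes z: "z \<in> e" and hat: "0 < hat X Y (m e) 1 g2 1 h2 z" shows "z \<in> rel_interior e"
proof -
  have "hat X Y (m e) 1 g2 1 h2 a = 0"
  proof -
    have "h2 < 0" using ab(3) by simp
    then have "max 1 h2 = 1" by linarith
    then show ?thesis using frame by (simp only: hat_def a_minus_m mult_zero_right mult_1_right max.idem)
  qed
  moreover have "hat X Y (m e) 1 g2 1 h2 b = 0" using ab(3) frame by (simp add: hat_def b_minus_m max_def)
  ultimately have "z \<noteq> a" "z \<noteq> b" using hat by auto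
  moreover have "z \<in> closed_segment a b" using z ab(2) by blast
  ultimately show ?thesis unfolding rel_interior_e by (simp add: open_segment_def)
qed

lemma rel_interior_hat:
  assumes z: "z \<in> rel_interior e" shows "0 < hat X Y (m e) 1 g2 1 h2 z"
proof -
  have "z \<in> open_segment a b" using z unfolding rel_interior_e .
  then obtain u where u: "0 < u" "u < 1" "z = (1 - u) *\<^sub>R a + u *\<^sub>R b" by (auto simp: in_segment)
  have "z - m e = (1 - u) *\<^sub>R (a - m e) + u *\<^sub>R (b - m e)" unfolding u(3) by (simp add: algebra_simps)
  also have "\<dots> = (1 - u - u * \<beta>) *\<^sub>R t" unfolding a_minus_m b_minus_m by (simp add: algebra_simps)
  finally have "z - m e = (1 - u - u * \<beta>) *\<^sub>R t" .
  then have xy: "X \<bullet> (z - m e) = 0" "Y \<bullet> (z - m e) = 1 - u - u * \<beta>" using frame by simp_all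
  have "0 < u * \<beta>" using u ab(3) by simp
  then have "1 - u - u * \<beta> < 1" using u by linarith
  moreover have "h2 * (1 - u - u * \<beta>) < 1"
  proof -
    have "u * \<beta> < \<beta>" using u ab(3) by simp
    then have "u + u * \<beta> - 1 < \<beta>" using u(2) by linarith
    then have "(u + u * \<beta> - 1) / \<beta> < 1" using ab(3) by (simp only: divide_less_eq_1_pos)
    moreover have "h2 * (1 - u - u * \<beta>) = (u + u * \<beta> - 1) / \<beta>" by (simp add: diff_divide_distrib add_divide_distrib algebra_simps)
    ultimately show ?thesis by simp
  qed
  ultimately show ?thesis by (simp add: hat_def xy)
qed

lemma open_hat: "open {z. 0 < hat X Y (m e) g1 g2 h h' z}"
  by (intro open_Collect_less continuous_on_hat continuous_intros)

end

locale boundary_edge = framed_edge +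
  assumes unshared: "\<And>T'. T' \<in> \<T> \<Longrightarrow> T' \<noteq> T \<Longrightarrow> \<not> e edge_of T'"
begin

text \<open>The factor \<open>- 1\<close> of the virtual side is an arbitrary negative number.
  Cutting off at the two cells has the same effect as cutting off at \<open>T\<close>, and a point
  of \<open>T\<close> with positive hat value is in no other triangle: it is in the relative
  interior of the unshared edge or interior to \<open>T\<close>.\<close>

lemma edge_cross: "edge_cross \<Omega> \<T> c m (m e) X Y s t 1 (- 1) 1 h2 k {1}"
proof
  fix K assume K: "K \<in> ps_mesh c m \<T>"
  show "(\<exists>g\<in>{1}. \<exists>h\<in>{1, h2}. interior K = Q g h) \<or> interior K \<inter> (\<Union>g\<in>{1}. \<Union>h\<in>{1, h2}. C g h) = {}"
  proof (cases "interior K \<inter> (\<Union>g\<in>{1}. \<Union>h\<in>{1, h2}. C g h) = {}")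
    case False
    then obtain h z where "h \<in> {1, h2}" "z \<in> interior K" "z \<in> C 1 h" by auto
    then obtain d where "d extreme_point_of e" "K = convex hull {c T, d, m e}"
      using interior_meets_tri[OF T e K] C_subset_tri by blast
    then have "K = C 1 1 \<or> K = C 1 h2" using extreme_e cells by auto
    then show ?thesis using interior_C[of 1 1] interior_C[of 1 h2] ab(3) by auto
  qed simp
next
  fix f :: "pt \<Rightarrow> real"
  assume f: "continuous_on UNIV f" "\<And>z. hat X Y (m e) 1 (- 1) 1 h2 z \<le> 0 \<Longrightarrow> f z = 0"
  let ?D = "\<Union>g\<in>{1}. \<Union>h\<in>{1, h2}. C g h"
  have D: "z \<in> ?D" if "0 < hat X Y (m e) 1 (- 1) 1 h2 z" "0 \<le> X \<bullet> (z - m e)" for z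
    using hat_ctri[of 1 "-1" 1 h2 X Y "m e" z 1] that ab(3) by auto
  have DT: "?D \<subseteq> T" using C_subset_tri tri_subset_T[OF T e] by blast
  have eq: "(\<lambda>z. if z \<in> ?D then f z else 0) = (\<lambda>z. if z \<in> T then f z else 0)"
  proof
    fix z show "(if z \<in> ?D then f z else 0) = (if z \<in> T then f z else 0)"
    proof (cases "z \<in> T \<and> z \<notin> ?D")
      case True
      then have "f z = 0" using D[of z] f(2)[of z] ell_nonneg[OF T e, of z] unfolding ell_def by fastforce
      then show ?thesis by simp
    qed (use DT in auto)
  qed
  show "continuous_on (closure \<Omega>) (\<lambda>z. if z \<in> ?D then f z else 0)"
    unfolding eq
  proof (rule paste_continuous[OF T])
    show "continuous_on T f" using f(1) continuous_on_subset by blast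
    fix T' z assume T': "T' \<in> \<T>" "T' \<noteq> T" and z: "z \<in> T" "z \<in> T'"
    show "f z = 0"
    proof (rule ccontr)
      assume "f z \<noteq> 0"
      then have hat: "0 < hat X Y (m e) 1 (- 1) 1 h2 z" using f(2)[of z] by fastforce
      show False
      proof (cases "ell T e z = 0")
        case True
        then have "z \<in> rel_interior e" using edge_iff_ell[OF T e z(1)] hat_rel_interior[OF _ hat] by simp
        then show False using edge_shared(1)[OF T T' e _ z(2)] unshared[OF T'] by blast
      next
        case False
        then have "0 < ell T e z" using ell_nonneg[OF T e z(1)] by simp
        then have "z \<in> {z. 0 < hat X Y (m e) 1 (- 1) 1 h2 z} \<inter> {z. 0 < ell T e z}" using hat by simp
        moreover have "open ({z. 0 < hat X Y (m e) 1 (- 1) 1 h2 z} \<inter> {z. 0 < ell T e z})"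
          by (intro open_Int open_hat open_Collect_less continuous_on_ell continuous_intros)
        moreover have "{z. 0 < hat X Y (m e) 1 (- 1) 1 h2 z} \<inter> {z. 0 < ell T e z} \<subseteq> T"
          using D DT by (force simp: ell_def)
        ultimately have "z \<in> interior T" by (meson interiorI)
        then show False using interior_Int_empty[OF T T'(1)] T'(2) z(2) by blast
      qed
    qed
  qed
qed (use k frame ab(3) in auto)

end

sublocale boundary_edge \<subseteq> E: edge_cross \<Omega> \<T> c m "m e" X Y s t 1 "- 1" 1 h2 k "{1}"
  by (rule edge_cross)

context boundary_edge
begin

lemma cell_cases:
  assumes K: "K \<in> ps_mesh c m \<T>" "z \<in> interior K"
  shows "(\<exists>h\<in>{1, h2}. z \<in> Q 1 h \<and> ind T e z = 1) \<or> (z \<notin> E.D \<and> ind T e z = 0)"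
proof (cases "z \<in> tri T e")
  case True
  then obtain d where d: "d extreme_point_of e" "K = convex hull {c T, d, m e}"
    using interior_meets_tri[OF T e K(1,2)] by blast
  then have "K = C 1 1 \<or> K = C 1 h2" using extreme_e cells by auto
  then have "z \<in> Q 1 1 \<or> z \<in> Q 1 h2" using K(2) interior_C[of 1 1] interior_C[of 1 h2] ab(3) by auto
  then show ?thesis using True by (auto simp: ind_def)
next
  case False
  then have "z \<notin> E.D" using C_subset_tri by auto
  then show ?thesis using False by (simp add: ind_def)
qed

lemma pw_ind:
  assumes "K \<in> ps_mesh c m \<T>" "z \<in> interior K" "\<And>h. h \<in> {1, h2} \<Longrightarrow> z \<in> Q 1 h \<Longrightarrow> F 1 h z = v"
  shows "E.pw F z = v * ind T e z"
  using cell_cases[OF assms(1,2)]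
proof
  assume "\<exists>h\<in>{1, h2}. z \<in> Q 1 h \<and> ind T e z = 1"
  then show ?thesis using E.pw_quad[of 1 _ z F] assms(3) by fastforce
next
  assume *: "z \<notin> E.D \<and> ind T e z = 0"
  show ?thesis unfolding E.pw_outside[OF conjunct1[OF *]] conjunct2[OF *] by simp
qed

text \<open>The field need not vanish on the boundary edge, so the transversal hat field yields a
  multiple of this one indicator alone.\<close>

lemma ind_divs: "ind T e \<in> divs k"
proof -
  have "(\<lambda>z. - 1 * E.pw (\<lambda>g h z. - g) z) \<in> divs k" by (rule divs_cmult[OF E.pw_hat])
  then show ?thesis
    by (rule divs_cong) (use pw_ind[of _ _ "\<lambda>g h z. - g" "- 1"] in auto)
qed

lemma edge_part_divs:
  assumes ind: "ind T e \<in> divs k"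
    and q: "\<And>K. K \<in> ps_mesh c m \<T> \<Longrightarrow> \<exists>q\<in>poly2 (k - 1). \<forall>z\<in>interior K. p z = q z"
  shows "(\<lambda>z. p z * ind T e z) \<in> divs k"
proof -
  have K: "C 1 1 \<in> ps_mesh c m \<T>" "C 1 h2 \<in> ps_mesh c m \<T>"
    using ps_meshI[OF T e] cells(1,2) extreme_e by metis+
  have int: "interior (C 1 1) = Q 1 1" "interior (C 1 h2) = Q 1 h2" using interior_C ab(3) by auto
  obtain q1 q2 where q1: "q1 \<in> poly2 (k - 1)" "\<And>z. z \<in> Q 1 1 \<Longrightarrow> p z = q1 z"
    and q2: "q2 \<in> poly2 (k - 1)" "\<And>z. z \<in> Q 1 h2 \<Longrightarrow> p z = q2 z"
    using q[OF K(1)] q[OF K(2)] unfolding int by blast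
  have one: "E.pw (\<lambda>g h z. 1) \<in> divs k"
    by (rule divs_cong[OF ind]) (use pw_ind[of _ _ "\<lambda>g h z. 1" 1] in auto)
  have h2: "h2 \<noteq> 1" using ab(3) by (smt (verit) divide_neg_pos)
  \<comment> \<open>The virtual quadrants carry as constants the values at \<open>m e\<close> of
    their actual neighbours, which makes the alternating sum vanish for any \<open>q1\<close> and
    \<open>q2\<close>.\<close>
  define F where "F = (\<lambda>(g::real) (h::real). if g = 1 then (if h = 1 then q1 else q2)
      else (if h = 1 then (\<lambda>z. q1 (m e)) else (\<lambda>z. q2 (m e))))"
  have "F \<in> {F. E.pw F \<in> divs k}"
    by (rule cross.all_poly[OF E.cross[OF one], where n = "k - 1"]) (use q1(1) q2(1) k h2 in \<open>auto simp: F_def\<close>)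
  then have "E.pw F \<in> divs k" by simp
  then show ?thesis
    by (rule divs_cong) (rule pw_ind, use q1(2) q2(2) h2 in \<open>auto simp: F_def\<close>)
qed

end

locale shared_edge = framed_edge +
  fixes T' :: "pt set" and \<alpha> :: real
  assumes T': "T' \<in> \<T>" "T' \<noteq> T" "e edge_of T'" and \<alpha>: "0 < \<alpha>" "c T' = m e - \<alpha> *\<^sub>R s"
begin

abbreviation g2 where "g2 \<equiv> - 1 / \<alpha>"

lemma signs: "(0::real) < 1" "g2 < 0" "(0::real) < 1" "h2 < 0" using \<alpha> ab(3) by auto

lemma cells': "convex hull {c T', a, m e} = C g2 1" "convex hull {c T', b, m e} = C g2 h2"
  using cells(3,4)[OF \<alpha>(1)] \<alpha>(2) by simp_all

lemma C_subset_tri': "h \<in> {1, h2} \<Longrightarrow> C g2 h \<subseteq> tri T' e"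
  using split_subset_tri[OF T'(1,3), of a] split_subset_tri[OF T'(1,3), of b] cells' extreme_e by auto

lemma interior_C': "g \<in> {1, g2} \<Longrightarrow> h \<in> {1, h2} \<Longrightarrow> interior (C g h) = Q g h"
  using signs by (intro interior_C) auto

lemma hat_imp_D:
  assumes "0 < hat X Y (m e) 1 g2 1 h2 z" shows "z \<in> (\<Union>g\<in>{1, g2}. \<Union>h\<in>{1, h2}. C g h)"
proof -
  obtain g where g: "g \<in> {1, g2}" "0 \<le> g * (X \<bullet> (z - m e))"
    using signs by (metis insertI1 insertI2 mult_nonneg_nonneg mult_nonpos_nonpos less_imp_le linorder_le_cases)
  show ?thesis using hat_ctri[OF signs assms g] g(1) by blast
qed

lemma D_subset: "(\<Union>g\<in>{1, g2}. \<Union>h\<in>{1, h2}. C g h) \<subseteq> tri T e \<union> tri T' e"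
  using C_subset_tri C_subset_tri' by blast

lemma interior_meets:
  assumes K: "K \<in> ps_mesh c m \<T>" "z \<in> interior K"
  shows "z \<in> tri T e \<Longrightarrow> K = C 1 1 \<or> K = C 1 h2" "z \<in> tri T' e \<Longrightarrow> K = C g2 1 \<or> K = C g2 h2"
  using interior_meets_tri[OF T e K] interior_meets_tri[OF T'(1,3) K] extreme_e cells cells' by auto

text \<open>Here cutting off changes nothing: where the hat function is positive, the point already
  lies in one of the four cells.\<close>

lemma edge_cross: "edge_cross \<Omega> \<T> c m (m e) X Y s t 1 g2 1 h2 k {1, g2}"
proof
  fix K assume K: "K \<in> ps_mesh c m \<T>"
  show "(\<exists>g\<in>{1, g2}. \<exists>h\<in>{1, h2}. interior K = Q g h) \<or> interior K \<inter> (\<Union>g\<in>{1, g2}. \<Union>h\<in>{1, h2}. C g h) = {}"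
  proof (cases "interior K \<inter> (\<Union>g\<in>{1, g2}. \<Union>h\<in>{1, h2}. C g h) = {}")
    case False
    then obtain z where z: "z \<in> interior K" "z \<in> tri T e \<or> z \<in> tri T' e" using D_subset by blast
    then have "K = C 1 1 \<or> K = C 1 h2 \<or> K = C g2 1 \<or> K = C g2 h2" using interior_meets[OF K] by blast
    then obtain g h where gh: "g \<in> {1, g2}" "h \<in> {1, h2}" "K = C g h" by blast
    then have "interior K = Q g h" using interior_C' by blast
    then show ?thesis using gh(1,2) by blast
  qed simp
next
  fix f :: "pt \<Rightarrow> real"
  assume f: "continuous_on UNIV f" "\<And>z. hat X Y (m e) 1 g2 1 h2 z \<le> 0 \<Longrightarrow> f z = 0"
  have "(if z \<in> (\<Union>g\<in>{1, g2}. \<Union>h\<in>{1, h2}. C g h) then f z else 0) = f z" for z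
  proof (cases "0 < hat X Y (m e) 1 g2 1 h2 z")
    case True
    then show ?thesis using hat_imp_D[OF True] by (simp only: if_True)
  next
    case False
    then have "f z = 0" using f(2)[of z] by linarith
    then show ?thesis by simp
  qed
  then show "continuous_on (closure \<Omega>) (\<lambda>z. if z \<in> (\<Union>g\<in>{1, g2}. \<Union>h\<in>{1, h2}. C g h) then f z else 0)"
    using continuous_on_subset[OF f(1) subset_UNIV] by (simp only:)
qed (use k frame signs in auto)

end

sublocale shared_edge \<subseteq> E: edge_cross \<Omega> \<T> c m "m e" X Y s t 1 g2 1 h2 k "{1, g2}"
  by (rule edge_cross)

context shared_edge
begin

lemma hat_subset: "{z. 0 < hat X Y (m e) 1 g2 1 h2 z} \<subseteq> T \<union> T'"
  using hat_imp_D D_subset tri_subset_T[OF T e] tri_subset_T[OF T'(1,3)] by blast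

lemma rel_interior_subset_interior: "rel_interior e \<subseteq> interior (T \<union> T')"
  using rel_interior_hat interior_maximal[OF hat_subset open_hat] by blast

text \<open>The open set lies in the closure of \<Omega>; that it lies in \<Omega> itself is the
  absence of slits.\<close>

lemma hat_subset_\<Omega>: "{z. 0 < hat X Y (m e) 1 g2 1 h2 z} \<subseteq> \<Omega>"
proof -
  have "T \<union> T' \<subseteq> closure \<Omega>" using T T'(1) Union_mesh by blast
  then have "interior (T \<union> T') \<subseteq> \<Omega>" using interior_mono interior_closure_\<Omega> by blast
  then show ?thesis using interior_maximal[OF hat_subset open_hat] by blast
qed

lemma m_in_\<Omega>: "m e \<in> \<Omega>"
  using hat_m hat_subset_\<Omega> by (metis (mono_tags, lifting) mem_Collect_eq subsetD zero_less_one)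

text \<open>A third triangle with the edge \<open>e\<close> would have interior points arbitrarily
  close to \<open>m e\<close>, in the neighbourhood filled by \<open>T\<close> and
  \<open>T'\<close>.\<close>

lemma only_two: assumes "T'' \<in> \<T>" "e edge_of T''" shows "T'' = T \<or> T'' = T'"
proof (rule ccontr)
  assume n: "\<not> (T'' = T \<or> T'' = T')"
  have "m e \<in> closure (interior T'')" using m_in_e[OF assms] edge_facts(2)[OF assms] closure_interior_T[OF assms(1)] by blast
  moreover have "m e \<in> {z. 0 < hat X Y (m e) 1 g2 1 h2 z}" using hat_m by simp
  ultimately have "interior T'' \<inter> {z. 0 < hat X Y (m e) 1 g2 1 h2 z} \<noteq> {}"
    using open_hat open_Int_closure_eq_empty by blast
  then have "interior T'' \<inter> (T \<union> T') \<noteq> {}" using hat_subset by blast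
  then show False using interior_Int_empty[OF assms(1) T] interior_Int_empty[OF assms(1) T'(1)] n by blast
qed

lemma cell_cases:
  assumes K: "K \<in> ps_mesh c m \<T>" "z \<in> interior K"
  shows "(\<exists>h\<in>{1, h2}. z \<in> Q 1 h \<and> ind T e z = 1 \<and> ind T' e z = 0) \<or>
     (\<exists>h\<in>{1, h2}. z \<in> Q g2 h \<and> ind T e z = 0 \<and> ind T' e z = 1) \<or>
     (z \<notin> E.D \<and> ind T e z = 0 \<and> ind T' e z = 0)"
proof -
  have *: "z \<notin> tri T' e" if "z \<in> Q 1 h" "h \<in> {1, h2}" for h
  proof -
    have "Q 1 h \<subseteq> T" using C_subset_tri[OF that(2)] tri_subset_T[OF T e] interior_C'[of 1 h] that(2) interior_subset by blast
    then have "z \<in> interior T" using open_quad that(1) by (meson interiorI)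
    then show ?thesis using interior_Int_empty[OF T T'(1)] T'(2) tri_subset_T[OF T'(1,3)] by blast
  qed
  have **: "z \<notin> tri T e" if "z \<in> Q g2 h" "h \<in> {1, h2}" for h
  proof -
    have "Q g2 h \<subseteq> T'" using C_subset_tri'[OF that(2)] tri_subset_T[OF T'(1,3)] interior_C'[of g2 h] that(2) interior_subset by blast
    then have "z \<in> interior T'" using open_quad that(1) by (meson interiorI)
    then show ?thesis using interior_Int_empty[OF T'(1) T] T'(2) tri_subset_T[OF T e] by blast
  qed
  consider "z \<in> tri T e" | "z \<in> tri T' e" | "z \<notin> tri T e" "z \<notin> tri T' e" by blast
  then show ?thesis
  proof cases
    case 1
    then obtain h where "h \<in> {1, h2}" "z \<in> Q 1 h" using interior_meets(1)[OF K 1] interior_C'[of 1] K(2) by auto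
    then show ?thesis using *[of h] 1 by (auto simp: ind_def)
  next
    case 2
    then obtain h where "h \<in> {1, h2}" "z \<in> Q g2 h" using interior_meets(2)[OF K 2] interior_C'[of g2] K(2) by auto
    then show ?thesis using **[of h] 2 by (auto simp: ind_def)
  next
    case 3
    then have "z \<notin> E.D" using D_subset by blast
    then show ?thesis using 3 by (simp add: ind_def)
  qed
qed

lemma pw_ind:
  assumes "K \<in> ps_mesh c m \<T>" "z \<in> interior K" "\<And>h. h \<in> {1, h2} \<Longrightarrow> z \<in> Q 1 h \<Longrightarrow> F 1 h z = v"
    "\<And>h. h \<in> {1, h2} \<Longrightarrow> z \<in> Q g2 h \<Longrightarrow> F g2 h z = v'"
  shows "E.pw F z = v * ind T e z + v' * ind T' e z"
proof -
  consider h where "h \<in> {1, h2}" "z \<in> Q 1 h" "ind T e z = 1" "ind T' e z = 0"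
    | h where "h \<in> {1, h2}" "z \<in> Q g2 h" "ind T e z = 0" "ind T' e z = 1"
    | "z \<notin> E.D" "ind T e z = 0" "ind T' e z = 0" using cell_cases[OF assms(1,2)] by blast
  then show ?thesis
  proof cases
    case 1
    then show ?thesis using E.pw_quad[of 1 h z F] assms(3)[of h] by simp
  next
    case 2
    then show ?thesis using E.pw_quad[of g2 h z F] assms(4)[of h] by simp
  next
    case 3
    then show ?thesis using E.pw_outside[of z F] by simp
  qed
qed

text \<open>The divergence in \<open>pw_hat\<close> is \<open>- 1\<close> on the side of
  \<open>T\<close> and \<open>- g2\<close> on the side of \<open>T'\<close>, both nonzero.\<close>

lemma ind_neighbour: assumes "ind T e \<in> divs k" shows "ind T' e \<in> divs k"
proof -
  have "(\<lambda>z. - 1 * ind T e z + (- g2) * ind T' e z) \<in> divs k"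
    by (rule divs_cong[OF E.pw_hat]) (rule pw_ind, auto)
  then show ?thesis by (rule divs_transfer) (use assms signs in auto)
qed

end

section \<open>From single edges to all indicators\<close>

context ps_refinement
begin

lemma framed_edge_exists:
  assumes "T \<in> \<T>" "e edge_of T" "1 \<le> k"
  shows "\<exists>a b s t Y \<beta>. framed_edge \<Omega> \<T> c m T e a b s t Y \<beta> k"
proof -
  obtain a b s t Y \<beta> where *: "a \<noteq> b" "e = closed_segment a b" "0 < \<beta>"
    "c T = m e + s" "a = m e + t" "b = m e - \<beta> *\<^sub>R t"
    "nrm T e \<bullet> s = 1" "nrm T e \<bullet> t = 0" "Y \<bullet> s = 0" "Y \<bullet> t = 1"
    using edge_frame[OF assms(1,2)] .
  have "framed_edge \<Omega> \<T> c m T e a b s t Y \<beta> k"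
    by (intro framed_edge.intro ps_refinement_axioms framed_edge_axioms.intro * assms)
  then show ?thesis by blast
qed

lemma boundary_edge_exists:
  assumes "T \<in> \<T>" "e edge_of T" "1 \<le> k" "\<And>T'. T' \<in> \<T> \<Longrightarrow> T' \<noteq> T \<Longrightarrow> \<not> e edge_of T'"
  shows "\<exists>a b s t Y \<beta>. boundary_edge \<Omega> \<T> c m T e a b s t Y \<beta> k"
proof -
  obtain a b s t Y \<beta> where "framed_edge \<Omega> \<T> c m T e a b s t Y \<beta> k"
    using framed_edge_exists[OF assms(1-3)] by blast
  then interpret framed_edge \<Omega> \<T> c m T e a b s t Y \<beta> k .
  have "boundary_edge \<Omega> \<T> c m T e a b s t Y \<beta> k" by unfold_locales (rule assms(4))
  then show ?thesis by blast
qed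

lemma shared_edge_exists:
  assumes "T \<in> \<T>" "e edge_of T" "1 \<le> k" "T' \<in> \<T>" "T' \<noteq> T" "e edge_of T'"
  shows "\<exists>a b s t Y \<beta> \<alpha>. shared_edge \<Omega> \<T> c m T e a b s t Y \<beta> k T' \<alpha>"
proof -
  obtain a b s t Y \<beta> where "framed_edge \<Omega> \<T> c m T e a b s t Y \<beta> k"
    using framed_edge_exists[OF assms(1-3)] by blast
  then interpret framed_edge \<Omega> \<T> c m T e a b s t Y \<beta> k .
  obtain \<alpha> where \<alpha>: "0 < \<alpha>" "c T' = m e - \<alpha> *\<^sub>R (c T - m e)"
    using shared_frame[OF assms(1,4) assms(5)[symmetric] assms(2,6)] .
  have "c T - m e = s" using ab(4) by (metis add_diff_cancel_left')
  then have "shared_edge \<Omega> \<T> c m T e a b s t Y \<beta> k T' \<alpha>"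
    using \<alpha> by (intro shared_edge.intro framed_edge_axioms shared_edge_axioms.intro assms) simp_all
  then show ?thesis by blast
qed

lemma all_edges_extreme_finite: "finite (\<Union>T\<in>\<T>. \<Union>e\<in>{e. e edge_of T}. {a. a extreme_point_of e})"
proof (intro finite_UN_I finite_mesh)
  fix T e assume T: "T \<in> \<T>" "e \<in> {e. e edge_of T}"
  then obtain a b where "a \<noteq> b" "e = closed_segment a b" using edge_segment by blast
  then have "{a. a extreme_point_of e} = {a, b}" by (auto simp: extreme_point_of_segment)
  then show "finite {a. a extreme_point_of e}" by simp
qed (rule finite_edges)

text \<open>A set of triangles that is closed under passing to neighbours and touches no boundary edge
  would have a union whose frontier is finite.\<close>

lemma ind_divs:
  assumes T: "T \<in> \<T>" "e edge_of T" and k: "1 \<le> k"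
  shows "ind T e \<in> divs k"
proof (rule ccontr)
  assume no: "ind T e \<notin> divs k"
  define B where "B = {T \<in> \<T>. \<forall>e. e edge_of T \<longrightarrow> ind T e \<notin> divs k}"
  have B: "T \<in> B" if "T \<in> \<T>" "e edge_of T" "ind T e \<notin> divs k" for T e
    using divs_ind_other_edge[OF that(1) _ that(2) k] that unfolding B_def by blast
  have TB: "T \<in> B" using B[OF T no] .
  have neighbour: "\<exists>T'\<in>B. rel_interior e \<subseteq> interior (T \<union> T')" if T: "T \<in> B" "e edge_of T" for T e
  proof -
    have T\<T>: "T \<in> \<T>" and noT: "ind T e \<notin> divs k" using T by (auto simp: B_def)
    show ?thesis
    proof (cases "\<exists>T'\<in>\<T>. T' \<noteq> T \<and> e edge_of T'")
      case True
      then obtain T' where T': "T' \<in> \<T>" "T' \<noteq> T" "e edge_of T'" by blast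
      obtain a b s t Y \<beta> \<alpha> where S: "shared_edge \<Omega> \<T> c m T e a b s t Y \<beta> k T' \<alpha>"
        using shared_edge_exists[OF T\<T> T(2) k T'] by blast
      \<comment> \<open>The roles are exchanged, since the contrapositive is needed: if the
        indicator on the side of \<open>T'\<close> were attained, so would be the one on the side of
        \<open>T\<close>.\<close>
      obtain a' b' s' t' Y' \<beta>' \<alpha>' where S': "shared_edge \<Omega> \<T> c m T' e a' b' s' t' Y' \<beta>' k T \<alpha>'"
        using shared_edge_exists[OF T'(1,3) k T\<T> T'(2)[symmetric] T(2)] by blast
      have "ind T' e \<notin> divs k" using shared_edge.ind_neighbour[OF S'] noT by blast
      then have "T' \<in> B" using B[OF T'(1,3)] by blast
      then show ?thesis using shared_edge.rel_interior_subset_interior[OF S] by blast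
    next
      case False
      then obtain a b s t Y \<beta> where "boundary_edge \<Omega> \<T> c m T e a b s t Y \<beta> k"
        using boundary_edge_exists[OF T\<T> T(2) k] by blast
      then show ?thesis using boundary_edge.ind_divs noT by blast
    qed
  qed
  define U where "U = \<Union>B"
  define V where "V = (\<Union>T\<in>\<T>. \<Union>e\<in>{e. e edge_of T}. {a. a extreme_point_of e})"
  have B\<T>: "B \<subseteq> \<T>" by (auto simp: B_def)
  have U: "compact U" unfolding U_def using B\<T> finite_subset[OF B\<T> finite_mesh] compact_T by (intro compact_Union) auto
  have fV: "finite V" unfolding V_def by (rule all_edges_extreme_finite)
  \<comment> \<open>The plane without finitely many points is connected, yet it would be covered by
    the disjoint open sets \<open>interior U\<close> and \<open>- U\<close>, both of which meet
    it.\<close>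
  have conn: "connected (UNIV - V)"
    using fV by (intro connected_open_delete_finite) auto
  have sub: "UNIV - V \<subseteq> interior U \<union> - U"
  proof
    fix z assume z: "z \<in> UNIV - V"
    show "z \<in> interior U \<union> - U"
    proof (cases "z \<in> U")
      case True
      then obtain T where T: "T \<in> B" "z \<in> T" by (auto simp: U_def)
      have T\<T>: "T \<in> \<T>" using T B\<T> by blast
      have TU: "interior T \<subseteq> interior U" using T by (intro interior_mono) (auto simp: U_def)
      show ?thesis
      proof (cases "z \<in> interior T")
        case False
        then obtain e where e: "e edge_of T" "z \<in> e" using edge_of_boundary_point[OF T\<T> T(2)] by blast
        obtain a b where ab: "a \<noteq> b" "e = closed_segment a b" using edge_segment[OF T\<T> e(1)] .
        have "\<not> z extreme_point_of e" using z e(1) T\<T> unfolding V_def by blast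
        then have "z \<noteq> a" "z \<noteq> b" using ab by (auto simp: extreme_point_of_segment)
        then have "z \<in> rel_interior e" using ab e(2) by (auto simp: rel_interior_closed_segment open_segment_def)
        moreover obtain T' where T': "T' \<in> B" "rel_interior e \<subseteq> interior (T \<union> T')" using neighbour[OF T(1) e(1)] by blast
        moreover have "interior (T \<union> T') \<subseteq> interior U" using T(1) T'(1) by (intro interior_mono) (auto simp: U_def)
        ultimately show ?thesis by blast
      qed (use TU in blast)
    qed blast
  qed
  have "interior U \<inter> (UNIV - V) = {} \<or> - U \<inter> (UNIV - V) = {}"
    using conn open_interior compact_imp_closed[OF U] sub interior_subset
    by (intro connectedD) auto
  moreover have "interior U - V \<noteq> {}"
  proof (rule open_Diff_finite_nonempty[OF open_interior _ fV])
    have "interior T \<subseteq> interior U" using TB by (intro interior_mono) (auto simp: U_def)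
    then show "interior U \<noteq> {}" using interior_nonempty[OF T(1)] by blast
  qed
  moreover have "- U - V \<noteq> {}"
  proof (rule open_Diff_finite_nonempty[OF _ _ fV])
    show "open (- U)" using compact_imp_closed[OF U] by blast
    show "- U \<noteq> {}" using compact_imp_bounded[OF U] by (metis Compl_empty_eq double_complement not_bounded_UNIV)
  qed
  ultimately show False by blast
qed

end


section \<open>Singular vertices\<close>

text \<open>A polynomial vanishing on a segment vanishes on its whole line, so the derivative along
  the line is zero even at the end \<open>p\<close>.\<close>

lemma poly2_segment_zero:
  assumes f: "f \<in> poly2 r" and 0: "\<And>u. u \<in> {0..1} \<Longrightarrow> f (p + u *\<^sub>R w) = 0"
  shows "partial 1 f p * w $ 1 + partial 2 f p * w $ 2 = 0"
proof -
  obtain c :: "nat \<Rightarrow> real" and n where c: "(\<lambda>t. f (p + t *\<^sub>R w)) = (\<lambda>t. \<Sum>i\<le>n. c i * t^i)"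
    using poly2_line[OF f] unfolding real_polynomial_function_iff_sum by blast
  have "{0..1} \<subseteq> {t. (\<Sum>i\<le>n. c i * t^i) = 0}" using 0 fun_cong[OF c] by auto
  moreover have "infinite {0..1::real}" by (simp add: infinite_Icc)
  ultimately have "infinite {t. (\<Sum>i\<le>n. c i * t^i) = 0}" using finite_subset by blast
  then have "\<forall>i\<le>n. c i = 0" using polyfun_finite_roots[of c n] by blast
  then have z: "(\<lambda>t. f (p + t *\<^sub>R w)) = (\<lambda>t. 0)" unfolding c by simp
  have 1: "((\<lambda>t. p + t *\<^sub>R w) has_derivative (\<lambda>h. h *\<^sub>R w)) (at 0)" by (auto intro!: derivative_eq_intros)
  have "((\<lambda>t. f (p + t *\<^sub>R w)) has_derivative (\<lambda>h. partial 1 f p * (h *\<^sub>R w) $ 1 + partial 2 f p * (h *\<^sub>R w) $ 2)) (at 0)"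
    by (rule has_derivative_compose[OF 1]) (use has_derivative_partial[OF poly2_differentiable[OF f], of p] in simp)
  moreover have "((\<lambda>t. f (p + t *\<^sub>R w)) has_derivative (\<lambda>h. 0)) (at 0)" unfolding z by simp
  ultimately have "(\<lambda>h. partial 1 f p * (h *\<^sub>R w) $ 1 + partial 2 f p * (h *\<^sub>R w) $ 2) = (\<lambda>h. 0)"
    by (rule has_derivative_unique)
  from fun_cong[OF this, of 1] show ?thesis by simp
qed

lemma continuous_agree_on_closure:
  fixes f g :: "pt \<Rightarrow> 'b::t2_space"
  assumes "continuous_on S f" "continuous_on S g" "U \<subseteq> S" "S \<subseteq> closure U"
    and eq: "\<And>z. z \<in> U \<Longrightarrow> f z = g z" and z: "z \<in> S"
  shows "f z = g z"
proof (cases "z \<in> U")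
  case False
  then have nt: "\<not> trivial_limit (at z within U)"
    using assms(4) z by (auto simp: trivial_limit_within closure_def)
  have f: "(f \<longlongrightarrow> f z) (at z within U)" and g: "(g \<longlongrightarrow> g z) (at z within U)"
    using assms(1,2) z tendsto_within_subset[OF _ assms(3)] unfolding continuous_on_def by blast+
  have "(f \<longlongrightarrow> g z) (at z within U)"
    by (rule Lim_transform_eventually[OF g]) (auto simp: eventually_at_filter eq)
  then show ?thesis using tendsto_unique[OF nt f] by simp
qed (rule eq)

lemma ctri_swap: "ctri X Y p g h = ctri Y X p h g"
  by (auto simp: ctri_def)

lemma ctri_edge:
  fixes X Y s t p :: pt
  assumes frame: "X \<bullet> s = 1" "X \<bullet> t = 0" "Y \<bullet> s = 0" "Y \<bullet> t = 1" and g: "g \<noteq> 0" and h: "h * h' < 0"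
  shows "(ctri X Y p g h \<inter> ctri X Y p g h') edge_of ctri X Y p g h"
proof -
  have h0: "h \<noteq> 0" using h by auto
  have I: "ctri X Y p g h \<inter> ctri X Y p g h' = {z. Y \<bullet> (z - p) = 0 \<and> 0 \<le> g * (X \<bullet> (z - p)) \<and> g * (X \<bullet> (z - p)) \<le> 1}"
  proof -
    have "r = 0" if "0 \<le> h * r" "0 \<le> h' * r" for r
      using that h by (auto simp: zero_le_mult_iff mult_less_0_iff)
    then show ?thesis by (auto simp: ctri_def)
  qed
  have cv: "convex (ctri X Y p g h)" using convex_hull_eq_ctri[OF frame g h0, of p] convex_convex_hull by metis
  have "(ctri X Y p g h \<inter> {z. (h *\<^sub>R Y) \<bullet> z = (h *\<^sub>R Y) \<bullet> p}) face_of ctri X Y p g h"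
    using cv by (intro face_of_Int_supporting_hyperplane_ge) (auto simp: ctri_def inner_diff_right algebra_simps)
  moreover have "ctri X Y p g h \<inter> {z. (h *\<^sub>R Y) \<bullet> z = (h *\<^sub>R Y) \<bullet> p} = ctri X Y p g h \<inter> ctri X Y p g h'"
    unfolding I using h0 by (auto simp: ctri_def inner_diff_right)
  ultimately have face: "(ctri X Y p g h \<inter> ctri X Y p g h') face_of ctri X Y p g h" by simp
  have "ctri X Y p g h \<inter> ctri X Y p g h' = closed_segment p (p + (1 / g) *\<^sub>R s)"
  proof (intro equalityI subsetI)
    fix z assume z: "z \<in> ctri X Y p g h \<inter> ctri X Y p g h'"
    then have "z - p = (g * (X \<bullet> (z - p))) *\<^sub>R ((1 / g) *\<^sub>R s)"
      unfolding I using frame_coords[OF frame, of "z - p"] g by simp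
    then have "z = (1 - g * (X \<bullet> (z - p))) *\<^sub>R p + (g * (X \<bullet> (z - p))) *\<^sub>R (p + (1 / g) *\<^sub>R s)"
      by (simp add: algebra_simps)
    then show "z \<in> closed_segment p (p + (1 / g) *\<^sub>R s)"
      using z unfolding I in_segment by blast
  next
    fix z assume "z \<in> closed_segment p (p + (1 / g) *\<^sub>R s)"
    then obtain u where u: "0 \<le> u" "u \<le> 1" "z = (1 - u) *\<^sub>R p + u *\<^sub>R (p + (1 / g) *\<^sub>R s)" by (auto simp: in_segment)
    have "z - p = (u / g) *\<^sub>R s" unfolding u(3) by (simp add: algebra_simps)
    then show "z \<in> ctri X Y p g h \<inter> ctri X Y p g h'" unfolding I using u(1,2) frame g by simp
  qed
  moreover have "p \<noteq> p + (1 / g) *\<^sub>R s" using frame g by auto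
  ultimately have "aff_dim (ctri X Y p g h \<inter> ctri X Y p g h') = 1"
    by (simp add: segment_convex_hull aff_dim_convex_hull aff_dim_2)
  then show ?thesis using face by (simp add: edge_of_def)
qed

text \<open>Opposite cells share only the point \<open>p\<close>; this excludes numberings in which
  they are neighbours.\<close>

lemma ctri_opposite:
  fixes X Y s t p :: pt
  assumes frame: "X \<bullet> s = 1" "X \<bullet> t = 0" "Y \<bullet> s = 0" "Y \<bullet> t = 1" and g: "g * g' < 0" and h: "h * h' < 0"
  shows "\<not> (ctri X Y p g h \<inter> ctri X Y p g' h') edge_of K"
proof -
  have 0: "r = 0" if "0 \<le> u * r" "0 \<le> u' * r" "u * u' < 0" for r u u' :: real
    using that by (auto simp: zero_le_mult_iff mult_less_0_iff)
  have "ctri X Y p g h \<inter> ctri X Y p g' h' \<subseteq> {p}"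
  proof
    fix z assume "z \<in> ctri X Y p g h \<inter> ctri X Y p g' h'"
    then have "X \<bullet> (z - p) = 0" "Y \<bullet> (z - p) = 0" using 0 g h unfolding ctri_def by blast+
    then have "z - p = 0" using frame_coords[OF frame, of "z - p"] by simp
    then show "z \<in> {p}" by simp
  qed
  then have "aff_dim (ctri X Y p g h \<inter> ctri X Y p g' h') \<le> 0" using aff_dim_subset[of _ "{p}"] by simp
  then show ?thesis by (simp add: edge_of_def)
qed

text \<open>Neighbours in the cycle are related and opposite elements are not, so \<open>M1\<close>,
  \<open>M3\<close> form one opposite pair and \<open>M2\<close>, \<open>M4\<close> the other; only
  the sign of the sum is left open.\<close>

lemma cyclic_alternating_sum:
  fixes v :: "'a \<Rightarrow> real"
  assumes d: "distinct [M1, M2, M3, M4]" and eq: "{M1, M2, M3, M4} = {A, B, C, D}"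
    and R: "R M1 M2" "R M2 M3" "R M3 M4" "R M4 M1"
    and n: "\<not> R A C" "\<not> R C A" "\<not> R B D" "\<not> R D B"
  shows "\<bar>v M1 - v M2 + v M3 - v M4\<bar> = \<bar>v A - v B + v C - v D\<bar>"
proof -
  have m: "M1 \<in> {A, B, C, D}" "M2 \<in> {A, B, C, D}" "M3 \<in> {A, B, C, D}" "M4 \<in> {A, B, C, D}"
    unfolding eq[symmetric] by simp_all
  have "(M1 = A \<and> M3 = C \<or> M1 = C \<and> M3 = A) \<and> (M2 = B \<and> M4 = D \<or> M2 = D \<and> M4 = B) \<or>
    (M1 = B \<and> M3 = D \<or> M1 = D \<and> M3 = B) \<and> (M2 = A \<and> M4 = C \<or> M2 = C \<and> M4 = A)"
    using m(1)
  proof (elim insertE emptyE)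
    assume 1: "M1 = A"
    then have "M2 \<noteq> A" "M3 \<noteq> A" "M4 \<noteq> A" "M2 \<noteq> M3" "M2 \<noteq> M4" "M3 \<noteq> M4" using d by auto
    moreover have "M2 \<noteq> C" "M4 \<noteq> C" using 1 R n by blast+
    ultimately show ?thesis using m(2-4) 1 by auto
  next
    assume 1: "M1 = B"
    then have "M2 \<noteq> B" "M3 \<noteq> B" "M4 \<noteq> B" "M2 \<noteq> M3" "M2 \<noteq> M4" "M3 \<noteq> M4" using d by auto
    moreover have "M2 \<noteq> D" "M4 \<noteq> D" using 1 R n by blast+
    ultimately show ?thesis using m(2-4) 1 by auto
  next
    assume 1: "M1 = C"
    then have "M2 \<noteq> C" "M3 \<noteq> C" "M4 \<noteq> C" "M2 \<noteq> M3" "M2 \<noteq> M4" "M3 \<noteq> M4" using d by auto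
    moreover have "M2 \<noteq> A" "M4 \<noteq> A" using 1 R n by blast+
    ultimately show ?thesis using m(2-4) 1 by auto
  next
    assume 1: "M1 = D"
    then have "M2 \<noteq> D" "M3 \<noteq> D" "M4 \<noteq> D" "M2 \<noteq> M3" "M2 \<noteq> M4" "M3 \<noteq> M4" using d by auto
    moreover have "M2 \<noteq> B" "M4 \<noteq> B" using 1 R n by blast+
    ultimately show ?thesis using m(2-4) 1 by auto
  qed
  then show ?thesis by (elim disjE conjE) (simp_all add: abs_if)
qed

context ps_refinement
begin

lemma closure_interior_K: assumes "K \<in> ps_mesh c m \<T>" shows "closure (interior K) = K"
proof -
  obtain T e d where K: "T \<in> \<T>" "e edge_of T" "d extreme_point_of e" "K = convex hull {c T, d, m e}"
    using ps_meshE[OF assms] .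
  obtain a b s t Y \<beta> where "framed_edge \<Omega> \<T> c m T e a b s t Y \<beta> 1"
    using framed_edge_exists[OF K(1,2), of 1] by blast
  then interpret framed_edge \<Omega> \<T> c m T e a b s t Y \<beta> 1 .
  have h2: "h2 \<noteq> 0" using ab(3) by simp
  have "K = C 1 1 \<or> K = C 1 h2" using K(3,4) extreme_e cells(1,2) by auto
  then show ?thesis using closure_Q[of 1 1] closure_Q[OF _ h2, of 1] interior_C[of 1 1] interior_C[OF _ h2, of 1] by auto
qed

lemma interior_K_subset_\<Omega>: "K \<in> ps_mesh c m \<T> \<Longrightarrow> interior K \<subseteq> \<Omega>"
  using ps_mesh_covers interior_mono[of K "closure \<Omega>"] interior_closure_\<Omega> by auto

text \<open>Values on the boundary of the cell, as far as it lies in \<Omega>, follow by density of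
  the open cell.\<close>

lemma eq_on_cell:
  fixes u :: "pt \<Rightarrow> real"
  assumes u: "continuous_on \<Omega> u" and K: "K \<in> ps_mesh c m \<T>"
    and q: "q \<in> poly2 r" "\<And>z. z \<in> interior K \<Longrightarrow> u z = q z" and z: "z \<in> K" "z \<in> \<Omega>"
  shows "u z = q z"
proof (rule continuous_agree_on_closure[of "K \<inter> \<Omega>" u q "interior K"])
  show "continuous_on (K \<inter> \<Omega>) u" using u by (rule continuous_on_subset) simp
  show "interior K \<subseteq> K \<inter> \<Omega>" using interior_K_subset_\<Omega>[OF K] interior_subset by blast
  show "K \<inter> \<Omega> \<subseteq> closure (interior K)" using closure_interior_K[OF K] by blast
qed (use q z poly2_continuous in auto)

end

section \<open>The four cells at an interior edge point and their alternating sum\<close>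

context shared_edge
begin

abbreviation GH where "GH g h \<equiv> g \<in> {1, g2} \<and> h \<in> {1, h2}"

lemma GH_nonzero: "GH g h \<Longrightarrow> g \<noteq> 0 \<and> h \<noteq> 0" using signs by auto

lemma cell_in_mesh: assumes "GH g h" shows "C g h \<in> ps_mesh c m \<T>"
proof -
  have "C 1 1 \<in> ps_mesh c m \<T>" "C 1 h2 \<in> ps_mesh c m \<T>"
    using ps_meshI[OF T e, of a] ps_meshI[OF T e, of b] extreme_e unfolding cells(1,2) by simp_all
  moreover have "C g2 1 \<in> ps_mesh c m \<T>" "C g2 h2 \<in> ps_mesh c m \<T>"
    using ps_meshI[OF T'(1,3), of a] ps_meshI[OF T'(1,3), of b] extreme_e unfolding cells' by simp_all
  ultimately show ?thesis using assms by blast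
qed

lemma m_in_C: "m e \<in> C g h" by (simp add: ctri_def)

lemma extreme_m: assumes "GH g h" shows "m e extreme_point_of C g h"
proof -
  have 0: "g \<noteq> 0" "h \<noteq> 0" using GH_nonzero[OF assms] by auto
  define \<phi> where "\<phi> z = g * (X \<bullet> (z - m e)) + h * (Y \<bullet> (z - m e))" for z
  have pos: "0 \<le> \<phi> z" if "z \<in> C g h" for z using that by (auto simp: ctri_def \<phi>_def)
  have zero: "z = m e" if "z \<in> C g h" "\<phi> z = 0" for z
  proof -
    have "g * (X \<bullet> (z - m e)) = 0 \<and> h * (Y \<bullet> (z - m e)) = 0"
      using that unfolding ctri_def \<phi>_def mem_Collect_eq by linarith
    then have "z - m e = 0" using coords[of "z - m e"] 0 by simp
    then show ?thesis by simp
  qed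
  have "m e \<notin> open_segment p q" if pq: "p \<in> C g h" "q \<in> C g h" for p q
  proof
    assume o: "m e \<in> open_segment p q"
    then obtain u where u: "0 < u" "u < 1" "m e = (1 - u) *\<^sub>R p + u *\<^sub>R q" by (auto simp: in_segment)
    have "(1 - u) *\<^sub>R (p - m e) + u *\<^sub>R (q - m e) = ((1 - u) *\<^sub>R p + u *\<^sub>R q) - m e" by (simp add: algebra_simps)
    then have "0 = (1 - u) *\<^sub>R (p - m e) + u *\<^sub>R (q - m e)" by (simp only: u(3)[symmetric] diff_self)
    then have "0 = X \<bullet> ((1 - u) *\<^sub>R (p - m e) + u *\<^sub>R (q - m e))" "0 = Y \<bullet> ((1 - u) *\<^sub>R (p - m e) + u *\<^sub>R (q - m e))"
      by (metis inner_zero_right)+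
    then have "0 = g * ((1 - u) * (X \<bullet> (p - m e)) + u * (X \<bullet> (q - m e))) + h * ((1 - u) * (Y \<bullet> (p - m e)) + u * (Y \<bullet> (q - m e)))"
      by (simp add: inner_add_right)
    also have "\<dots> = (1 - u) * \<phi> p + u * \<phi> q" by (simp add: \<phi>_def algebra_simps)
    finally have "(1 - u) * \<phi> p + u * \<phi> q = 0" by simp
    moreover have "0 \<le> (1 - u) * \<phi> p" "0 \<le> u * \<phi> q" using u pos pq by auto
    ultimately have "(1 - u) * \<phi> p = 0" "u * \<phi> q = 0" by linarith+
    then have "p = m e" "q = m e" using u zero pq by auto
    then show False using o by simp
  qed
  then show ?thesis using m_in_C by (auto simp: extreme_point_of_def)
qed

text \<open>A cell containing \<open>m e\<close> has interior points in the neighbourhood where the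
  hat function is positive, and is therefore one of the four.\<close>

lemma extreme_cells: "{K \<in> ps_mesh c m \<T>. m e extreme_point_of K} = {C 1 1, C 1 h2, C g2 h2, C g2 1}"
proof (intro equalityI subsetI)
  fix K assume "K \<in> {C 1 1, C 1 h2, C g2 h2, C g2 1}"
  then obtain g h where "GH g h" "K = C g h" by auto
  then show "K \<in> {K \<in> ps_mesh c m \<T>. m e extreme_point_of K}" using cell_in_mesh extreme_m by blast
next
  fix K assume "K \<in> {K \<in> ps_mesh c m \<T>. m e extreme_point_of K}"
  then have K: "K \<in> ps_mesh c m \<T>" "m e \<in> K" by (auto simp: extreme_point_of_def)
  then have "m e \<in> closure (interior K)" using closure_interior_K by blast
  moreover have "m e \<in> {z. 0 < hat X Y (m e) 1 g2 1 h2 z}" using hat_m by simp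
  ultimately have "interior K \<inter> {z. 0 < hat X Y (m e) 1 g2 1 h2 z} \<noteq> {}"
    using open_hat open_Int_closure_eq_empty by blast
  then obtain z where z: "z \<in> interior K" "z \<in> tri T e \<or> z \<in> tri T' e" using hat_imp_D D_subset by blast
  then show "K \<in> {C 1 1, C 1 h2, C g2 h2, C g2 1}" using interior_meets[OF K(1) z(1)] by blast
qed

lemma C_inject: assumes "GH g h" "GH g' h'" "C g h = C g' h'" shows "g' = g \<and> h' = h"
proof -
  have "Q g h = Q g' h'" using interior_C' assms by metis
  then obtain z where "z \<in> Q g h" "z \<in> Q g' h'" using Q_nonempty[of g h] GH_nonzero[OF assms(1)] by blast
  then show ?thesis using quad_unique[OF signs, of g h g' h' z] assms(1,2) by blast
qed

lemma one_neq: "1 \<noteq> g2" "1 \<noteq> h2" using signs by linarith+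

lemma C_distinct: "distinct [C 1 1, C 1 h2, C g2 h2, C g2 1]"
  using C_inject[of 1 1 1 h2] C_inject[of 1 1 g2 h2] C_inject[of 1 1 g2 1] C_inject[of 1 h2 g2 h2]
    C_inject[of 1 h2 g2 1] C_inject[of g2 h2 g2 1] one_neq by auto

lemma C_adjacent:
  "g \<in> {1, g2} \<Longrightarrow> (C g 1 \<inter> C g h2) edge_of C g 1" "g \<in> {1, g2} \<Longrightarrow> (C g 1 \<inter> C g h2) edge_of C g h2"
  "h \<in> {1, h2} \<Longrightarrow> (C 1 h \<inter> C g2 h) edge_of C 1 h" "h \<in> {1, h2} \<Longrightarrow> (C 1 h \<inter> C g2 h) edge_of C g2 h"
proof -
  have "g \<noteq> 0" if "g \<in> {1, g2}" using that signs by auto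
  then show "g \<in> {1, g2} \<Longrightarrow> (C g 1 \<inter> C g h2) edge_of C g 1" "g \<in> {1, g2} \<Longrightarrow> (C g 1 \<inter> C g h2) edge_of C g h2"
    using ctri_edge[OF frame, of g 1 h2] ctri_edge[OF frame, of g h2 1] signs by (auto simp: Int_commute)
  have "h \<noteq> 0" if "h \<in> {1, h2}" using that signs by auto
  then show "h \<in> {1, h2} \<Longrightarrow> (C 1 h \<inter> C g2 h) edge_of C 1 h" "h \<in> {1, h2} \<Longrightarrow> (C 1 h \<inter> C g2 h) edge_of C g2 h"
    using ctri_edge[OF frame(4,3,2,1), of h 1 g2] ctri_edge[OF frame(4,3,2,1), of h g2 1] signs
    by (auto simp: Int_commute ctri_swap[of X Y])
qed

text \<open>\<open>theta\<close> picks an arbitrary numbering; by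
  \<open>cyclic_alternating_sum\<close> the pick is immaterial.\<close>

lemma theta_eq:
  "theta (ps_mesh c m \<T>) (m e) f = \<bar>value_from (C 1 1) f (m e) - value_from (C 1 h2) f (m e)
     + value_from (C g2 h2) f (m e) - value_from (C g2 1) f (m e)\<bar>"
proof -
  let ?R = "\<lambda>K K'. (K \<inter> K') edge_of K"
  have cyc: "cyclic_numbering (ps_mesh c m \<T>) (m e) (C 1 1, C 1 h2, C g2 h2, C g2 1)"
    unfolding cyclic_numbering_def extreme_cells
    using C_distinct C_adjacent(1,2)[of 1] C_adjacent(1,2)[of g2] C_adjacent(3,4)[of 1] C_adjacent(3,4)[of h2]
    by (simp add: Int_commute)
  define Ks where "Ks = (SOME Ks. cyclic_numbering (ps_mesh c m \<T>) (m e) Ks)"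
  obtain M1 M2 M3 M4 where L: "Ks = (M1, M2, M3, M4)" by (cases Ks)
  have "cyclic_numbering (ps_mesh c m \<T>) (m e) Ks" unfolding Ks_def using cyc by (rule someI)
  then have "distinct [M1, M2, M3, M4]" "{M1, M2, M3, M4} = {C 1 1, C 1 h2, C g2 h2, C g2 1}"
    "?R M1 M2" "?R M2 M3" "?R M3 M4" "?R M4 M1"
    unfolding cyclic_numbering_def L extreme_cells by auto
  moreover have "\<not> ?R (C 1 1) (C g2 h2)" "\<not> ?R (C g2 h2) (C 1 1)" "\<not> ?R (C 1 h2) (C g2 1)" "\<not> ?R (C g2 1) (C 1 h2)"
    using signs by (intro ctri_opposite[OF frame]; simp)+
  ultimately show ?thesis
    unfolding theta_def Ks_def[symmetric] L prod.case by (rule cyclic_alternating_sum)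
qed

lemma value_from_eq:
  assumes "GH g h" "q \<in> poly2 r" "\<And>z. z \<in> Q g h \<Longrightarrow> f z = q z"
  shows "value_from (C g h) f (m e) = q (m e)"
proof -
  have "m e \<in> closure (Q g h)" using closure_Q GH_nonzero[OF assms(1)] m_in_C by simp
  moreover have "m e \<notin> Q g h" by (simp add: quad_def)
  ultimately have nt: "m e islimpt Q g h" by (simp add: closure_def)
  have "(q \<longlongrightarrow> q (m e)) (at (m e) within Q g h)"
    using poly2_continuous[OF assms(2), of UNIV] by (simp add: continuous_on_eq_continuous_at isCont_def tendsto_within_subset[of _ _ _ UNIV])
  then have "(f \<longlongrightarrow> q (m e)) (at (m e) within Q g h)"
    by (rule Lim_transform_eventually) (auto simp: eventually_at_filter assms(3))
  then show ?thesis
    unfolding value_from_def using interior_C'[of g h] assms(1) nt by (simp add: tendsto_Lim trivial_limit_within)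
qed

lemma partial_frame:
  assumes "q \<in> poly2 r"
  shows "partial i q z = X $ i * (partial 1 q z * s $ 1 + partial 2 q z * s $ 2) + Y $ i * (partial 1 q z * t $ 1 + partial 2 q z * t $ 2)"
proof -
  have "axis i 1 = (X $ i) *\<^sub>R s + (Y $ i) *\<^sub>R t" using coords[of "axis i 1"] by (simp add: inner_axis)
  from arg_cong[OF this, of "\<lambda>v. v $ _"]
  have "(axis i 1 :: pt) $ j = X $ i * s $ j + Y $ i * t $ j" for j
    by (simp only: vector_add_component vector_scaleR_component real_scaleR_def)
  moreover have "partial i q z = partial 1 q z * (axis i 1 :: pt) $ 1 + partial 2 q z * (axis i 1 :: pt) $ 2"
    using exhaust_2[of i] by (auto simp: axis_def)
  ultimately show ?thesis by (simp add: algebra_simps)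
qed

lemma hat_C:
  assumes "GH g h" "z \<in> C g h" "g * (X \<bullet> (z - m e)) + h * (Y \<bullet> (z - m e)) < 1"
  shows "0 < hat X Y (m e) 1 g2 1 h2 z"
proof -
  have *: "max (u * r) (v * r) = a * r" if "a = u \<or> a = v" "0 \<le> a * r" "0 < u" "v < 0" for a u v r :: real
    using that by (auto simp: zero_le_mult_iff max_def mult_le_cancel_right)
  have "max (1 * (X \<bullet> (z - m e))) (g2 * (X \<bullet> (z - m e))) = g * (X \<bullet> (z - m e))"
    using assms(1,2) signs unfolding ctri_def by (intro *) blast+
  moreover have "max (1 * (Y \<bullet> (z - m e))) (h2 * (Y \<bullet> (z - m e))) = h * (Y \<bullet> (z - m e))"
    using assms(1,2) signs unfolding ctri_def by (intro *) blast+
  ultimately show ?thesis using assms(3) by (simp only: hat_def)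
qed

text \<open>On two cells separated by a line the field agrees along that line, and so does its
  derivative along it at \<open>m e\<close>. Hence the derivative along \<open>s\<close> depends
  only on \<open>g\<close>, the one along \<open>t\<close> only on \<open>h\<close>, and the
  divergence at \<open>m e\<close> is a function of \<open>g\<close> plus a function of
  \<open>h\<close>.\<close>

lemma theta_divergence:
  assumes v: "\<And>i. continuous_on \<Omega> (\<lambda>z. v z $ i)"
      "\<And>K i. K \<in> ps_mesh c m \<T> \<Longrightarrow> \<exists>p\<in>poly2 k'. \<forall>z\<in>interior K. v z $ i = p z"
    and f: "\<And>K z. K \<in> ps_mesh c m \<T> \<Longrightarrow> z \<in> interior K \<Longrightarrow> f z = divergence v z"
  shows "theta (ps_mesh c m \<T>) (m e) f = 0"
proof -
  have "\<exists>q\<in>poly2 k'. \<forall>z\<in>Q g h. v z $ i = q z" if "GH g h" for g h i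
    using v(2)[OF cell_in_mesh[OF that], of i] interior_C'[of g h] that by simp
  then obtain q where q: "\<And>g h i. GH g h \<Longrightarrow> q g h i \<in> poly2 k' \<and> (\<forall>z\<in>Q g h. v z $ i = q g h i z)"
    by metis
  have qC: "v z $ i = q g h i z" if "GH g h" "z \<in> C g h" "z \<in> \<Omega>" for g h i z
    using eq_on_cell[OF v(1) cell_in_mesh[OF that(1)], of "q g h i" k' i] q[OF that(1)] interior_C'[of g h] that by blast
  let ?d = "\<lambda>w f. partial 1 f (m e) * w $ 1 + partial 2 f (m e) * w $ 2"
  define P where "P g h = partial 1 (q g h 1) (m e) + partial 2 (q g h 2) (m e)" for g h
  have val: "value_from (C g h) f (m e) = P g h" if gh: "GH g h" for g h
  proof -
    have "f z = partial 1 (q g h 1) z + partial 2 (q g h 2) z" if z: "z \<in> Q g h" for z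
    proof -
      have "f z = divergence v z" using f[OF cell_in_mesh[OF gh]] z interior_C'[of g h] gh by blast
      also have "\<dots> = partial 1 (q g h 1) z + partial 2 (q g h 2) z"
      proof -
        have "partial i (\<lambda>y. v y $ i) z = partial i (q g h i) z" for i
        proof (rule partial_cong_open(2)[OF open_quad z])
          show "v y $ i = q g h i y" if "y \<in> Q g h" for y by (rule bspec[OF conjunct2[OF q[OF gh, of i]] that])
          show "q g h i differentiable at z" using q[OF gh, of i] by (elim conjE) (rule poly2_differentiable)
        qed
        then show ?thesis unfolding divergence_def sum_2 by simp
      qed
      finally show ?thesis .
    qed
    moreover have "(\<lambda>z. partial 1 (q g h 1) z + partial 2 (q g h 2) z) \<in> poly2 (k' - 1)"
      using q[OF gh] by (intro poly2_add poly2_partial) blast+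
    ultimately show ?thesis using value_from_eq[OF gh] unfolding P_def by blast
  qed
  \<comment> \<open>Half of the common edge, whence the 2: its points have positive hat value and so
    lie in \<Omega>, where the field is continuous.\<close>
  have diff0: "?d w (q g h i) = ?d w (q g' h' i)"
    if gh: "GH g h" "GH g' h'" and r: "r \<noteq> 0"
      and w: "\<And>u. u \<in> {0..1} \<Longrightarrow> m e + u *\<^sub>R ((1 / (2 * r)) *\<^sub>R w) \<in> C g h \<inter> C g' h'"
        "\<And>u. u \<in> {0..1} \<Longrightarrow> g * (X \<bullet> (u *\<^sub>R ((1 / (2 * r)) *\<^sub>R w))) + h * (Y \<bullet> (u *\<^sub>R ((1 / (2 * r)) *\<^sub>R w))) < 1"
    for g h g' h' i r w
  proof -
    have p: "q g h i \<in> poly2 k'" "q g' h' i \<in> poly2 k'" using q gh by blast+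
    have "?d ((1 / (2 * r)) *\<^sub>R w) (\<lambda>z. q g h i z - q g' h' i z) = 0"
    proof (rule poly2_segment_zero[OF poly2_diff[OF p]])
      fix u :: real assume u: "u \<in> {0..1}"
      let ?z = "m e + u *\<^sub>R ((1 / (2 * r)) *\<^sub>R w)"
      have "0 < hat X Y (m e) 1 g2 1 h2 ?z" using w(1)[OF u] w(2)[OF u] by (intro hat_C[OF gh(1)]) simp_all
      then have "?z \<in> \<Omega>" using hat_subset_\<Omega> by blast
      then show "q g h i ?z - q g' h' i ?z = 0"
        using qC[OF gh(1), of ?z i] qC[OF gh(2), of ?z i] w(1)[OF u] by simp
    qed
    then have "(1 / (2 * r)) * (?d w (q g h i) - ?d w (q g' h' i)) = 0"
      using p by (simp add: partial_diff poly2_differentiable algebra_simps)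
    then show ?thesis using r by simp
  qed
  have ds: "?d s (q g 1 i) = ?d s (q g h2 i)" if "g \<in> {1, g2}" for g i
    by (rule diff0[of g 1 g h2 g]) (use that frame signs in \<open>auto simp: ctri_def\<close>)
  have dt: "?d t (q 1 h i) = ?d t (q g2 h i)" if "h \<in> {1, h2}" for h i
    by (rule diff0[of 1 h g2 h h]) (use that frame signs in \<open>auto simp: ctri_def\<close>)
  have P: "P g h = (X $ 1 * ?d s (q g h 1) + Y $ 1 * ?d t (q g h 1)) + (X $ 2 * ?d s (q g h 2) + Y $ 2 * ?d t (q g h 2))" if "GH g h" for g h
    unfolding P_def using partial_frame[of "q g h 1" k' 1 "m e"] partial_frame[of "q g h 2" k' 2 "m e"] q[OF that] by simp
  have "P 1 1 - P 1 h2 + P g2 h2 - P g2 1 = 0"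
    using ds[of 1] ds[of g2] dt[of 1] dt[of h2] by (simp add: P)
  then show ?thesis unfolding theta_eq by (simp add: val)
qed

text \<open>The two indicators supply the constant 1 that \<open>cross\<close> asks for, and
  \<open>theta\<close> the condition of \<open>all_poly\<close>.\<close>

lemma edge_part_divs:
  assumes ind: "ind T e \<in> divs k" "ind T' e \<in> divs k"
    and q: "\<And>K. K \<in> ps_mesh c m \<T> \<Longrightarrow> \<exists>q\<in>poly2 (k - 1). \<forall>z\<in>interior K. p z = q z"
    and \<theta>: "theta (ps_mesh c m \<T>) (m e) p = 0"
  shows "(\<lambda>z. p z * (ind T e z + ind T' e z)) \<in> divs k"
proof -
  have "\<exists>q\<in>poly2 (k - 1). \<forall>z\<in>Q g h. p z = q z" if "GH g h" for g h
    using q[OF cell_in_mesh[OF that]] interior_C'[of g h] that by simp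
  then obtain q where q: "\<And>g h. GH g h \<Longrightarrow> q g h \<in> poly2 (k - 1) \<and> (\<forall>z\<in>Q g h. p z = q g h z)" by metis
  have val: "value_from (C g h) p (m e) = q g h (m e)" if "GH g h" for g h
    using value_from_eq[OF that, of "q g h" "k - 1" p] q[OF that] by blast
  have "\<bar>q 1 1 (m e) - q 1 h2 (m e) + q g2 h2 (m e) - q g2 1 (m e)\<bar> = 0"
    using \<theta> unfolding theta_eq by (simp add: val)
  then have alt: "q 1 1 (m e) - q 1 h2 (m e) + q g2 h2 (m e) - q g2 1 (m e) = 0" by simp
  have one: "E.pw (\<lambda>g h z. 1) \<in> divs k"
    by (rule divs_cong[OF divs_add[OF ind]]) (use pw_ind[of _ _ "\<lambda>g h z. 1" 1 1] in auto)
  have "q \<in> {F. E.pw F \<in> divs k}"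
    by (rule cross.all_poly[OF E.cross[OF one], where n = "k - 1"]) (use q k alt in auto)
  then have "E.pw q \<in> divs k" by simp
  then show ?thesis
  proof (rule divs_cong)
    fix K z assume K: "K \<in> ps_mesh c m \<T>" "z \<in> interior K"
    have qz: "q g h z = p z" if "GH g h" "z \<in> Q g h" for g h
      using bspec[OF conjunct2[OF q[OF that(1)]] that(2)] by (rule sym)
    have "E.pw q z = p z * ind T e z + p z * ind T' e z"
    proof (rule pw_ind[OF K])
      show "q 1 h z = p z" if "h \<in> {1, h2}" "z \<in> Q 1 h" for h using qz that by blast
      show "q g2 h z = p z" if "h \<in> {1, h2}" "z \<in> Q g2 h" for h using qz that by blast
    qed
    then show "E.pw q z = p z * (ind T e z + ind T' e z)" by (simp add: distrib_left)
  qed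
qed

end

section \<open>Surjectivity of the divergence\<close>

context ps_refinement
begin

text \<open>The decomposition runs over edges, not over pairs of a triangle and an edge: the
  alternating sum couples the two sides of a shared edge, which have to be treated together.\<close>

theorem divs_surjective:
  assumes k: "1 \<le> k"
    and q: "\<And>K. K \<in> ps_mesh c m \<T> \<Longrightarrow> \<exists>q\<in>poly2 (k - 1). \<forall>z\<in>interior K. p z = q z"
    and \<theta>: "\<And>z. z \<in> ps_edge_points m \<T> \<inter> \<Omega> \<Longrightarrow> theta (ps_mesh c m \<T>) z p = 0"
  shows "p \<in> divs k"
proof -
  define E where "E = (\<Union>T\<in>\<T>. {e. e edge_of T})"
  define N where "N e = {T \<in> \<T>. e edge_of T}" for e
  have finE: "finite E" unfolding E_def using finite_mesh finite_edges by blast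
  have finN: "finite (N e)" for e unfolding N_def using finite_mesh by simp
  have part: "(\<lambda>z. p z * (\<Sum>T\<in>N e. ind T e z)) \<in> divs k" if "e \<in> E" for e
  proof -
    obtain T where T: "T \<in> \<T>" "e edge_of T" using \<open>e \<in> E\<close> by (auto simp: E_def)
    show ?thesis
    proof (cases "\<exists>T'\<in>\<T>. T' \<noteq> T \<and> e edge_of T'")
      case True
      then obtain T' where T': "T' \<in> \<T>" "T' \<noteq> T" "e edge_of T'" by blast
      obtain a b s t Y \<beta> \<alpha> where "shared_edge \<Omega> \<T> c m T e a b s t Y \<beta> k T' \<alpha>"
        using shared_edge_exists[OF T k T'] by blast
      then interpret S: shared_edge \<Omega> \<T> c m T e a b s t Y \<beta> k T' \<alpha> .
      have N: "N e = {T, T'}" using S.only_two T T' by (auto simp: N_def)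
      have "m e \<in> ps_edge_points m \<T> \<inter> \<Omega>" using S.m_in_\<Omega> T by (auto simp: ps_edge_points_def)
      then show ?thesis
        using S.edge_part_divs[OF ind_divs[OF T k] ind_divs[OF T'(1,3) k] q \<theta>] T'(2) unfolding N by simp
    next
      case False
      then obtain a b s t Y \<beta> where "boundary_edge \<Omega> \<T> c m T e a b s t Y \<beta> k"
        using boundary_edge_exists[OF T k] by blast
      then interpret S: boundary_edge \<Omega> \<T> c m T e a b s t Y \<beta> k .
      have N: "N e = {T}" using False T by (auto simp: N_def)
      show ?thesis using S.edge_part_divs[OF ind_divs[OF T k] q] unfolding N by simp
    qed
  qed
  show ?thesis
  proof (rule divs_cong[OF divs_sum[OF finE part]])
    fix K z assume "K \<in> ps_mesh c m \<T>" and z: "z \<in> interior K"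
    then obtain T0 e0 d where K: "T0 \<in> \<T>" "e0 edge_of T0" "d extreme_point_of e0" "K = convex hull {c T0, d, m e0}"
      by (elim ps_meshE)
    have "(\<Sum>T\<in>N e. ind T e z) = (if e = e0 then 1 else 0)" if "e \<in> E" for e
    proof -
      have "(\<Sum>T\<in>N e. ind T e z) = (\<Sum>T\<in>N e. if T = T0 then (if e = e0 then 1 else 0) else 0)"
        using ind_split[OF _ _ K(1-3), of _ _ z] z K(4) by (intro sum.cong) (auto simp: N_def)
      also have "\<dots> = (if e = e0 then 1 else 0)"
        using finN K(1,2) by (auto simp: N_def)
      finally show ?thesis .
    qed
    then have "(\<Sum>e\<in>E. p z * (\<Sum>T\<in>N e. ind T e z)) = (\<Sum>e\<in>E. if e = e0 then p z else 0)"
      by (intro sum.cong) auto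
    also have "\<dots> = p z" using finE K(1,2) by (auto simp: E_def)
    finally show "(\<Sum>e\<in>E. p z * (\<Sum>T\<in>N e. ind T e z)) = p z" .
  qed
qed

end


lemma continuous_on_vec_components:
  fixes v :: "'a::topological_space \<Rightarrow> real^'n"
  assumes "\<And>i. continuous_on S (\<lambda>z. v z $ i)" shows "continuous_on S v"
  unfolding continuous_on_def
proof (intro ballI vec_tendstoI)
  fix x i assume "x \<in> S"
  then show "((\<lambda>z. v z $ i) \<longlongrightarrow> v x $ i) (at x within S)" using assms[of i] by (simp add: continuous_on_def)
qed

lemma continuous_on_component: "continuous_on S v \<Longrightarrow> continuous_on S (\<lambda>z. v z $ i)"
  unfolding continuous_on_def by (auto intro: tendsto_vec_nth)

lemma rot_components: "rot q z $ 1 = partial 2 q z" "rot q z $ 2 = - partial 1 q z"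
  by (simp_all add: rot_def)

lemma partial_const: "partial i (\<lambda>_. a) x = 0"
  using has_derivative_imp_partial[OF has_derivative_const] .

lemma rot_const: "rot (\<lambda>_. a) = (\<lambda>_. 0)"
  by (auto simp: fun_eq_iff vec_eq_iff forall_2 rot_components partial_const)

context ps_refinement
begin

section \<open>Exactness\<close>

lemma \<Omega>_lebesgue: "\<Omega> \<in> sets lebesgue" using open_\<Omega> by simp

lemma T_lebesgue: "T \<in> \<T> \<Longrightarrow> T \<in> sets lebesgue"
  using closed_T by simp

lemma convex_K: "K \<in> ps_mesh c m \<T> \<Longrightarrow> convex K"
  by (elim ps_meshE) simp

lemma interior_K_nonempty: "K \<in> ps_mesh c m \<T> \<Longrightarrow> interior K \<noteq> {}"
  using closure_interior_K[of K] by (metis closure_empty convex_hull_eq_empty empty_not_insert ps_meshE)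

lemma split_in_mesh: "T \<in> \<T> \<Longrightarrow> K \<in> ps_split c m T \<Longrightarrow> K \<in> ps_mesh c m \<T>"
  unfolding ps_mesh_def by (rule UN_I)

lemma split_interior:
  assumes "T \<in> \<T>" "K \<in> ps_split c m T" shows "interior K \<subseteq> interior T"
proof (rule interior_mono)
  show "K \<subseteq> T" using assms(2) split_covers[OF assms(1)] by blast
qed

lemma mesh_splitE:
  assumes "K \<in> ps_mesh c m \<T>" obtains T where "T \<in> \<T>" "K \<in> ps_split c m T"
  using assms unfolding ps_mesh_def by (elim UN_E)

lemma T_\<Omega>_closure: "T \<in> \<T> \<Longrightarrow> interior T \<subseteq> T \<inter> \<Omega>" "T \<in> \<T> \<Longrightarrow> T \<inter> \<Omega> \<subseteq> closure (interior T)"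
  using interior_subset_\<Omega> interior_subset closure_interior_T by blast+

lemma negligible_skeleton: "negligible (closure \<Omega> - (\<Union>K\<in>ps_mesh c m \<T>. interior K))"
proof (rule negligible_subset)
  show "negligible (\<Union>(frontier ` ps_mesh c m \<T>))"
    using finite_ps_mesh convex_K negligible_convex_frontier by (intro negligible_Union) auto
  show "closure \<Omega> - (\<Union>K\<in>ps_mesh c m \<T>. interior K) \<subseteq> \<Union>(frontier ` ps_mesh c m \<T>)"
  proof
    fix z assume z: "z \<in> closure \<Omega> - (\<Union>K\<in>ps_mesh c m \<T>. interior K)"
    then obtain K where K: "K \<in> ps_mesh c m \<T>" "z \<in> K" using ps_mesh_covers by blast
    then have "z \<in> frontier K" using z closure_subset by (auto simp: frontier_def)
    then show "z \<in> \<Union>(frontier ` ps_mesh c m \<T>)" using K by blast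
  qed
qed

lemma AE_meshI:
  assumes "S \<in> sets lebesgue" "S \<subseteq> closure \<Omega>"
    "\<And>K z. K \<in> ps_mesh c m \<T> \<Longrightarrow> z \<in> interior K \<Longrightarrow> z \<in> S \<Longrightarrow> P z"
  shows "AE z in lebesgue_on S. P z"
  unfolding AE_lebesgue_on_iff_negligible[OF assms(1)]
  by (rule negligible_subset[OF negligible_skeleton]) (use assms(2,3) in blast)

lemma T_subset: "T \<in> \<T> \<Longrightarrow> T \<subseteq> closure \<Omega>" using Union_mesh by blast

lemma AE_T_interiorI:
  assumes T: "T \<in> \<T>" and P: "\<And>z. z \<in> interior T \<Longrightarrow> P z"
  shows "AE z in lebesgue_on T. P z"
  unfolding AE_lebesgue_on_iff_negligible[OF T_lebesgue[OF T]]
proof (rule negligible_subset[OF negligible_convex_frontier[OF convex_T[OF T]]])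
  show "{z \<in> T. \<not> P z} \<subseteq> frontier T" using P closed_T[OF T] by (auto simp: frontier_def)
qed

lemma AE_continuous_eq:
  fixes f g :: "pt \<Rightarrow> 'b::t2_space"
  assumes "AE z in lebesgue_on S. f z = g z" "S \<in> sets lebesgue" "open U" "U \<subseteq> S"
    "continuous_on U f" "continuous_on U g" "z \<in> U"
  shows "f z = g z"
proof (rule continuous_eq_of_negligible[OF assms(3,5,6) _ assms(7)])
  show "negligible {x \<in> U. f x \<noteq> g x}"
    using assms(1) unfolding AE_lebesgue_on_iff_negligible[OF assms(2)]
    by (rule negligible_subset) (use assms(4) in blast)
qed

section \<open>Criteria for membership in the global spaces\<close>

definition pieces :: "nat \<Rightarrow> (pt \<Rightarrow> real) \<Rightarrow> bool" where
  "pieces k f \<longleftrightarrow> (\<forall>K\<in>ps_mesh c m \<T>. \<exists>p\<in>poly2 k. \<forall>z\<in>interior K. f z = p z)"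

lemma piecesE:
  assumes "pieces k f" "K \<in> ps_mesh c m \<T>"
  shows "\<exists>p. p \<in> poly2 k \<and> (\<forall>z\<in>interior K. f z = p z)"
  using assms unfolding pieces_def by blast

lemma pieces_V2:
  assumes "\<And>T. T \<in> \<T> \<Longrightarrow> \<exists>w\<in>V2 k (ps_split c m T). \<forall>z\<in>T \<inter> \<Omega>. f z = w z"
  shows "pieces k f"
  unfolding pieces_def
proof
  fix K assume "K \<in> ps_mesh c m \<T>"
  then obtain T where T: "T \<in> \<T>" "K \<in> ps_split c m T" by (rule mesh_splitE)
  obtain w where w: "w \<in> V2 k (ps_split c m T)" "\<forall>z\<in>T \<inter> \<Omega>. f z = w z" using assms[OF T(1)] by blast
  obtain p where p: "p \<in> poly2 k" "\<forall>z\<in>interior K. w z = p z" using w(1) T(2) unfolding V2_def by blast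
  have "f z = p z" if "z \<in> interior K" for z
  proof -
    have "z \<in> T \<inter> \<Omega>" using that split_interior[OF T] T_\<Omega>_closure(1)[OF T(1)] by blast
    then show ?thesis using w(2) p(2) that by simp
  qed
  then show "\<exists>p\<in>poly2 k. \<forall>z\<in>interior K. f z = p z" using p(1) by blast
qed

lemma V2_pieces: "pieces k f \<Longrightarrow> T \<in> \<T> \<Longrightarrow> f \<in> V2 k (ps_split c m T)"
  unfolding V2_def pieces_def using split_in_mesh by blast

lemma pieces_on_T:
  assumes "pieces k f" "T \<in> \<T>" "\<And>z. z \<in> interior T \<Longrightarrow> w z = f z"
  shows "w \<in> V2 k (ps_split c m T)"
  unfolding V2_def
proof (intro CollectI ballI)
  fix K assume K: "K \<in> ps_split c m T"
  obtain p where "p \<in> poly2 k" "\<And>z. z \<in> interior K \<Longrightarrow> f z = p z"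
    using piecesE[OF assms(1) split_in_mesh[OF assms(2) K]] by blast
  then show "\<exists>p\<in>poly2 k. \<forall>z\<in>interior K. w z = p z"
    using assms(3) split_interior[OF assms(2) K] by (intro bexI[of _ p]) auto
qed

lemma pieces_differentiable:
  assumes "pieces k f" "K \<in> ps_mesh c m \<T>" "z \<in> interior K" shows "f differentiable (at z)"
proof -
  obtain p where "p \<in> poly2 k" "\<And>z. z \<in> interior K \<Longrightarrow> f z = p z" using piecesE[OF assms(1,2)] by blast
  then show ?thesis using partial_cong_open(1)[OF open_interior assms(3), of f p] poly2_differentiable by blast
qed

lemma pieces_divergence:
  assumes "\<And>i. pieces k (\<lambda>z. v z $ i)" shows "pieces (k - 1) (divergence v)"
  unfolding pieces_def
proof
  fix K assume K: "K \<in> ps_mesh c m \<T>"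
  obtain p1 where p1: "p1 \<in> poly2 k" "\<And>z. z \<in> interior K \<Longrightarrow> v z $ 1 = p1 z" using piecesE[OF assms[of 1] K] by blast
  obtain p2 where p2: "p2 \<in> poly2 k" "\<And>z. z \<in> interior K \<Longrightarrow> v z $ 2 = p2 z" using piecesE[OF assms[of 2] K] by blast
  have "divergence v z = partial 1 p1 z + partial 2 p2 z" if z: "z \<in> interior K" for z
  proof -
    have "partial 1 (\<lambda>y. v y $ 1) z = partial 1 p1 z"
      by (rule partial_cong_open(2)[OF open_interior z _ poly2_differentiable[OF p1(1)]]) (rule p1(2))
    moreover have "partial 2 (\<lambda>y. v y $ 2) z = partial 2 p2 z"
      by (rule partial_cong_open(2)[OF open_interior z _ poly2_differentiable[OF p2(1)]]) (rule p2(2))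
    ultimately show ?thesis by (simp add: divergence_def sum_2)
  qed
  moreover have "(\<lambda>z. partial 1 p1 z + partial 2 p2 z) \<in> poly2 (k - 1)"
    using p1 p2 by (intro poly2_add poly2_partial)
  ultimately show "\<exists>p\<in>poly2 (k - 1). \<forall>z\<in>interior K. divergence v z = p z"
    by (intro bexI[of _ "\<lambda>z. partial 1 p1 z + partial 2 p2 z"] ballI) simp_all
qed

lemma pieces_continuous:
  assumes "pieces k f" "K \<in> ps_mesh c m \<T>" shows "continuous_on (interior K) f"
proof -
  obtain p where "p \<in> poly2 k" "\<And>z. z \<in> interior K \<Longrightarrow> f z = p z" using piecesE[OF assms] by blast
  then show ?thesis using poly2_continuous[of p k "interior K"] by (simp cong: continuous_on_cong)
qed

lemma divergence_cong_open:
  assumes "open U" "z \<in> U" "\<And>y. y \<in> U \<Longrightarrow> v y = w y" "\<And>i. (\<lambda>y. w y $ i) differentiable (at z)"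
  shows "divergence v z = divergence w z"
proof -
  have "partial i (\<lambda>y. v y $ i) z = partial i (\<lambda>y. w y $ i) z" for i
    by (rule partial_cong_open(2)[OF assms(1,2) _ assms(4)]) (simp only: assms(3))
  then show ?thesis unfolding divergence_def by (simp only:)
qed

text \<open>The third part records what \<open>restricts_to\<close> says on the frontier of
  \<Omega>: \<open>T \<inter> \<Omega>\<close> need not be closed, so an extension to
  \<open>T\<close> is carried along.\<close>

lemma L1_psD:
  assumes "v \<in> L1_ps \<Omega> \<T> c m k"
  shows "continuous_on \<Omega> v" "\<And>i. pieces k (\<lambda>z. v z $ i)"
    "\<And>T. T \<in> \<T> \<Longrightarrow> \<exists>w. continuous_on T w \<and> (\<forall>z\<in>T \<inter> \<Omega>. v z = w z)"
proof -
  show "continuous_on \<Omega> v" using assms by (simp add: L1_ps_def)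
  have *: "\<exists>w\<in>L1 k T (ps_split c m T). \<forall>z\<in>T \<inter> \<Omega>. v z = w z" if "T \<in> \<T>" for T
    using assms that by (simp add: L1_ps_def restricts_to_def)
  show "pieces k (\<lambda>z. v z $ i)" for i
  proof (rule pieces_V2)
    fix T assume "T \<in> \<T>"
    then obtain w where "w \<in> L1 k T (ps_split c m T)" "\<forall>z\<in>T \<inter> \<Omega>. v z = w z" using * by blast
    then show "\<exists>w\<in>V2 k (ps_split c m T). \<forall>z\<in>T \<inter> \<Omega>. v z $ i = w z"
      by (intro bexI[of _ "\<lambda>z. w z $ i"]) (auto simp: L1_def L0_def)
  qed
  fix T assume "T \<in> \<T>"
  then obtain w where "w \<in> L1 k T (ps_split c m T)" "\<forall>z\<in>T \<inter> \<Omega>. v z = w z" using * by blast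
  then show "\<exists>w. continuous_on T w \<and> (\<forall>z\<in>T \<inter> \<Omega>. v z = w z)"
    by (intro exI[of _ w]) (auto simp: L1_def L0_def intro: continuous_on_vec_components)
qed

lemma L1_psI:
  assumes "continuous_on \<Omega> v" "\<And>i. pieces k (\<lambda>z. v z $ i)"
    "\<And>T. T \<in> \<T> \<Longrightarrow> \<exists>w. continuous_on T w \<and> (\<forall>z\<in>T \<inter> \<Omega>. v z = w z)"
  shows "v \<in> L1_ps \<Omega> \<T> c m k"
  unfolding L1_ps_def restricts_to_def
proof (intro CollectI conjI ballI)
  fix T assume T: "T \<in> \<T>"
  then obtain w where w: "continuous_on T w" "\<forall>z\<in>T \<inter> \<Omega>. v z = w z" using assms(3) by blast
  have "w \<in> L1 k T (ps_split c m T)"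
    unfolding L1_def L0_def
  proof (intro CollectI allI conjI)
    fix i show "(\<lambda>z. w z $ i) \<in> V2 k (ps_split c m T)"
    proof (rule pieces_on_T[OF assms(2)[of i] T])
      fix z assume "z \<in> interior T"
      then have "z \<in> T \<inter> \<Omega>" using T_\<Omega>_closure(1)[OF T] by blast
      then show "w z $ i = v z $ i" using w(2) by simp
    qed
    show "continuous_on T (\<lambda>z. w z $ i)" using w(1) by (rule continuous_on_component)
  qed
  then show "\<exists>w\<in>L1 k T (ps_split c m T). \<forall>z\<in>T \<inter> \<Omega>. v z = w z" using w(2) by blast
qed (rule assms(1))

text \<open>The extra conditions follow from one continuous representative \<open>g\<close> of the
  divergence that extends to each closed triangle, because \<open>v\<close> and its extension from
  \<open>T \<inter> \<Omega>\<close> have the same divergence on the open cells of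
  \<open>T\<close>.\<close>

lemma S1_psI:
  assumes v: "v \<in> L1_ps \<Omega> \<T> c m k" and g: "continuous_on \<Omega> g" "\<And>K z. K \<in> ps_mesh c m \<T> \<Longrightarrow> z \<in> interior K \<Longrightarrow> g z = divergence v z"
    and ext: "\<And>T. T \<in> \<T> \<Longrightarrow> \<exists>w. continuous_on T w \<and> (\<forall>z\<in>T \<inter> \<Omega>. g z = w z)"
  shows "v \<in> S1_ps \<Omega> \<T> c m k"
  unfolding S1_ps_def restricts_to_def
proof (intro CollectI conjI ballI)
  show "continuous_on \<Omega> v" using v by (simp add: L1_ps_def)
  have "g \<in> ae_class \<Omega> (divergence v)"
    unfolding ae_class_def by (intro CollectI AE_meshI \<Omega>_lebesgue closure_subset g(2))
  then show "ae_continuous_on \<Omega> (divergence v)" unfolding ae_continuous_on_def using g(1) by blast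
  fix T assume T: "T \<in> \<T>"
  obtain w where w: "w \<in> L1 k T (ps_split c m T)" "\<forall>z\<in>T \<inter> \<Omega>. v z = w z"
    using v T by (auto simp: L1_ps_def restricts_to_def)
  obtain g' where g': "continuous_on T g'" "\<forall>z\<in>T \<inter> \<Omega>. g z = g' z" using ext[OF T] by blast
  have "g' \<in> ae_class T (divergence w)"
    unfolding ae_class_def
  proof (intro CollectI AE_meshI T_lebesgue T_subset T)
    fix K z assume K: "K \<in> ps_mesh c m \<T>" "z \<in> interior K" "z \<in> T"
    obtain T' where T': "T' \<in> \<T>" "K \<in> ps_split c m T'" using mesh_splitE[OF K(1)] .
    then have "z \<in> interior T'" using split_interior[OF T'] K(2) by blast
    then have "T' = T" using interior_Int_empty[OF T'(1) T] K(3) by blast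
    have KT: "interior K \<subseteq> T \<inter> \<Omega>" using split_interior[OF T'] T_\<Omega>_closure(1)[OF T'(1)] unfolding \<open>T' = T\<close> by blast
    have "divergence w z = divergence v z"
    proof (rule divergence_cong_open[OF open_interior K(2)])
      show "w y = v y" if "y \<in> interior K" for y using w(2) KT that by (metis subsetD)
      show "(\<lambda>y. v y $ i) differentiable at z" for i by (rule pieces_differentiable[OF L1_psD(2)[OF v] K(1,2)])
    qed
    then show "g' z = divergence w z" using g(2)[OF K(1,2)] g'(2) KT K(2) by (metis subsetD)
  qed
  then have "w \<in> S1 k T (ps_split c m T)" unfolding S1_def ae_continuous_on_def using w(1) g'(1) by blast
  then show "\<exists>w\<in>S1 k T (ps_split c m T). \<forall>z\<in>T \<inter> \<Omega>. v z = w z" using w(2) by blast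
qed

lemma S1_ps_subset: "v \<in> S1_ps \<Omega> \<T> c m k \<Longrightarrow> v \<in> L1_ps \<Omega> \<T> c m k"
  unfolding S1_ps_def L1_ps_def restricts_to_def S1_def by blast

subsection \<open>Constants and rotations\<close>

lemma const_S0_ps: "(\<lambda>_. a) \<in> S0_ps \<Omega> \<T> c m r"
proof -
  have "(\<lambda>_. a) \<in> S0 r T (ps_split c m T)" for T
  proof -
    have "(\<lambda>_. a) \<in> V2 r (ps_split c m T)" unfolding V2_def by (auto intro!: bexI[of _ "\<lambda>_. a"])
    moreover have "(\<lambda>_. 0) \<in> ae_class T (rot (\<lambda>_. a))" by (simp add: ae_class_def rot_const)
    then have "ae_continuous_on T (rot (\<lambda>_. a))"
      unfolding ae_continuous_on_def by (intro exI[of _ "\<lambda>_. 0"] conjI continuous_on_const)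
    ultimately show ?thesis unfolding S0_def L0_def by (intro CollectI conjI continuous_on_const)
  qed
  moreover have "C1_on \<Omega> (\<lambda>_. a)"
    by (simp add: C1_on_def partial_const cong: continuous_on_cong)
  ultimately show ?thesis unfolding S0_ps_def restricts_to_def
    by (intro CollectI conjI ballI bexI[of _ "\<lambda>_. a"]) simp_all
qed

lemma S0_ps_rot_continuous: "q \<in> S0_ps \<Omega> \<T> c m r \<Longrightarrow> continuous_on \<Omega> (rot q)"
proof (rule continuous_on_vec_components)
  fix i assume "q \<in> S0_ps \<Omega> \<T> c m r"
  then have "continuous_on \<Omega> (partial i q)" for i by (auto simp: S0_ps_def C1_on_def)
  then show "continuous_on \<Omega> (\<lambda>z. rot q z $ i)"
    using exhaust_2[of i] continuous_on_minus[of \<Omega> "partial 1 q"] by (auto simp: rot_components)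
qed

text \<open>\<open>rot q\<close> is continuous, so vanishing almost everywhere means vanishing on
  \<Omega>, which is connected.\<close>

lemma exact_constants: "exact_at \<Omega> (UNIV :: real set) (\<lambda>a _. a) (S0_ps \<Omega> \<T> c m r) rot"
  unfolding exact_at_def
proof (intro equalityI subsetI)
  fix C assume "C \<in> (\<lambda>u. ae_class \<Omega> (\<lambda>_. u)) ` (UNIV :: real set)"
  then obtain a where "C = ae_class \<Omega> (\<lambda>_. a)" by blast
  then show "C \<in> ae_class \<Omega> ` {v \<in> S0_ps \<Omega> \<T> c m r. ae_class \<Omega> (rot v) = ae_class \<Omega> (\<lambda>_. 0)}"
    by (intro image_eqI[of _ _ "\<lambda>_. a"] CollectI conjI const_S0_ps) (simp_all add: rot_const)
next
  fix C assume "C \<in> ae_class \<Omega> ` {v \<in> S0_ps \<Omega> \<T> c m r. ae_class \<Omega> (rot v) = ae_class \<Omega> (\<lambda>_. 0)}"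
  then obtain q where q: "q \<in> S0_ps \<Omega> \<T> c m r" "AE z in lebesgue_on \<Omega>. rot q z = 0" "C = ae_class \<Omega> q"
    by (auto simp: ae_class_eq_iff)
  have r: "rot q z = 0" if "z \<in> \<Omega>" for z
    by (rule AE_continuous_eq[OF q(2) \<Omega>_lebesgue open_\<Omega> _ S0_ps_rot_continuous[OF q(1)] continuous_on_const that]) simp
  have "(q has_derivative (\<lambda>_. 0)) (at z)" if z: "z \<in> \<Omega>" for z
  proof (rule partial_zeroD)
    show "q differentiable (at z)" using q(1) z by (simp add: S0_ps_def C1_on_def)
    show "partial i q z = 0" for i
      using r[OF z] rot_components[of q z] exhaust_2[of i] by (metis neg_equal_0_iff_equal zero_index)
  qed
  then have const: "q x = q y" if "x \<in> \<Omega>" "y \<in> \<Omega>" for x y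
    using has_derivative_zero_unique_connected[OF open_\<Omega> connected_\<Omega> _ that] by blast
  obtain x where "x \<in> \<Omega>" using nonempty_\<Omega> by blast
  then have "ae_class \<Omega> q = ae_class \<Omega> (\<lambda>_. q x)"
    unfolding ae_class_eq_iff by (intro AE_meshI \<Omega>_lebesgue closure_subset) (rule const)
  then show "C \<in> (\<lambda>u. ae_class \<Omega> (\<lambda>_. u)) ` (UNIV :: real set)" using q(3) by blast
qed

text \<open>The local space provides a function continuous on the closed triangle that equals the
  rotation almost everywhere; it is \<open>rot q\<close> on the interior by continuity and on
  \<open>T \<inter> \<Omega>\<close> by density. The divergence vanishes by symmetry of second
  derivatives.\<close>

lemma S0_ps_rot:
  assumes q: "q \<in> S0_ps \<Omega> \<T> c m r"
  shows "rot q \<in> L1_ps \<Omega> \<T> c m (r - 1)"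
    "K \<in> ps_mesh c m \<T> \<Longrightarrow> z \<in> interior K \<Longrightarrow> divergence (rot q) z = 0"
proof -
  have res: "\<exists>w\<in>S0 r T (ps_split c m T). \<forall>z\<in>T \<inter> \<Omega>. q z = w z" if "T \<in> \<T>" for T
    using q that by (simp add: S0_ps_def restricts_to_def)
  have "pieces r q"
    by (rule pieces_V2) (use res in \<open>auto simp: S0_def L0_def\<close>)
  have loc: "\<exists>p\<in>poly2 r. \<forall>z\<in>interior K. rot q z $ 1 = partial 2 p z \<and> rot q z $ 2 = - partial 1 p z"
    if K: "K \<in> ps_mesh c m \<T>" for K
  proof -
    obtain p where p: "p \<in> poly2 r" "\<And>z. z \<in> interior K \<Longrightarrow> q z = p z" using piecesE[OF \<open>pieces r q\<close> K] by blast
    then show ?thesis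
      using partial_cong_open(2)[OF open_interior _ p(2) poly2_differentiable[OF p(1)]]
      by (intro bexI[OF _ p(1)]) (simp add: rot_components)
  qed
  show "rot q \<in> L1_ps \<Omega> \<T> c m (r - 1)"
  proof (rule L1_psI)
    show cont: "continuous_on \<Omega> (rot q)" using S0_ps_rot_continuous[OF q] .
    show "pieces (r - 1) (\<lambda>z. rot q z $ i)" for i
      unfolding pieces_def
    proof
      fix K assume "K \<in> ps_mesh c m \<T>"
      then obtain p where p: "p \<in> poly2 r" "\<forall>z\<in>interior K. rot q z $ 1 = partial 2 p z \<and> rot q z $ 2 = - partial 1 p z"
        using loc by blast
      show "\<exists>p\<in>poly2 (r - 1). \<forall>z\<in>interior K. rot q z $ i = p z"
      proof (cases "i = 1")
        case True
        then show ?thesis using p(2) poly2_partial[OF p(1), of 2] by (intro bexI[of _ "partial 2 p"]) auto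
      next
        case False
        then have "i = 2" using exhaust_2[of i] by auto
        then show ?thesis using p(2) poly2_uminus[OF poly2_partial[OF p(1), of 1]]
          by (intro bexI[of _ "\<lambda>z. - partial 1 p z"]) auto
      qed
    qed
    fix T assume T: "T \<in> \<T>"
    obtain w where w: "w \<in> S0 r T (ps_split c m T)" "\<forall>z\<in>T \<inter> \<Omega>. q z = w z" using res[OF T] by blast
    obtain g where g: "continuous_on T g" "AE z in lebesgue_on T. g z = rot w z"
      using w(1) by (auto simp: S0_def ae_continuous_on_def ae_class_def)
    have qw: "rot w z = rot q z" if z: "z \<in> interior T" for z
    proof -
      have wq: "w y = q y" if "y \<in> interior T" for y using w(2) T_\<Omega>_closure(1)[OF T] that by (metis subsetD)
      have "q differentiable (at z)" using q z T_\<Omega>_closure(1)[OF T] by (auto simp: S0_ps_def C1_on_def)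
      then have "partial i w z = partial i q z" for i
        by (intro partial_cong_open(2)[OF open_interior z]) (rule wq)
      then show ?thesis by (simp add: rot_def)
    qed
    have cq: "continuous_on (interior T) (rot q)" using cont interior_subset_\<Omega>[OF T] by (rule continuous_on_subset)
    have gq: "g z = rot q z" if z: "z \<in> interior T" for z
      unfolding qw[OF z, symmetric]
    proof (rule AE_continuous_eq[OF g(2) T_lebesgue[OF T] open_interior interior_subset _ _ z])
      show "continuous_on (interior T) g" using g(1) interior_subset by (rule continuous_on_subset)
      show "continuous_on (interior T) (rot w)" using cq by (simp cong: continuous_on_cong add: qw)
    qed
    have "rot q z = g z" if "z \<in> T \<inter> \<Omega>" for z
    proof (rule continuous_agree_on_closure[OF _ _ T_\<Omega>_closure(1,2)[OF T] _ that])
      show "continuous_on (T \<inter> \<Omega>) (rot q)" "continuous_on (T \<inter> \<Omega>) g"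
        using cont g(1) by (auto intro: continuous_on_subset)
    qed (simp add: gq)
    then show "\<exists>w. continuous_on T w \<and> (\<forall>z\<in>T \<inter> \<Omega>. rot q z = w z)" using g(1) by blast
  qed
  show "divergence (rot q) z = 0" if K: "K \<in> ps_mesh c m \<T>" and z: "z \<in> interior K"
  proof -
    obtain p where p: "p \<in> poly2 r" "\<forall>z\<in>interior K. rot q z $ 1 = partial 2 p z \<and> rot q z $ 2 = - partial 1 p z"
      using loc[OF K] by blast
    have p1: "partial 1 p \<in> poly2 (r - 1)" and p2: "partial 2 p \<in> poly2 (r - 1)" using poly2_partial[OF p(1)] by auto
    have "partial 1 (\<lambda>y. rot q y $ 1) z = partial 1 (partial 2 p) z"
      using p(2) by (intro partial_cong_open(2)[OF open_interior z] poly2_differentiable[OF p2]) auto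
    moreover have "partial 2 (\<lambda>y. rot q y $ 2) z = partial 2 (\<lambda>y. - 1 * partial 1 p y) z"
      using p(2) by (intro partial_cong_open(2)[OF open_interior z] poly2_differentiable[OF poly2_cmult[OF p1]]) auto
    moreover have "partial 2 (\<lambda>y. - 1 * partial 1 p y) z = - 1 * partial 2 (partial 1 p) z"
      by (rule partial_cmult[OF poly2_differentiable[OF p1]])
    ultimately show ?thesis using poly2_partial_commute[OF p(1), of z] by (simp add: divergence_def sum_2)
  qed
qed

end


context ps_refinement
begin

subsection \<open>Divergence-free fields are rotations\<close>

text \<open>The differential that a potential must have: \<open>rot q = v\<close> prescribes this as
  the derivative of \<open>q\<close> at \<open>z\<close> along \<open>h\<close>.\<close>

definition dform :: "(pt \<Rightarrow> pt) \<Rightarrow> pt \<Rightarrow> pt \<Rightarrow> real" where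
  "dform v z h = - v z $ 2 * h $ 1 + v z $ 1 * h $ 2"

lemma bounded_linear_dform: "bounded_linear (dform v z)"
  unfolding dform_def
  by (intro bounded_linear_add bounded_linear_const_mult bounded_linear_vec_nth)

lemma zero_derivative_convex:
  fixes f :: "pt \<Rightarrow> real"
  assumes "convex S" "\<And>z. z \<in> S \<Longrightarrow> (f has_derivative (\<lambda>_. 0)) (at z)" "x \<in> S" "y \<in> S"
  shows "f x = f y"
proof -
  have "\<exists>c. \<forall>x\<in>S. f x = c"
    by (rule has_derivative_zero_constant[OF assms(1)]) (rule has_derivative_at_withinI[OF assms(2)])
  then show ?thesis using assms(3,4) by metis
qed

text \<open>The finitely many closed cells avoiding \<open>x\<close> stay away from it. Since every
  cell met by the ball contains the centre, convexity keeps the segment from the centre to a point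
  of a cell in that cell.\<close>

lemma isolating_ball:
  assumes "x \<in> \<Omega>"
  shows "\<exists>\<epsilon>. 0 < \<epsilon> \<and> ball x \<epsilon> \<subseteq> \<Omega> \<and> (\<forall>K\<in>ps_mesh c m \<T>. K \<inter> ball x \<epsilon> \<noteq> {} \<longrightarrow> x \<in> K)"
proof -
  let ?U = "\<Omega> - \<Union>{K \<in> ps_mesh c m \<T>. x \<notin> K}"
  have "closed K" if "K \<in> ps_mesh c m \<T>" for K using closed_closure[of "interior K"] unfolding closure_interior_K[OF that] .
  then have "open ?U" using open_\<Omega> finite_ps_mesh by (intro open_Diff closed_Union) auto
  moreover have "x \<in> ?U" using assms by blast
  ultimately obtain \<epsilon> where e: "0 < \<epsilon>" "ball x \<epsilon> \<subseteq> ?U" by (rule openE)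
  have "x \<in> K" if K: "K \<in> ps_mesh c m \<T>" "K \<inter> ball x \<epsilon> \<noteq> {}" for K
  proof (rule ccontr)
    assume "x \<notin> K"
    then have "K \<inter> ?U = {}" using K(1) by blast
    then show False using K(2) e(2) by blast
  qed
  then show ?thesis using e by blast
qed

lemma contraction_exists:
  assumes "simply_connected \<Omega>"
  obtains H :: "real \<times> pt \<Rightarrow> pt" and a where "continuous_on ({0..1} \<times> \<Omega>) H" "H ` ({0..1} \<times> \<Omega>) \<subseteq> \<Omega>"
    "\<And>x. x \<in> \<Omega> \<Longrightarrow> H (0, x) = a" "\<And>x. x \<in> \<Omega> \<Longrightarrow> H (1, x) = x"
proof -
  obtain a where "homotopic_with_canon (\<lambda>_. True) \<Omega> \<Omega> id (\<lambda>_. a)"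
    using simply_connected_imp_contractible_pt[OF open_\<Omega> assms] by (auto simp: contractible_def)
  then have "homotopic_with_canon (\<lambda>_. True) \<Omega> \<Omega> (\<lambda>_. a) id" by (rule homotopic_with_symD)
  then obtain H :: "real \<times> pt \<Rightarrow> pt" where H: "continuous_on ({0..1} \<times> \<Omega>) H" "H \<in> {0..1} \<times> \<Omega> \<rightarrow> \<Omega>"
     "\<forall>x. H (0, x) = a" "\<forall>x. H (1, x) = x"
    unfolding homotopic_with_def by auto
  then show ?thesis using that[of H a] by auto
qed

text \<open>The potential is a polynomial on the whole plane; by continuity of \<open>v\<close> its
  derivative is the right one also at boundary points of \<open>K\<close> in \<Omega>, which the
  gluing needs.\<close>

lemma local_potentials:
  assumes v: "continuous_on \<Omega> v" "\<And>i. pieces k (\<lambda>z. v z $ i)"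
    and div: "\<forall>K\<in>ps_mesh c m \<T>. \<forall>z\<in>interior K. divergence v z = 0"
  shows "\<exists>Q. \<forall>K\<in>ps_mesh c m \<T>. Q K \<in> poly2 (Suc k) \<and> (\<forall>z\<in>K \<inter> \<Omega>. (Q K has_derivative dform v z) (at z))"
proof (rule bchoice, rule ballI)
  fix K assume K: "K \<in> ps_mesh c m \<T>"
  obtain p1 where p1: "p1 \<in> poly2 k" "\<And>z. z \<in> interior K \<Longrightarrow> v z $ 1 = p1 z" using piecesE[OF v(2)[of 1] K] by blast
  obtain p2 where p2: "p2 \<in> poly2 k" "\<And>z. z \<in> interior K \<Longrightarrow> v z $ 2 = p2 z" using piecesE[OF v(2)[of 2] K] by blast
  have "partial 1 p1 z + partial 2 p2 z = 0" if z: "z \<in> interior K" for z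
  proof -
    have "partial 1 (\<lambda>y. v y $ 1) z = partial 1 p1 z"
      by (rule partial_cong_open(2)[OF open_interior z _ poly2_differentiable[OF p1(1)]]) (rule p1(2))
    moreover have "partial 2 (\<lambda>y. v y $ 2) z = partial 2 p2 z"
      by (rule partial_cong_open(2)[OF open_interior z _ poly2_differentiable[OF p2(1)]]) (rule p2(2))
    moreover have "divergence v z = 0" using div K z by blast
    ultimately show ?thesis by (simp add: divergence_def sum_2)
  qed
  then obtain q where q: "q \<in> poly2 (Suc k)" "partial 2 q = p1" "partial 1 q = (\<lambda>x. - p2 x)"
    using poly2_potential[OF p1(1) p2(1) open_interior interior_K_nonempty[OF K]] by blast
  have "(q has_derivative dform v z) (at z)" if z: "z \<in> K \<inter> \<Omega>" for z
  proof -
    have "v z $ 1 = p1 z"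
      by (rule eq_on_cell[OF continuous_on_component[OF v(1)] K p1]) (use z in auto)
    moreover have "v z $ 2 = p2 z"
      by (rule eq_on_cell[OF continuous_on_component[OF v(1)] K p2]) (use z in auto)
    ultimately show ?thesis
      using has_derivative_partial[OF poly2_differentiable[OF q(1)], of z] q(2,3)
      by (simp add: dform_def[abs_def])
  qed
  then show "\<exists>q. q \<in> poly2 (Suc k) \<and> (\<forall>z\<in>K \<inter> \<Omega>. (q has_derivative dform v z) (at z))" using q(1) by blast
qed

lemma potential_exists:
  assumes sc: "simply_connected \<Omega>" and v: "continuous_on \<Omega> v" "\<And>i. pieces k (\<lambda>z. v z $ i)"
    and div: "\<forall>K\<in>ps_mesh c m \<T>. \<forall>z\<in>interior K. divergence v z = 0"
  shows "\<exists>q. (\<forall>z\<in>\<Omega>. (q has_derivative dform v z) (at z)) \<and> pieces (Suc k) q"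
proof -
  obtain Q where "\<forall>K\<in>ps_mesh c m \<T>. Q K \<in> poly2 (Suc k) \<and> (\<forall>z\<in>K \<inter> \<Omega>. (Q K has_derivative dform v z) (at z))"
    using local_potentials[OF v div] by blast
  then have Q: "Q K \<in> poly2 (Suc k)" and dQ: "z \<in> K \<Longrightarrow> z \<in> \<Omega> \<Longrightarrow> (Q K has_derivative dform v z) (at z)"
    if "K \<in> ps_mesh c m \<T>" for K z using that by auto
  \<comment> \<open>On a segment common to two convex cells the potentials have the same derivative,
    so their increments agree although the potentials may differ by a constant.\<close>
  have seg: "Q K y - Q K x = Q K' y - Q K' x"
    if K: "K \<in> ps_mesh c m \<T>" "K' \<in> ps_mesh c m \<T>" and xy: "x \<in> K \<inter> K'" "y \<in> K \<inter> K'" and sub: "closed_segment x y \<subseteq> \<Omega>"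
    for K K' x y
  proof -
    have KK: "closed_segment x y \<subseteq> K \<inter> K'"
      using xy convex_K[OF K(1)] convex_K[OF K(2)] by (intro closed_segment_subset convex_Int) auto
    have "(\<lambda>z. Q K z - Q K' z) x = (\<lambda>z. Q K z - Q K' z) y"
    proof (rule zero_derivative_convex[OF convex_closed_segment])
      fix z assume "z \<in> closed_segment x y"
      then have z: "z \<in> K" "z \<in> K'" "z \<in> \<Omega>" using KK sub by auto
      show "((\<lambda>z. Q K z - Q K' z) has_derivative (\<lambda>_. 0)) (at z)"
        using has_derivative_diff[OF dQ[OF K(1) z(1,3)] dQ[OF K(2) z(2,3)]] by simp
    qed auto
    then show ?thesis by simp
  qed
  have "\<exists>\<epsilon>. \<forall>x\<in>\<Omega>. 0 < \<epsilon> x \<and> ball x (\<epsilon> x) \<subseteq> \<Omega> \<and> (\<forall>K\<in>ps_mesh c m \<T>. K \<inter> ball x (\<epsilon> x) \<noteq> {} \<longrightarrow> x \<in> K)"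
    by (rule bchoice, rule ballI, rule isolating_ball)
  then obtain \<epsilon> where *: "\<forall>x\<in>\<Omega>. 0 < \<epsilon> x \<and> ball x (\<epsilon> x) \<subseteq> \<Omega> \<and> (\<forall>K\<in>ps_mesh c m \<T>. K \<inter> ball x (\<epsilon> x) \<noteq> {} \<longrightarrow> x \<in> K)"
    by (rule exE)
  have \<epsilon>: "0 < \<epsilon> x \<and> ball x (\<epsilon> x) \<subseteq> \<Omega>" if "x \<in> \<Omega>" for x using bspec[OF * that] by simp
  have meet: "x \<in> K" if "x \<in> \<Omega>" "K \<in> ps_mesh c m \<T>" "y \<in> K" "y \<in> ball x (\<epsilon> x)" for x y K
  proof -
    have "K \<inter> ball x (\<epsilon> x) \<noteq> {}" using that(3,4) by blast
    then show ?thesis using bspec[OF * that(1)] that(2) by simp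
  qed
  \<comment> \<open>Any cell containing both points will do; by \<open>seg\<close> the increment
    does not depend on it.\<close>
  define cell where "cell x y = (SOME K. K \<in> ps_mesh c m \<T> \<and> x \<in> K \<and> y \<in> K)" for x y
  define F where "F x y = Q (cell x y) y - Q (cell x y) x" for x y
  have F: "F x y = Q K y - Q K x" if x: "x \<in> \<Omega>" "y \<in> ball x (\<epsilon> x)" and K: "K \<in> ps_mesh c m \<T>" "y \<in> K" for x y K
  proof -
    have xK: "x \<in> K" using meet[OF x(1) K x(2)] .
    have "K \<in> ps_mesh c m \<T> \<and> x \<in> K \<and> y \<in> K" using K xK by simp
    then have c: "cell x y \<in> ps_mesh c m \<T> \<and> x \<in> cell x y \<and> y \<in> cell x y"
      unfolding cell_def by (rule someI)
    have "closed_segment x y \<subseteq> ball x (\<epsilon> x)" using x \<epsilon>[OF x(1)] by (intro closed_segment_subset) auto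
    then have "closed_segment x y \<subseteq> \<Omega>" using \<epsilon>[OF x(1)] by blast
    then show ?thesis unfolding F_def using c K xK by (intro seg) auto
  qed
  have dF: "(F x has_derivative dform v y) (at y)" if x: "x \<in> \<Omega>" and y: "y \<in> ball x (\<epsilon> x)" for x y
  proof -
    have y\<Omega>: "y \<in> \<Omega>" using \<epsilon>[OF x] y by blast
    let ?S = "{K \<in> ps_mesh c m \<T>. y \<in> K}"
    \<comment> \<open>The increment of \<open>F x\<close> is taken in whichever cell contains
      \<open>z\<close>. Near \<open>y\<close> this cell contains \<open>y\<close> too, so the
      estimates for the finitely many cells at \<open>y\<close> can be imposed
      simultaneously.\<close>
    have ev: "\<forall>\<^sub>F z in at y. norm (F x z - F x y - dform v y (z - y)) \<le> e * norm (z - y)" if e: "e > 0" for e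
    proof -
      have "\<forall>K\<in>?S. \<forall>\<^sub>F z in at y. norm (Q K z - Q K y - dform v y (z - y)) \<le> e * norm (z - y)"
        using dQ[OF _ _ y\<Omega>] e unfolding has_derivative_within_alt2 by blast
      then have 1: "\<forall>\<^sub>F z in at y. \<forall>K\<in>?S. norm (Q K z - Q K y - dform v y (z - y)) \<le> e * norm (z - y)"
        using finite_ps_mesh by (intro eventually_ball_finite) auto
      have "open (ball x (\<epsilon> x) \<inter> ball y (\<epsilon> y))" "y \<in> ball x (\<epsilon> x) \<inter> ball y (\<epsilon> y)" using y \<epsilon>[OF y\<Omega>] by auto
      then have 2: "\<forall>\<^sub>F z in at y. z \<in> ball x (\<epsilon> x) \<inter> ball y (\<epsilon> y)" by (rule eventually_at_in_open')
      show ?thesis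
        using 1 2
      proof eventually_elim
        case (elim z)
        then have z: "z \<in> ball x (\<epsilon> x)" "z \<in> ball y (\<epsilon> y)" by auto
        then have "z \<in> \<Omega>" using \<epsilon>[OF x] by blast
        then obtain K where K: "K \<in> ps_mesh c m \<T>" "z \<in> K" using ps_mesh_covers closure_subset by blast
        then have yK: "y \<in> K" using meet[OF y\<Omega> K z(2)] by blast
        have "F x z - F x y = Q K z - Q K y" using F[OF x z(1) K] F[OF x y K(1) yK] by simp
        then show ?case using elim(1) K(1) yK by auto
      qed
    qed
    show ?thesis unfolding has_derivative_within_alt2 using ev bounded_linear_dform by blast
  qed
  have consist: "F w p - F w q = F z p - F z q"
    if wz: "w \<in> \<Omega>" "z \<in> \<Omega>" and pq: "p \<in> ball w (\<epsilon> w) \<inter> ball z (\<epsilon> z)" "q \<in> ball w (\<epsilon> w) \<inter> ball z (\<epsilon> z)" for w z p q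
  proof -
    have "(\<lambda>y. F w y - F z y) p = (\<lambda>y. F w y - F z y) q"
    proof (rule zero_derivative_convex[OF _ _ pq])
      fix y assume "y \<in> ball w (\<epsilon> w) \<inter> ball z (\<epsilon> z)"
      then have "y \<in> ball w (\<epsilon> w)" "y \<in> ball z (\<epsilon> z)" by auto
      from has_derivative_diff[OF dF[OF wz(1) this(1)] dF[OF wz(2) this(2)]]
      show "((\<lambda>y. F w y - F z y) has_derivative (\<lambda>_. 0)) (at y)" by simp
    qed (intro convex_Int convex_ball)
    then show ?thesis by simp
  qed
  obtain H a where H: "continuous_on ({0..1::real} \<times> \<Omega>) H" "H ` ({0..1} \<times> \<Omega>) \<subseteq> \<Omega>"
    "\<And>x. x \<in> \<Omega> \<Longrightarrow> H (0, x) = a" "\<And>x. x \<in> \<Omega> \<Longrightarrow> H (1, x) = x"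
    using contraction_exists[OF sc] by metis
  obtain q where q: "\<And>x. x \<in> \<Omega> \<Longrightarrow> \<exists>\<delta>>0. \<forall>y\<in>ball x \<delta>. q y - q x = F x y - F x x"
    using glue_local_primitives[of \<Omega> \<epsilon> F H a, OF consist open_\<Omega> \<epsilon> H] by blast
  have dq: "(q has_derivative dform v x) (at x)" if x: "x \<in> \<Omega>" for x
  proof -
    obtain \<delta> where \<delta>: "\<delta> > 0" "\<And>y. y \<in> ball x \<delta> \<Longrightarrow> q y - q x = F x y - F x x" using q[OF x] by blast
    have "((\<lambda>y. F x y + (q x - F x x)) has_derivative dform v x) (at x)"
      using has_derivative_add[OF dF[OF x] has_derivative_const] \<epsilon>[OF x] by simp
    then show ?thesis
    proof (rule has_derivative_transform_within_open[OF _ open_ball])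
      show "x \<in> ball x \<delta>" using \<delta>(1) by simp
      show "F x y + (q x - F x x) = q y" if "y \<in> ball x \<delta>" for y using \<delta>(2)[OF that] by simp
    qed
  qed
  have "pieces (Suc k) q"
    unfolding pieces_def
  proof
    fix K assume K: "K \<in> ps_mesh c m \<T>"
    obtain y where y: "y \<in> interior K" using interior_K_nonempty[OF K] by blast
    have "q z = Q K z + (q y - Q K y)" if z: "z \<in> interior K" for z
    proof -
      have "(\<lambda>z. q z - Q K z) z = (\<lambda>z. q z - Q K z) y"
      proof (rule zero_derivative_convex[OF _ _ z y])
        show "convex (interior K)" using convex_K[OF K] by (rule convex_interior)
        fix z assume z: "z \<in> interior K"
        then have z': "z \<in> K" "z \<in> \<Omega>" using interior_subset interior_K_subset_\<Omega>[OF K] by blast+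
        show "((\<lambda>z. q z - Q K z) has_derivative (\<lambda>_. 0)) (at z)"
          using has_derivative_diff[OF dq[OF z'(2)] dQ[OF K z']] by simp
      qed
      then show ?thesis by simp
    qed
    then show "\<exists>p\<in>poly2 (Suc k). \<forall>z\<in>interior K. q z = p z"
      using poly2_add[OF Q[OF K] poly2_const[of "q y - Q K y"]] by (intro bexI[of _ "\<lambda>z. Q K z + (q y - Q K y)"]) auto
  qed
  then show ?thesis using dq by blast
qed

text \<open>What \<open>potential_exists\<close> leaves open is the extension to closed triangles:
  \<open>v\<close> extends continuously to \<open>T\<close>, so the gradient is bounded,
  \<open>q\<close> is Lipschitz on the convex interior and extends by uniform continuity.\<close>

lemma kernel_is_rot:
  assumes sc: "simply_connected \<Omega>" and v: "v \<in> L1_ps \<Omega> \<T> c m k"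
    and div: "\<forall>K\<in>ps_mesh c m \<T>. \<forall>z\<in>interior K. divergence v z = 0"
  shows "\<exists>q\<in>S0_ps \<Omega> \<T> c m (Suc k). \<forall>z\<in>\<Omega>. rot q z = v z"
proof -
  obtain q where dq: "\<And>z. z \<in> \<Omega> \<Longrightarrow> (q has_derivative dform v z) (at z)" and pq: "pieces (Suc k) q"
    using potential_exists[OF sc L1_psD(1,2)[OF v] div] by blast
  have p1: "partial 1 q z = - v z $ 2" and p2: "partial 2 q z = v z $ 1" if "z \<in> \<Omega>" for z
    unfolding has_derivative_imp_partial[OF dq[OF that]] by (simp_all add: dform_def axis_def)
  have rot: "rot q z = v z" if "z \<in> \<Omega>" for z
    using p1[OF that] p2[OF that] by (simp add: vec_eq_iff forall_2 rot_components)
  have "C1_on \<Omega> q"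
    unfolding C1_on_def
  proof (intro conjI ballI allI)
    show "q differentiable (at z)" if "z \<in> \<Omega>" for z using dq[OF that] unfolding differentiable_def by blast
    fix i
    have "continuous_on \<Omega> (\<lambda>z. - v z $ 2)" "continuous_on \<Omega> (\<lambda>z. v z $ 1)"
      using L1_psD(1)[OF v] by (auto intro!: continuous_on_minus continuous_on_component)
    then show "continuous_on \<Omega> (partial i q)"
      using exhaust_2[of i] p1 p2 by (auto cong: continuous_on_cong)
  qed
  moreover have "\<exists>w\<in>S0 (Suc k) T (ps_split c m T). \<forall>z\<in>T \<inter> \<Omega>. q z = w z" if T: "T \<in> \<T>" for T
  proof -
    obtain u where u: "continuous_on T u" "\<forall>z\<in>T \<inter> \<Omega>. v z = u z" using L1_psD(3)[OF v T] by blast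
    have "bounded (u ` T)" using u(1) compact_T[OF T] by (intro compact_imp_bounded compact_continuous_image)
    then obtain B where B: "\<And>z. z \<in> T \<Longrightarrow> norm (u z) \<le> B" unfolding bounded_iff by blast
    have int: "z \<in> T" "z \<in> \<Omega>" "v z = u z" if "z \<in> interior T" for z
      using that T_\<Omega>_closure(1)[OF T] u(2) by auto
    have B0: "0 \<le> B" using B[OF c_in[OF T]] norm_ge_zero order_trans by blast
    \<comment> \<open>The factor 2 comes from estimating the two terms of \<open>dform\<close>
      separately.\<close>
    have "norm (q x - q y) \<le> (2 * B) * norm (x - y)" if xy: "x \<in> interior T" "y \<in> interior T" for x y
    proof (rule differentiable_bound[OF _ _ _ xy, where f' = "dform v"])
      show "convex (interior T)" using convex_T[OF T] by (rule convex_interior)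
      show "(q has_derivative dform v z) (at z within interior T)" if "z \<in> interior T" for z
        using dq[OF int(2)[OF that]] by (rule has_derivative_at_withinI)
      show "onorm (dform v z) \<le> 2 * B" if z: "z \<in> interior T" for z
      proof (rule onorm_bound)
        fix h :: pt
        have "\<bar>v z $ i\<bar> \<le> B" for i
          using component_le_norm_cart[of "u z" i] B[OF int(1)[OF z]] int(3)[OF z] by simp
        then have "\<bar>v z $ 2\<bar> * \<bar>h $ 1\<bar> \<le> B * norm h" "\<bar>v z $ 1\<bar> * \<bar>h $ 2\<bar> \<le> B * norm h"
          using component_le_norm_cart[of h] B0 by (auto intro!: mult_mono)
        moreover have "\<bar>dform v z h\<bar> \<le> \<bar>v z $ 2\<bar> * \<bar>h $ 1\<bar> + \<bar>v z $ 1\<bar> * \<bar>h $ 2\<bar>"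
          unfolding dform_def abs_mult[symmetric] by linarith
        ultimately show "norm (dform v z h) \<le> 2 * B * norm h" by simp
      qed (use B0 in simp)
    qed
    then have "(2 * B)-lipschitz_on (interior T) q"
      using B0 by (intro lipschitz_onI) (auto simp: dist_norm)
    then have "uniformly_continuous_on (interior T) q" by (rule lipschitz_on_uniformly_continuous)
    then obtain w where "uniformly_continuous_on (closure (interior T)) w" "\<And>x. x \<in> interior T \<Longrightarrow> q x = w x"
      using uniformly_continuous_on_extension_on_closure by metis
    then have w: "continuous_on T w" "\<And>x. x \<in> interior T \<Longrightarrow> q x = w x"
      using uniformly_continuous_imp_continuous closure_interior_T[OF T] by auto
    have cq: "continuous_on \<Omega> q" using dq by (intro continuous_at_imp_continuous_on ballI has_derivative_continuous)
    have qw: "q z = w z" if "z \<in> T \<inter> \<Omega>" for z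
    proof (rule continuous_agree_on_closure[OF _ _ T_\<Omega>_closure(1,2)[OF T] w(2) that])
      show "continuous_on (T \<inter> \<Omega>) q" "continuous_on (T \<inter> \<Omega>) w"
        using cq w(1) by (auto intro: continuous_on_subset)
    qed
    have "w \<in> V2 (Suc k) (ps_split c m T)"
      by (rule pieces_on_T[OF pq T]) (rule w(2)[symmetric])
    moreover have "u \<in> ae_class T (rot w)"
      unfolding ae_class_def
    proof (intro CollectI AE_T_interiorI[OF T])
      fix z assume z: "z \<in> interior T"
      have "partial i w z = partial i q z" for i
      proof (rule partial_cong_open(2)[OF open_interior z])
        show "q differentiable at z" using dq[OF int(2)[OF z]] unfolding differentiable_def by blast
      qed (rule w(2)[symmetric])
      then have "rot w z = rot q z" by (simp add: rot_def)
      then show "u z = rot w z" using rot[OF int(2)[OF z]] int(3)[OF z] by simp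
    qed
    then have "ae_continuous_on T (rot w)" unfolding ae_continuous_on_def using u(1) by blast
    ultimately have "w \<in> S0 (Suc k) T (ps_split c m T)" using w(1) by (simp add: S0_def L0_def)
    then show ?thesis using qw by blast
  qed
  ultimately have "q \<in> S0_ps \<Omega> \<T> c m (Suc k)" unfolding S0_ps_def restricts_to_def by blast
  then show ?thesis using rot by blast
qed

lemma AE_divergence_zero:
  assumes v: "\<And>i. pieces k (\<lambda>z. v z $ i)" and AE: "AE z in lebesgue_on \<Omega>. divergence v z = 0"
    and K: "K \<in> ps_mesh c m \<T>" and z: "z \<in> interior K"
  shows "divergence v z = 0"
  by (rule AE_continuous_eq[OF AE \<Omega>_lebesgue open_interior interior_K_subset_\<Omega>[OF K]
        pieces_continuous[OF pieces_divergence[OF v] K] continuous_on_const z])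

text \<open>\<open>L\<close> is left open to serve both sequences: a divergence-free field of either
  space has its potential in the same \<open>S0_ps\<close>.\<close>

lemma exact_rot:
  assumes sc: "simply_connected \<Omega>"
    and L: "L \<subseteq> L1_ps \<Omega> \<T> c m k" "\<And>q. q \<in> S0_ps \<Omega> \<T> c m (Suc k) \<Longrightarrow> rot q \<in> L"
  shows "exact_at \<Omega> (S0_ps \<Omega> \<T> c m (Suc k)) rot L divergence"
  unfolding exact_at_def
proof (intro equalityI subsetI)
  fix C assume "C \<in> (\<lambda>u. ae_class \<Omega> (rot u)) ` S0_ps \<Omega> \<T> c m (Suc k)"
  then obtain q where q: "q \<in> S0_ps \<Omega> \<T> c m (Suc k)" "C = ae_class \<Omega> (rot q)" by blast
  have "ae_class \<Omega> (divergence (rot q)) = ae_class \<Omega> (\<lambda>_. 0)"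
    unfolding ae_class_eq_iff by (intro AE_meshI \<Omega>_lebesgue closure_subset) (rule S0_ps_rot(2)[OF q(1)])
  then show "C \<in> ae_class \<Omega> ` {v \<in> L. ae_class \<Omega> (divergence v) = ae_class \<Omega> (\<lambda>_. 0)}"
    using L(2)[OF q(1)] q(2) by blast
next
  fix C assume "C \<in> ae_class \<Omega> ` {v \<in> L. ae_class \<Omega> (divergence v) = ae_class \<Omega> (\<lambda>_. 0)}"
  then obtain v where v: "v \<in> L" "AE z in lebesgue_on \<Omega>. divergence v z = 0" "C = ae_class \<Omega> v"
    by (auto simp: ae_class_eq_iff)
  have v1: "v \<in> L1_ps \<Omega> \<T> c m k" using v(1) L(1) by blast
  obtain q where q: "q \<in> S0_ps \<Omega> \<T> c m (Suc k)" "\<forall>z\<in>\<Omega>. rot q z = v z"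
    using kernel_is_rot[OF sc v1] AE_divergence_zero[OF L1_psD(2)[OF v1] v(2)] by blast
  have "ae_class \<Omega> v = ae_class \<Omega> (rot q)"
    unfolding ae_class_eq_iff by (intro AE_meshI \<Omega>_lebesgue closure_subset) (use q(2) in simp)
  then show "C \<in> (\<lambda>u. ae_class \<Omega> (rot u)) ` S0_ps \<Omega> \<T> c m (Suc k)" using q(1) v(3) by blast
qed

subsection \<open>The range of the divergence\<close>

lemma fields_L1_ps: assumes "v \<in> fields k" shows "v \<in> L1_ps \<Omega> \<T> c m k"
proof (rule L1_psI)
  have c: "continuous_on (closure \<Omega>) v"
    using assms by (intro continuous_on_vec_components) (simp add: fields_def)
  then show "continuous_on \<Omega> v" using closure_subset by (rule continuous_on_subset)
  show "pieces k (\<lambda>z. v z $ i)" for i using assms by (simp add: fields_def pieces_def)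
  fix T assume "T \<in> \<T>"
  then have "continuous_on T v" using c T_subset by (blast intro: continuous_on_subset)
  then show "\<exists>w. continuous_on T w \<and> (\<forall>z\<in>T \<inter> \<Omega>. v z = w z)" by blast
qed

text \<open>A divergence has uncontrolled values on the skeleton. It is replaced by a bounded Borel
  function with the same values on open cells, which can serve as an element of
  \<open>V2_ps\<close>.\<close>

lemma pieces_measurable_representative:
  assumes "pieces k f"
  shows "\<exists>p\<in>borel_measurable borel. (\<exists>B. \<forall>z\<in>\<Omega>. \<bar>p z\<bar> \<le> B) \<and> (\<forall>K\<in>ps_mesh c m \<T>. \<forall>z\<in>interior K. p z = f z)"
proof -
  have "\<exists>p\<in>borel_measurable borel. (\<exists>B. \<forall>z\<in>\<Omega>. \<bar>p z\<bar> \<le> B) \<and> (\<forall>K\<in>\<K>. \<forall>z\<in>interior K. p z = f z)"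
    if "\<K> \<subseteq> ps_mesh c m \<T>" for \<K>
    using finite_subset[OF that finite_ps_mesh] that
  proof (induction \<K> rule: finite_induct)
    case empty
    show ?case by (intro bexI[of _ "\<lambda>_. 0"]) auto
  next
    case (insert K \<K>)
    then obtain p B where p: "p \<in> borel_measurable borel" "\<forall>z\<in>\<Omega>. \<bar>p z\<bar> \<le> B" "\<forall>K\<in>\<K>. \<forall>z\<in>interior K. p z = f z" by auto
    obtain q where q: "q \<in> poly2 k" "\<forall>z\<in>interior K. f z = q z" using piecesE[OF assms, of K] insert.prems by blast
    have "bounded (q ` closure \<Omega>)"
      using bounded_\<Omega> poly2_continuous[OF q(1)] by (intro compact_imp_bounded compact_continuous_image) (simp_all add: compact_closure)
    then obtain B' where B': "\<forall>z\<in>closure \<Omega>. \<bar>q z\<bar> \<le> B'" unfolding bounded_iff by auto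
    let ?p = "\<lambda>z. if z \<in> interior K then q z else p z"
    have "q \<in> borel_measurable borel"
      using poly2_continuous[OF q(1), of UNIV] by (rule borel_measurable_continuous_onI)
    then have "?p \<in> borel_measurable borel"
      using p(1) by (intro measurable_If_set) auto
    moreover have "\<forall>z\<in>\<Omega>. \<bar>?p z\<bar> \<le> max B B'"
    proof
      fix z assume z: "z \<in> \<Omega>"
      then have "\<bar>q z\<bar> \<le> B'" using B' closure_subset by blast
      moreover have "\<bar>p z\<bar> \<le> B" using p(2) z by blast
      ultimately show "\<bar>?p z\<bar> \<le> max B B'" by auto
    qed
    moreover have "\<forall>K'\<in>insert K \<K>. \<forall>z\<in>interior K'. ?p z = f z" using p(3) q(2) by auto
    ultimately show ?case by (intro bexI[of _ ?p] conjI exI[of _ "max B B'"])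
  qed
  then show ?thesis by blast
qed

lemma square_integrable:
  assumes "p \<in> borel_measurable borel" "\<forall>z\<in>\<Omega>. \<bar>p z\<bar> \<le> B"
  shows "square_integrable_on \<Omega> p"
proof -
  have meas: "p \<in> borel_measurable (lebesgue_on \<Omega>)"
    using assms(1) by (intro measurable_restrict_space1 measurable_completion) simp
  have "finite_measure (lebesgue_on \<Omega>)"
    using lmeasurable_open[OF bounded_\<Omega> open_\<Omega>] by (rule finite_measure_lebesgue_on)
  then have "integrable (lebesgue_on \<Omega>) (\<lambda>x. (p x)\<^sup>2)"
  proof (rule finite_measure.integrable_const_bound)
    have "norm ((p x)\<^sup>2) \<le> B\<^sup>2" if "x \<in> \<Omega>" for x
      using assms(2) that power_mono[of "\<bar>p x\<bar>" B 2] by simp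
    then show "AE x in lebesgue_on \<Omega>. norm ((p x)\<^sup>2) \<le> B\<^sup>2"
      by (intro AE_I2) (simp add: space_restrict_space)
  qed (use meas in measurable)
  then show ?thesis using meas by (simp add: square_integrable_on_def)
qed

text \<open>Only the geometry of the edge is of interest, so the degree parameter is set to
  1.\<close>

lemma interior_vertex_shared:
  assumes "z \<in> ps_edge_points m \<T> \<inter> \<Omega>"
  obtains T e a b s t Y \<beta> T' \<alpha> where "z = m e" "shared_edge \<Omega> \<T> c m T e a b s t Y \<beta> 1 T' \<alpha>"
proof -
  obtain T e where T: "T \<in> \<T>" "e edge_of T" "z = m e" using assms unfolding ps_edge_points_def by blast
  have "m e \<in> \<Omega>" using assms T(3) by blast
  then obtain T' where T': "T' \<in> \<T>" "T' \<noteq> T" "e edge_of T'"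
    using shared_of_mem_\<Omega>[OF T(1,2) m_rel_interior[OF T(1,2)]] by blast
  show ?thesis using shared_edge_exists[OF T(1,2) _ T', of 1] that[OF T(3)] by blast
qed

lemma theta_divergence_zero:
  assumes v: "v \<in> L1_ps \<Omega> \<T> c m k" and p: "\<And>K z. K \<in> ps_mesh c m \<T> \<Longrightarrow> z \<in> interior K \<Longrightarrow> p z = divergence v z"
    and z: "z \<in> ps_edge_points m \<T> \<inter> \<Omega>"
  shows "theta (ps_mesh c m \<T>) z p = 0"
proof -
  obtain T e a b s t Y \<beta> T' \<alpha> where ze: "z = m e" and S: "shared_edge \<Omega> \<T> c m T e a b s t Y \<beta> 1 T' \<alpha>"
    using interior_vertex_shared[OF z] .
  show ?thesis
    unfolding ze
  proof (rule shared_edge.theta_divergence[OF S, where v = v and k' = k])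
    show "continuous_on \<Omega> (\<lambda>z. v z $ i)" for i using L1_psD(1)[OF v] by (rule continuous_on_component)
    show "\<exists>p\<in>poly2 k. \<forall>z\<in>interior K. v z $ i = p z" if "K \<in> ps_mesh c m \<T>" for K i
      using L1_psD(2)[OF v] that by (simp add: pieces_def)
  qed (rule p)
qed

text \<open>All four one-sided values equal \<open>p (m e)\<close> and cancel.\<close>

lemma theta_continuous_zero:
  assumes p: "continuous_on \<Omega> p" "pieces k p" and z: "z \<in> ps_edge_points m \<T> \<inter> \<Omega>"
  shows "theta (ps_mesh c m \<T>) z p = 0"
proof -
  obtain T e a b s t Y \<beta> T' \<alpha> where ze: "z = m e" and S: "shared_edge \<Omega> \<T> c m T e a b s t Y \<beta> 1 T' \<alpha>"
    using interior_vertex_shared[OF z] .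
  interpret S: shared_edge \<Omega> \<T> c m T e a b s t Y \<beta> 1 T' \<alpha> by (rule S)
  have "value_from (S.C g h) p (m e) = p (m e)" if gh: "S.GH g h" for g h
  proof -
    obtain q where q: "q \<in> poly2 k" "\<forall>z\<in>interior (S.C g h). p z = q z"
      using piecesE[OF p(2) S.cell_in_mesh[OF gh]] by blast
    have "value_from (S.C g h) p (m e) = q (m e)"
      using q(2) S.interior_C'[of g h] gh by (intro S.value_from_eq[OF gh q(1)]) simp
    also have "\<dots> = p (m e)"
      by (rule eq_on_cell[OF p(1) S.cell_in_mesh[OF gh] q(1) _ S.m_in_C S.m_in_\<Omega>, symmetric]) (use q(2) in blast)
    finally show ?thesis .
  qed
  then show ?thesis unfolding ze S.theta_eq by simp
qed

text \<open>Exactness concerns classes modulo null sets, so the divergence may be redefined on the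
  skeleton; \<open>theta\<close> sees only limits from inside the cells.\<close>

lemma exact_divergence_V2:
  assumes k: "1 \<le> k"
  shows "exact_at \<Omega> (L1_ps \<Omega> \<T> c m k) divergence (V2_ps \<Omega> \<T> c m (k - 1)) (\<lambda>_ _. 0 :: real)"
  unfolding exact_at_def
proof (intro equalityI subsetI)
  fix C assume "C \<in> (\<lambda>u. ae_class \<Omega> (divergence u)) ` L1_ps \<Omega> \<T> c m k"
  then obtain v where v: "v \<in> L1_ps \<Omega> \<T> c m k" "C = ae_class \<Omega> (divergence v)" by blast
  obtain p B where p: "p \<in> borel_measurable borel" "\<forall>z\<in>\<Omega>. \<bar>p z\<bar> \<le> B"
    and pv: "\<forall>K\<in>ps_mesh c m \<T>. \<forall>z\<in>interior K. p z = divergence v z"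
    using pieces_measurable_representative[OF pieces_divergence[OF L1_psD(2)[OF v(1)]]] by blast
  have "pieces (k - 1) p"
    using pieces_divergence[OF L1_psD(2)[OF v(1)]] pv unfolding pieces_def by simp
  then have "restricts_to \<Omega> T p (V2 (k - 1) (ps_split c m T))" if "T \<in> \<T>" for T
    unfolding restricts_to_def using V2_pieces[OF _ that] by (intro bexI[of _ p]) simp_all
  moreover have "theta (ps_mesh c m \<T>) z p = 0" if "z \<in> ps_edge_points m \<T> \<inter> \<Omega>" for z
    by (rule theta_divergence_zero[OF v(1) _ that]) (use pv in blast)
  ultimately have "p \<in> V2_ps \<Omega> \<T> c m (k - 1)"
    using square_integrable[OF p] by (simp add: V2_ps_def)
  moreover have "C = ae_class \<Omega> p"
    unfolding v(2) ae_class_eq_iff by (intro AE_meshI \<Omega>_lebesgue closure_subset) (use pv in simp)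
  ultimately show "C \<in> ae_class \<Omega> ` {p \<in> V2_ps \<Omega> \<T> c m (k - 1). ae_class \<Omega> (\<lambda>_. 0 :: real) = ae_class \<Omega> (\<lambda>_. 0)}"
    by blast
next
  fix C assume "C \<in> ae_class \<Omega> ` {p \<in> V2_ps \<Omega> \<T> c m (k - 1). ae_class \<Omega> (\<lambda>_. 0 :: real) = ae_class \<Omega> (\<lambda>_. 0)}"
  then obtain p where p: "p \<in> V2_ps \<Omega> \<T> c m (k - 1)" "C = ae_class \<Omega> p" by blast
  have "pieces (k - 1) p"
    by (rule pieces_V2) (use p(1) in \<open>simp add: V2_ps_def restricts_to_def\<close>)
  moreover have "theta (ps_mesh c m \<T>) z p = 0" if "z \<in> ps_edge_points m \<T> \<inter> \<Omega>" for z
    using p(1) that by (simp add: V2_ps_def)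
  ultimately have "p \<in> divs k" unfolding pieces_def using divs_surjective[OF k] by blast
  then obtain v where v: "v \<in> fields k" "\<forall>K\<in>ps_mesh c m \<T>. \<forall>z\<in>interior K. divergence v z = p z"
    unfolding divs_def by blast
  have "C = ae_class \<Omega> (divergence v)"
    unfolding p(2) ae_class_eq_iff by (intro AE_meshI \<Omega>_lebesgue closure_subset) (use v(2) in simp)
  then show "C \<in> (\<lambda>u. ae_class \<Omega> (divergence u)) ` L1_ps \<Omega> \<T> c m k" using fields_L1_ps[OF v(1)] by blast
qed

text \<open>Two continuous representatives are at hand, one on \<Omega> from the global condition
  and one on the closed \<open>T\<close> from the local one; they agree on the interior of
  \<open>T\<close>, so the second extends the first.\<close>

lemma S1_ps_divergence:
  assumes "v \<in> S1_ps \<Omega> \<T> c m k"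
  shows "\<exists>g\<in>L2_ps \<Omega> \<T> c m (k - 1). AE z in lebesgue_on \<Omega>. divergence v z = g z"
proof -
  have v1: "v \<in> L1_ps \<Omega> \<T> c m k" using S1_ps_subset[OF assms] .
  have pv: "pieces (k - 1) (divergence v)" using pieces_divergence[OF L1_psD(2)[OF v1]] .
  obtain g where g: "continuous_on \<Omega> g" "AE z in lebesgue_on \<Omega>. g z = divergence v z"
    using assms by (auto simp: S1_ps_def ae_continuous_on_def ae_class_def)
  have gv: "g z = divergence v z" if K: "K \<in> ps_mesh c m \<T>" and z: "z \<in> interior K" for K z
    by (rule AE_continuous_eq[OF g(2) \<Omega>_lebesgue open_interior interior_K_subset_\<Omega>[OF K] _ pieces_continuous[OF pv K] z])
       (rule continuous_on_subset[OF g(1) interior_K_subset_\<Omega>[OF K]])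
  have pg: "pieces (k - 1) g" using pv gv unfolding pieces_def by simp
  have "\<exists>w\<in>L0 (k - 1) T (ps_split c m T). \<forall>z\<in>T \<inter> \<Omega>. g z = w z" if T: "T \<in> \<T>" for T
  proof -
    obtain u where u: "u \<in> S1 k T (ps_split c m T)" "\<forall>z\<in>T \<inter> \<Omega>. v z = u z"
      using assms T by (auto simp: S1_ps_def restricts_to_def)
    obtain w where w: "continuous_on T w" "AE z in lebesgue_on T. w z = divergence u z"
      using u(1) by (auto simp: S1_def ae_continuous_on_def ae_class_def)
    have AEg: "negligible {z \<in> \<Omega>. g z \<noteq> divergence v z}" "negligible {z \<in> T. w z \<noteq> divergence u z}"
      using g(2) w(2) unfolding AE_lebesgue_on_iff_negligible[OF \<Omega>_lebesgue] AE_lebesgue_on_iff_negligible[OF T_lebesgue[OF T]] .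
    have gw: "w z = g z" if z: "z \<in> interior T" for z
    proof (rule continuous_eq_of_negligible[OF open_interior _ _ _ z])
      show "continuous_on (interior T) w" using w(1) interior_subset by (rule continuous_on_subset)
      show "continuous_on (interior T) g" using g(1) interior_subset_\<Omega>[OF T] by (rule continuous_on_subset)
      show "negligible {x \<in> interior T. w x \<noteq> g x}"
      proof (rule negligible_subset[OF negligible_Un[OF negligible_Un[OF AEg] negligible_skeleton]])
        show "{x \<in> interior T. w x \<noteq> g x} \<subseteq> {z \<in> \<Omega>. g z \<noteq> divergence v z} \<union> {z \<in> T. w z \<noteq> divergence u z}
            \<union> (closure \<Omega> - (\<Union>K\<in>ps_mesh c m \<T>. interior K))"
        proof
          fix x assume "x \<in> {x \<in> interior T. w x \<noteq> g x}"
          then have x: "x \<in> interior T" "w x \<noteq> g x" by auto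
          then have xT: "x \<in> T" "x \<in> \<Omega>" using T_\<Omega>_closure(1)[OF T] by auto
          show "x \<in> {z \<in> \<Omega>. g z \<noteq> divergence v z} \<union> {z \<in> T. w z \<noteq> divergence u z}
            \<union> (closure \<Omega> - (\<Union>K\<in>ps_mesh c m \<T>. interior K))"
          proof (cases "\<exists>K\<in>ps_mesh c m \<T>. x \<in> interior K")
            case True
            then obtain K where K: "K \<in> ps_mesh c m \<T>" "x \<in> interior K" by blast
            have "divergence u x = divergence v x"
            proof (rule divergence_cong_open[OF open_interior x(1)])
              show "u y = v y" if "y \<in> interior T" for y
              proof -
                have "y \<in> T \<inter> \<Omega>" using that T_\<Omega>_closure(1)[OF T] by blast
                then show ?thesis using u(2) by simp
              qed
              show "(\<lambda>y. v y $ i) differentiable at x" for i by (rule pieces_differentiable[OF L1_psD(2)[OF v1] K])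
            qed
            then show ?thesis using x(2) xT by auto
          next
            case False
            then show ?thesis using xT(2) closure_subset by blast
          qed
        qed
      qed
    qed
    have "g z = w z" if "z \<in> T \<inter> \<Omega>" for z
    proof (rule continuous_agree_on_closure[OF _ _ T_\<Omega>_closure(1,2)[OF T] _ that])
      show "continuous_on (T \<inter> \<Omega>) g" "continuous_on (T \<inter> \<Omega>) w"
        using g(1) w(1) by (auto intro: continuous_on_subset)
    qed (simp add: gw)
    moreover have "w \<in> L0 (k - 1) T (ps_split c m T)"
      using pieces_on_T[OF pg T gw] w(1) by (simp add: L0_def)
    ultimately show ?thesis by blast
  qed
  then have "g \<in> L2_ps \<Omega> \<T> c m (k - 1)" using g(1) by (simp add: L2_ps_def restricts_to_def)
  then show ?thesis by (intro bexI[of _ g] AE_meshI \<Omega>_lebesgue closure_subset) (simp_all add: gv)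
qed

text \<open>The field from \<open>divs_surjective\<close> already works: its divergence is almost
  everywhere the continuous function \<open>p\<close>, which extends to each triangle, and
  \<open>S1_ps\<close> adds nothing more.\<close>

lemma exact_divergence_L2:
  assumes k: "1 \<le> k"
  shows "exact_at \<Omega> (S1_ps \<Omega> \<T> c m k) divergence (L2_ps \<Omega> \<T> c m (k - 1)) (\<lambda>_ _. 0 :: real)"
  unfolding exact_at_def
proof (intro equalityI subsetI)
  fix C assume "C \<in> (\<lambda>u. ae_class \<Omega> (divergence u)) ` S1_ps \<Omega> \<T> c m k"
  then obtain v where v: "v \<in> S1_ps \<Omega> \<T> c m k" "C = ae_class \<Omega> (divergence v)" by blast
  then obtain g where "g \<in> L2_ps \<Omega> \<T> c m (k - 1)" "AE z in lebesgue_on \<Omega>. divergence v z = g z"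
    using S1_ps_divergence by blast
  then show "C \<in> ae_class \<Omega> ` {p \<in> L2_ps \<Omega> \<T> c m (k - 1). ae_class \<Omega> (\<lambda>_. 0 :: real) = ae_class \<Omega> (\<lambda>_. 0)}"
    using v(2) by (auto simp: ae_class_eq_iff)
next
  fix C assume "C \<in> ae_class \<Omega> ` {p \<in> L2_ps \<Omega> \<T> c m (k - 1). ae_class \<Omega> (\<lambda>_. 0 :: real) = ae_class \<Omega> (\<lambda>_. 0)}"
  then obtain p where p: "p \<in> L2_ps \<Omega> \<T> c m (k - 1)" "C = ae_class \<Omega> p" by blast
  have cp: "continuous_on \<Omega> p" using p(1) by (simp add: L2_ps_def)
  have res: "\<exists>w\<in>L0 (k - 1) T (ps_split c m T). \<forall>z\<in>T \<inter> \<Omega>. p z = w z" if "T \<in> \<T>" for T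
    using p(1) that by (simp add: L2_ps_def restricts_to_def)
  have pp: "pieces (k - 1) p"
    by (rule pieces_V2) (use res in \<open>auto simp: L0_def\<close>)
  have "p \<in> divs k"
    using divs_surjective[OF k, of p] pp theta_continuous_zero[OF cp pp] unfolding pieces_def by blast
  then obtain v where v: "v \<in> fields k" "\<forall>K\<in>ps_mesh c m \<T>. \<forall>z\<in>interior K. divergence v z = p z"
    unfolding divs_def by blast
  have "v \<in> S1_ps \<Omega> \<T> c m k"
  proof (rule S1_psI[OF fields_L1_ps[OF v(1)] cp])
    show "p z = divergence v z" if "K \<in> ps_mesh c m \<T>" "z \<in> interior K" for K z using v(2) that by simp
    show "\<exists>w. continuous_on T w \<and> (\<forall>z\<in>T \<inter> \<Omega>. p z = w z)" if "T \<in> \<T>" for T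
      using res[OF that] by (auto simp: L0_def)
  qed
  moreover have "C = ae_class \<Omega> (divergence v)"
    unfolding p(2) ae_class_eq_iff by (intro AE_meshI \<Omega>_lebesgue closure_subset) (use v(2) in simp)
  ultimately show "C \<in> (\<lambda>u. ae_class \<Omega> (divergence u)) ` S1_ps \<Omega> \<T> c m k" by blast
qed

lemma S0_ps_rot_S1_ps:
  assumes "q \<in> S0_ps \<Omega> \<T> c m (Suc k)" shows "rot q \<in> S1_ps \<Omega> \<T> c m k"
proof (rule S1_psI[where g = "\<lambda>_. 0"])
  show "rot q \<in> L1_ps \<Omega> \<T> c m k" using S0_ps_rot(1)[OF assms] by simp
  show "0 = divergence (rot q) z" if "K \<in> ps_mesh c m \<T>" "z \<in> interior K" for K z
    using S0_ps_rot(2)[OF assms that] by simp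
  show "\<exists>w. continuous_on T w \<and> (\<forall>z\<in>T \<inter> \<Omega>. (0::real) = w z)" for T by (intro exI[of _ "\<lambda>_. 0"]) simp
qed simp

end

theorem theorem5p4:
  fixes \<Omega> :: "(real^2) set" and \<T> :: "(real^2) set set"
    and c m :: "(real^2) set \<Rightarrow> real^2" and \<sigma> :: real
  assumes "polygonal_domain \<Omega>"
    and "simply_connected \<Omega>"
    and "conforming_mesh \<Omega> \<T>"
    and "shape_regular \<sigma> \<T>"
    and "powell_sabin \<Omega> \<T> c m"
  shows "(\<forall>r\<ge>2. exact_rot_div \<Omega> (S0_ps \<Omega> \<T> c m r) (L1_ps \<Omega> \<T> c m (r - 1))
                   (V2_ps \<Omega> \<T> c m (r - 2))) \<and>
         (\<forall>r\<ge>3. exact_rot_div \<Omega> (S0_ps \<Omega> \<T> c m r) (S1_ps \<Omega> \<T> c m (r - 1))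
                   (L2_ps \<Omega> \<T> c m (r - 2)))"
proof -
  interpret ps_refinement \<Omega> \<T> c m using assms by unfold_locales
  \<comment> \<open>Written with \<open>k = r - 1\<close>, which leaves \<open>k - 1\<close> as the
    only truncated subtraction.\<close>
  have "exact_rot_div \<Omega> (S0_ps \<Omega> \<T> c m (Suc k)) (L1_ps \<Omega> \<T> c m k) (V2_ps \<Omega> \<T> c m (k - 1)) \<and>
    exact_rot_div \<Omega> (S0_ps \<Omega> \<T> c m (Suc k)) (S1_ps \<Omega> \<T> c m k) (L2_ps \<Omega> \<T> c m (k - 1))" if k: "1 \<le> k" for k
    unfolding exact_rot_div_def
  proof (intro conjI exact_constants exact_divergence_V2 exact_divergence_L2 k)
    show "exact_at \<Omega> (S0_ps \<Omega> \<T> c m (Suc k)) rot (L1_ps \<Omega> \<T> c m k) divergence"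
      using S0_ps_rot(1)[of _ "Suc k"] by (intro exact_rot assms(2)) auto
    show "exact_at \<Omega> (S0_ps \<Omega> \<T> c m (Suc k)) rot (S1_ps \<Omega> \<T> c m k) divergence"
      using S1_ps_subset S0_ps_rot_S1_ps by (intro exact_rot assms(2)) auto
  qed
  note main = this
  have *: "exact_rot_div \<Omega> (S0_ps \<Omega> \<T> c m r) (L1_ps \<Omega> \<T> c m (r - 1)) (V2_ps \<Omega> \<T> c m (r - 2)) \<and>
    exact_rot_div \<Omega> (S0_ps \<Omega> \<T> c m r) (S1_ps \<Omega> \<T> c m (r - 1)) (L2_ps \<Omega> \<T> c m (r - 2))" if "2 \<le> r" for r
  proof -
    have "Suc (r - 1) = r" "r - 1 - 1 = r - 2" "1 \<le> r - 1" using that by auto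
    then show ?thesis using main[of "r - 1"] by simp
  qed
  then show ?thesis by auto
qed

end
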